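(* Let $X=\mathbb{R}^d$ with Borel $\sigma$-algebra $\mathcal{A}$, let $\mathbb{V},\mathbb{W}$ be Banach spaces over $\mathbb{F}\in\{\mathbb{R},\mathbb{C}\}$, and let $k\ge0$ be an integer. Let $\mu\in C^k[L(\mathbb{V},\mathbb{W}),\mathscr{T}_{sv}]$ have continuous semivariation $\widehat{\mu}$, and let $\varphi\in C_B^k[X,L(\mathbb{V})]$. Then $\mu\varphi\in C^k[L(\mathbb{V},\mathbb{W}),\mathscr{T}_{sv}]$ and for every multivector $h\in M_0^kX$ (of order at most $k$) $$\partial_h(\mu\varphi)=\sum_{\alpha+\beta=h}C(\alpha,\beta)\cdot\partial_\alpha\mu\cdot\partial_\beta\varphi ,$$ where the sum is over all ordered pairs $(\alpha,\beta)$ of multivectors with $\alpha+\beta=h$.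
   Context: $L(\mathbb{V},\mathbb{W})$ is the space of bounded linear operators with the operator norm, $L(\mathbb{V})=L(\mathbb{V},\mathbb{V})$. $\mathrm{CA}[\mathcal{A},Y]$ is the set of $Y$-valued measures on $\mathcal{A}$ countably additive in the norm of $Y$. Semivariation: for $\mu\in\mathrm{CA}[\mathcal{A},L(\mathbb{V},\mathbb{W})]$, $\widehat{\mu}(A)=\sup\{\|\sum_{i=1}^m\mu(A_i)v_i\|_{\mathbb{W}}: A_i\in\mathcal{A}\text{ disjoint, finitely many, contained in }A,\ \|v_i\|\le1\}$. It is continuous if $A_n\searrow\varnothing$ in $\mathcal{A}$ implies $\widehat{\mu}(A_n)\to0$; this implies $\widehat\mu(X)<\infty$. Put $\|\mu\|_{sv}=\widehat{\mu}(X)$; $\mathscr{T}_{sv}$ is the topology it induces. Smoothness: $\mu_x(A)=\mu(A+x)$. $\mu\in C^k[L(\mathbb{V},\mathbb{W}),\mathscr{T}_{sv}]$ means that $T_\mu:X\ni x\mapsto\mu_x\in\mathrm{CA}[\mathcal{A},L(\mathbb{V},\mathbb{W})]$ is $k$ times continuously (Fréchet) differentiable with respect to $\|\cdot\|_{sv}$ (continuous if $k=0$). The Fomin derivative along $h\in X$ is $\partial_h\mu=\lim_{t\to0}(\mu_{th}-\mu)/t$; higher mixed derivatives are obtained by iteration. Multivectors: a multivector is a function $h:X\to\{0,1,2,\dots\}$ with $|h|:=\sum_{x\in X}h(x)<\infty$; $M_0^kX$ is the set of those with $|h|\le k$. $\partial_h$ denotes the mixed derivative in which each $x\in X$ is used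 $h(x)$ times (for $C^k$ objects and $|h|\le k$ the order is irrelevant); for $h=0$ it is the identity. $C(\alpha,\beta)=\prod_{x\in X}\frac{(\alpha(x)+\beta(x))!}{\alpha(x)!\,\beta(x)!}$. $C_B^k[X,L(\mathbb{V})]$ is the space of $k$ times continuously differentiable functions $X\to L(\mathbb{V})$ that are bounded together with all derivatives of order up to $k$. Dobrakov integral: for a countably additive operator-valued measure $m:\mathcal{A}\to L(E,G)$ ($E,G$ Banach) of finite semivariation and a simple function $s=\sum_i\chi_{A_i}v_i$ ($A_i\in\mathcal A$ disjoint, finitely many, $v_i\in E$), $\int_As\,dm=\sum_i m(A\cap A_i)v_i$. A function $f:X\to E$ is Dobrakov integrable if there are simple $s_n\to f$ almost everywhere (outside a set of zero semivariation) such that $\lim_n\int_As_n\,dm$ exists for every $A\in\mathcal{A}$; then $\int_Af\,dm$ is this limit (independent of the sequence). Product: for $\mu\in\mathrm{CA}[\mathcal{A},L(\mathbb{V},\mathbb{W})]$ with continuous semivariation, let $M:\mathcal{A}\to L[L(\mathbb{V}),L(\mathbb{V},\mathbb{W})]$, $M(A)[F]=\mu(A)\circ F$. For a bounded continuous $\varphi:X\to L(\mathbb{V})$ (automatically $M$-integrable), $\mu\varphi=\mu\cdot\varphi$ is the measure $A\mapsto\int_A\varphi\,dM\in L(\mathbb{V},\mathbb{W})$; the same notation is used with $\partial_\alpha\mu$ (whose semivariation is again continuous) in place of $\mu$. *)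

theory Defs
  imports "HOL-Analysis.Analysis" "HOL-Library.Multiset"
begin

section \<open>Normed spaces over the scalar field and bounded operators\<close>

text \<open>
  Normed spaces over \<open>F \<in> {\<real>, \<complex>}\<close> are real normed spaces carrying a compatible multiplication by
  scalars from a type \<open>'f::real_normed_field\<close>. By the theorems of Gelfand--Mazur and Ostrowski, the
  real and the complex numbers are, up to isometric isomorphism, the only instances of this class.
\<close>

locale normed_space_over = vector_space scale
  for scale :: "'f::real_normed_field \<Rightarrow> 'v::real_normed_vector \<Rightarrow> 'v" +
  assumes norm_scale: "norm (scale a x) = norm a * norm x"
    and scale_of_real: "scale (of_real r) x = r *\<^sub>R x"

text \<open>
  \<open>L(V,W)\<close>. A bounded real-linear operator is a bounded operator over the scalar field iff it is
  linear over that field; the operator norms agree.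
\<close>

definition bounded_ops ::
  "('f::real_normed_field \<Rightarrow> 'v::real_normed_vector \<Rightarrow> 'v) \<Rightarrow>
   ('f \<Rightarrow> 'w::real_normed_vector \<Rightarrow> 'w) \<Rightarrow> ('v \<Rightarrow>\<^sub>L 'w) set" where
  "bounded_ops sV sW = {T. Vector_Spaces.linear sV sW (blinfun_apply T)}"

section \<open>Operator-valued Borel measures and semivariation\<close>

text \<open>
  Measures on the Borel sets are total set functions that vanish off the Borel sets, so that equal
  measures are equal functions. The set \<open>Y\<close> is the space of admissible values.
\<close>

definition CA :: "'y set \<Rightarrow> ('a::topological_space set \<Rightarrow> 'y::real_normed_vector) set" where
  "CA Y = {\<mu>. (\<forall>A\<in>sets borel. \<mu> A \<in> Y) \<and> (\<forall>A. A \<notin> sets borel \<longrightarrow> \<mu> A = 0) \<and>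
     (\<forall>A::nat \<Rightarrow> 'a set. range A \<subseteq> sets borel \<longrightarrow> disjoint_family A \<longrightarrow>
        (\<lambda>n. \<mu> (A n)) sums \<mu> (\<Union>n. A n))}"

text \<open>
  The vectors are taken from a subset \<open>E\<close> of the domain type, because the integrator of the product
  below acts on \<open>L(V)\<close>, which over the complex numbers is only a subspace of the type of bounded
  real-linear operators.
\<close>

definition semivariation ::
  "'e set \<Rightarrow> ('a::topological_space set \<Rightarrow> 'e::real_normed_vector \<Rightarrow>\<^sub>L 'g::real_normed_vector) \<Rightarrow>
   'a set \<Rightarrow> ennreal" where
  "semivariation E m A =
     (SUP (n, B, v) \<in> {(n::nat, B, v). disjoint_family_on B {..<n} \<and>
          (\<forall>i<n. B i \<in> sets borel \<and> B i \<subseteq> A \<and> v i \<in> E \<and> norm (v i) \<le> 1)}.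
        ennreal (norm (\<Sum>i<n. blinfun_apply (m (B i)) (v i))))"

definition continuous_semivariation ::
  "('a::topological_space set \<Rightarrow> 'v::real_normed_vector \<Rightarrow>\<^sub>L 'w::real_normed_vector) \<Rightarrow> bool" where
  "continuous_semivariation \<mu> \<longleftrightarrow>
     (\<forall>A::nat \<Rightarrow> 'a set. range A \<subseteq> sets borel \<longrightarrow> decseq A \<longrightarrow> (\<Inter>n. A n) = {} \<longrightarrow>
        (\<lambda>n. semivariation UNIV \<mu> (A n)) \<longlonglongrightarrow> 0)"

lemma semivariation_upper:
  fixes n :: nat
  assumes "disjoint_family_on B {..<n}"
    and "\<And>i. i < n \<Longrightarrow> B i \<in> sets borel \<and> B i \<subseteq> A \<and> v i \<in> E \<and> norm (v i) \<le> 1"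
  shows "ennreal (norm (\<Sum>i<n. blinfun_apply (m (B i)) (v i))) \<le> semivariation E m A"
  unfolding semivariation_def by (rule SUP_upper2[of "(n, B, v)"]) (use assms in auto)

lemma semivariation_least:
  assumes "\<And>(n::nat) B v. disjoint_family_on B {..<n} \<Longrightarrow>
      (\<And>i. i < n \<Longrightarrow> B i \<in> sets borel \<and> B i \<subseteq> A \<and> v i \<in> E \<and> norm (v i) \<le> 1) \<Longrightarrow>
      ennreal (norm (\<Sum>i<n. blinfun_apply (m (B i)) (v i))) \<le> c"
  shows "semivariation E m A \<le> c"
  unfolding semivariation_def by (rule SUP_least) (auto intro!: assms)

lemma semivariation_zero: "semivariation E (\<lambda>A. 0) A = 0"
proof -
  have "semivariation E (\<lambda>A. 0) A \<le> 0" by (rule semivariation_least) simp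
  then show ?thesis by simp
qed

lemma semivariation_add:
  fixes m m' :: "'a::topological_space set \<Rightarrow> 'b::real_normed_vector \<Rightarrow>\<^sub>L 'c::real_normed_vector"
  shows "semivariation E (\<lambda>A. m A + m' A) A \<le> semivariation E m A + semivariation E m' A"
proof (rule semivariation_least)
  fix n and B :: "nat \<Rightarrow> 'a set" and v :: "nat \<Rightarrow> 'b"
  assume *: "disjoint_family_on B {..<n}"
    "\<And>i. i < n \<Longrightarrow> B i \<in> sets borel \<and> B i \<subseteq> A \<and> v i \<in> E \<and> norm (v i) \<le> 1"
  have "norm (\<Sum>i<n. blinfun_apply (m (B i) + m' (B i)) (v i)) \<le>
      norm (\<Sum>i<n. blinfun_apply (m (B i)) (v i)) + norm (\<Sum>i<n. blinfun_apply (m' (B i)) (v i))"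
    by (simp add: blinfun.add_left sum.distrib norm_triangle_ineq)
  then have "ennreal (norm (\<Sum>i<n. blinfun_apply (m (B i) + m' (B i)) (v i))) \<le>
      ennreal (norm (\<Sum>i<n. blinfun_apply (m (B i)) (v i))) +
      ennreal (norm (\<Sum>i<n. blinfun_apply (m' (B i)) (v i)))"
    by (simp flip: ennreal_plus)
  also have "\<dots> \<le> semivariation E m A + semivariation E m' A"
    using * by (intro add_mono semivariation_upper) auto
  finally show "ennreal (norm (\<Sum>i<n. blinfun_apply (m (B i) + m' (B i)) (v i))) \<le>
      semivariation E m A + semivariation E m' A" .
qed

lemma semivariation_scaleR_le:
  fixes m :: "'a::topological_space set \<Rightarrow> 'b::real_normed_vector \<Rightarrow>\<^sub>L 'c::real_normed_vector"
  shows "semivariation E (\<lambda>A. r *\<^sub>R m A) A \<le> ennreal \<bar>r\<bar> * semivariation E m A"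
proof (rule semivariation_least)
  fix n and B :: "nat \<Rightarrow> 'a set" and v :: "nat \<Rightarrow> 'b"
  assume *: "disjoint_family_on B {..<n}"
    "\<And>i. i < n \<Longrightarrow> B i \<in> sets borel \<and> B i \<subseteq> A \<and> v i \<in> E \<and> norm (v i) \<le> 1"
  have "ennreal (norm (\<Sum>i<n. blinfun_apply (r *\<^sub>R m (B i)) (v i))) =
      ennreal \<bar>r\<bar> * ennreal (norm (\<Sum>i<n. blinfun_apply (m (B i)) (v i)))"
    by (simp add: blinfun.scaleR_left ennreal_mult flip: scaleR_sum_right)
  also have "\<dots> \<le> ennreal \<bar>r\<bar> * semivariation E m A"
    using * by (intro mult_left_mono semivariation_upper) auto
  finally show "ennreal (norm (\<Sum>i<n. blinfun_apply (r *\<^sub>R m (B i)) (v i))) \<le>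
      ennreal \<bar>r\<bar> * semivariation E m A" .
qed

section \<open>The normed space of measures of finite semivariation\<close>

lemma zero_in_CA: "(\<lambda>A. 0) \<in> CA UNIV"
  by (simp add: CA_def)

lemma add_in_CA: "\<mu> \<in> CA UNIV \<Longrightarrow> \<nu> \<in> CA UNIV \<Longrightarrow> (\<lambda>A. \<mu> A + \<nu> A) \<in> CA UNIV"
  by (simp add: CA_def sums_add)

lemma scaleR_in_CA: "\<mu> \<in> CA UNIV \<Longrightarrow> (\<lambda>A. r *\<^sub>R \<mu> A) \<in> CA UNIV"
  by (simp add: CA_def sums_scaleR_right)

typedef (overloaded) ('a::topological_space, 'v::real_normed_vector, 'w::real_normed_vector) sv_measure =
  "{\<mu> :: 'a set \<Rightarrow> 'v \<Rightarrow>\<^sub>L 'w. \<mu> \<in> CA UNIV \<and> semivariation UNIV \<mu> UNIV < \<infinity>}"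
  morphisms measure_of_sv sv_of_measure
  by (rule exI[of _ "\<lambda>A. 0"]) (simp add: zero_in_CA semivariation_zero)

setup_lifting type_definition_sv_measure

lemma finite_semivariation_scaleR:
  assumes "semivariation E m A < \<infinity>"
  shows "semivariation E (\<lambda>A. r *\<^sub>R m A) A < \<infinity>"
  using semivariation_scaleR_le[of E r m A] assms
  by (auto simp: ennreal_mult_less_top intro: le_less_trans)

lemma finite_semivariation_add:
  assumes "semivariation E m A < \<infinity>" "semivariation E m' A < \<infinity>"
  shows "semivariation E (\<lambda>A. m A + m' A) A < \<infinity>"
  using semivariation_add[of E m m' A] assms by (auto intro: le_less_trans)

lemma semivariation_UNIV_eq_0:
  assumes "\<mu> \<in> CA UNIV" "semivariation UNIV \<mu> UNIV = 0"
  shows "\<mu> = (\<lambda>A. 0)"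
proof
  fix A
  show "\<mu> A = 0"
  proof (cases "A \<in> sets borel")
    case True
    have "blinfun_apply (\<mu> A) v = 0" for v
    proof -
      have "ennreal (norm (\<Sum>i<Suc 0. blinfun_apply (\<mu> A) (v /\<^sub>R norm v))) \<le>
          semivariation UNIV \<mu> UNIV"
        using True semivariation_upper[of "\<lambda>_. A" "Suc 0" UNIV "\<lambda>_. v /\<^sub>R norm v" UNIV \<mu>]
        by (cases "v = 0") (auto simp: disjoint_family_on_def)
      then have "blinfun_apply (\<mu> A) (v /\<^sub>R norm v) = 0"
        using assms(2) by (simp add: ennreal_eq_0_iff)
      then show ?thesis by (cases "v = 0") (auto simp: blinfun.scaleR_right)
    qed
    then show ?thesis by (intro blinfun_eqI) simp
  qed (use assms in \<open>simp add: CA_def\<close>)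
qed

instantiation sv_measure ::
  (topological_space, real_normed_vector, real_normed_vector) real_normed_vector
begin

lift_definition zero_sv_measure :: "('a, 'b, 'c) sv_measure" is "\<lambda>A. 0"
  by (simp add: zero_in_CA semivariation_zero)

lift_definition plus_sv_measure ::
  "('a, 'b, 'c) sv_measure \<Rightarrow> ('a, 'b, 'c) sv_measure \<Rightarrow> ('a, 'b, 'c) sv_measure"
  is "\<lambda>\<mu> \<nu> A. \<mu> A + \<nu> A"
  by (simp add: add_in_CA finite_semivariation_add[unfolded infinity_ennreal_def])

lift_definition scaleR_sv_measure :: "real \<Rightarrow> ('a, 'b, 'c) sv_measure \<Rightarrow> ('a, 'b, 'c) sv_measure"
  is "\<lambda>r \<mu> A. r *\<^sub>R \<mu> A"
  by (simp add: scaleR_in_CA finite_semivariation_scaleR[unfolded infinity_ennreal_def])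

definition uminus_sv_measure :: "('a, 'b, 'c) sv_measure \<Rightarrow> ('a, 'b, 'c) sv_measure" where
  "uminus_sv_measure \<mu> = (-1) *\<^sub>R \<mu>"

definition minus_sv_measure ::
  "('a, 'b, 'c) sv_measure \<Rightarrow> ('a, 'b, 'c) sv_measure \<Rightarrow> ('a, 'b, 'c) sv_measure" where
  "minus_sv_measure \<mu> \<nu> = \<mu> + (-1) *\<^sub>R \<nu>"

lift_definition norm_sv_measure :: "('a, 'b, 'c) sv_measure \<Rightarrow> real"
  is "\<lambda>\<mu>. enn2real (semivariation UNIV \<mu> UNIV)" .

definition dist_sv_measure :: "('a, 'b, 'c) sv_measure \<Rightarrow> ('a, 'b, 'c) sv_measure \<Rightarrow> real" where
  "dist_sv_measure \<mu> \<nu> = norm (\<mu> - \<nu>)"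

definition sgn_sv_measure :: "('a, 'b, 'c) sv_measure \<Rightarrow> ('a, 'b, 'c) sv_measure" where
  "sgn_sv_measure \<mu> = inverse (norm \<mu>) *\<^sub>R \<mu>"

definition uniformity_sv_measure ::
  "(('a, 'b, 'c) sv_measure \<times> ('a, 'b, 'c) sv_measure) filter" where
  "uniformity_sv_measure = (INF e\<in>{0<..}. principal {(\<mu>, \<nu>). dist \<mu> \<nu> < e})"

definition open_sv_measure :: "('a, 'b, 'c) sv_measure set \<Rightarrow> bool" where
  "open_sv_measure U \<longleftrightarrow> (\<forall>\<mu>\<in>U. \<forall>\<^sub>F (\<mu>', \<nu>) in uniformity. \<mu>' = \<mu> \<longrightarrow> \<nu> \<in> U)"

instance
proof
  fix \<mu> \<nu> \<rho> :: "('a, 'b, 'c) sv_measure" and r s :: real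
  show "\<mu> + \<nu> + \<rho> = \<mu> + (\<nu> + \<rho>)" by transfer (simp add: add.assoc)
  show "\<mu> + \<nu> = \<nu> + \<mu>" by transfer (simp add: add.commute)
  show "0 + \<mu> = \<mu>" by transfer simp
  show "- \<mu> + \<mu> = 0" unfolding uminus_sv_measure_def by transfer simp
  show "\<mu> - \<nu> = \<mu> + - \<nu>" unfolding uminus_sv_measure_def minus_sv_measure_def ..
  show "r *\<^sub>R (\<mu> + \<nu>) = r *\<^sub>R \<mu> + r *\<^sub>R \<nu>" by transfer (simp add: scaleR_add_right)
  show "(r + s) *\<^sub>R \<mu> = r *\<^sub>R \<mu> + s *\<^sub>R \<mu>" by transfer (simp add: scaleR_add_left)
  show "r *\<^sub>R s *\<^sub>R \<mu> = (r * s) *\<^sub>R \<mu>" by transfer simp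
  show "1 *\<^sub>R \<mu> = \<mu>" by transfer simp
  show "dist \<mu> \<nu> = norm (\<mu> - \<nu>)" by (rule dist_sv_measure_def)
  show "sgn \<mu> = inverse (norm \<mu>) *\<^sub>R \<mu>" by (rule sgn_sv_measure_def)
  show "(uniformity :: (('a, 'b, 'c) sv_measure \<times> ('a, 'b, 'c) sv_measure) filter) =
      (INF e\<in>{0<..}. principal {(\<mu>, \<nu>). dist \<mu> \<nu> < e})" by (rule uniformity_sv_measure_def)
  show "open U \<longleftrightarrow> (\<forall>\<mu>\<in>U. \<forall>\<^sub>F (\<mu>', \<nu>) in uniformity. \<mu>' = \<mu> \<longrightarrow> \<nu> \<in> U)"
    for U :: "('a, 'b, 'c) sv_measure set" by (rule open_sv_measure_def)
  show "norm \<mu> = 0 \<longleftrightarrow> \<mu> = 0"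
    by transfer (auto simp: enn2real_eq_0_iff semivariation_zero semivariation_UNIV_eq_0)
  show "norm (\<mu> + \<nu>) \<le> norm \<mu> + norm \<nu>"
  proof transfer
    fix \<mu> \<nu> :: "'a set \<Rightarrow> 'b \<Rightarrow>\<^sub>L 'c"
    assume *: "\<mu> \<in> CA UNIV \<and> semivariation UNIV \<mu> UNIV < \<infinity>"
      "\<nu> \<in> CA UNIV \<and> semivariation UNIV \<nu> UNIV < \<infinity>"
    have "enn2real (semivariation UNIV (\<lambda>A. \<mu> A + \<nu> A) UNIV) \<le>
        enn2real (semivariation UNIV \<mu> UNIV + semivariation UNIV \<nu> UNIV)"
      using * by (intro enn2real_mono semivariation_add) auto
    also have "\<dots> = enn2real (semivariation UNIV \<mu> UNIV) + enn2real (semivariation UNIV \<nu> UNIV)"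
      using * by (intro enn2real_plus) auto
    finally show "enn2real (semivariation UNIV (\<lambda>A. \<mu> A + \<nu> A) UNIV) \<le>
        enn2real (semivariation UNIV \<mu> UNIV) + enn2real (semivariation UNIV \<nu> UNIV)" .
  qed
  have le: "norm (r *\<^sub>R \<mu>) \<le> \<bar>r\<bar> * norm \<mu>" for r and \<mu> :: "('a, 'b, 'c) sv_measure"
  proof transfer
    fix r and \<mu> :: "'a set \<Rightarrow> 'b \<Rightarrow>\<^sub>L 'c"
    assume *: "\<mu> \<in> CA UNIV \<and> semivariation UNIV \<mu> UNIV < \<infinity>"
    have "enn2real (semivariation UNIV (\<lambda>A. r *\<^sub>R \<mu> A) UNIV) \<le>
        enn2real (ennreal \<bar>r\<bar> * semivariation UNIV \<mu> UNIV)"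
      using * by (intro enn2real_mono semivariation_scaleR_le) (auto simp: ennreal_mult_less_top)
    then show "enn2real (semivariation UNIV (\<lambda>A. r *\<^sub>R \<mu> A) UNIV) \<le>
        \<bar>r\<bar> * enn2real (semivariation UNIV \<mu> UNIV)"
      by (simp add: enn2real_mult)
  qed
  show "norm (r *\<^sub>R \<mu>) = \<bar>r\<bar> * norm \<mu>"
  proof (cases "r = 0")
    case True
    then show ?thesis using le[of 0 \<mu>] by (simp add: norm_sv_measure.rep_eq antisym)
  next
    case False
    have "\<mu> = inverse r *\<^sub>R r *\<^sub>R \<mu>" using False by transfer simp
    then have "norm \<mu> \<le> \<bar>inverse r\<bar> * norm (r *\<^sub>R \<mu>)" using le[of "inverse r" "r *\<^sub>R \<mu>"] by simp
    then have "\<bar>r\<bar> * norm \<mu> \<le> norm (r *\<^sub>R \<mu>)" using False by (simp add: field_simps)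
    then show ?thesis using le[of r \<mu>] by simp
  qed
qed

end

section \<open>Functions that are $k$ times continuously differentiable\<close>

text \<open>
  The \<open>j\<close>-th Frechet derivative at \<open>x\<close> is a bounded \<open>j\<close>-linear map, here a function on lists of
  length \<open>j\<close>. Its norm is the supremum over \<open>unit_tuples j\<close>, so convergence in operator norm
  is uniform convergence on \<open>unit_tuples j\<close>.
\<close>

definition unit_tuples :: "nat \<Rightarrow> 'a::real_normed_vector list set" where
  "unit_tuples j = {hs. length hs = j \<and> (\<forall>h\<in>set hs. norm h \<le> 1)}"

definition bounded_multilinear ::
  "nat \<Rightarrow> ('a::real_normed_vector list \<Rightarrow> 'b::real_normed_vector) \<Rightarrow> bool" where
  "bounded_multilinear j T \<longleftrightarrow>
     (\<forall>hs i. length hs = j \<longrightarrow> i < j \<longrightarrow> linear (\<lambda>h. T (hs[i := h]))) \<and> bounded (T ` unit_tuples j)"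

definition frechet_derivatives ::
  "nat \<Rightarrow> ('a::real_normed_vector \<Rightarrow> 'b::real_normed_vector) \<Rightarrow> (nat \<Rightarrow> 'a \<Rightarrow> 'a list \<Rightarrow> 'b) \<Rightarrow> bool" where
  "frechet_derivatives k f D \<longleftrightarrow>
     (\<forall>x. D 0 x [] = f x) \<and>
     (\<forall>j\<le>k. \<forall>x. bounded_multilinear j (D j x)) \<and>
     (\<forall>j<k. \<forall>x. uniform_limit (unit_tuples j)
        (\<lambda>y hs. (D j y hs - D j x hs - D (Suc j) x ((y - x) # hs)) /\<^sub>R norm (y - x)) (\<lambda>hs. 0) (at x))"

definition C_k :: "nat \<Rightarrow> ('a::real_normed_vector \<Rightarrow> 'b::real_normed_vector) \<Rightarrow> bool" where
  "C_k k f \<longleftrightarrow> (\<exists>D. frechet_derivatives k f D \<and>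
     (\<forall>x. uniform_limit (unit_tuples k) (D k) (D k x) (at x)))"

definition C_B_k :: "nat \<Rightarrow> 'b set \<Rightarrow> ('a::real_normed_vector \<Rightarrow> 'b::real_normed_vector) set" where
  "C_B_k k Y = {f. range f \<subseteq> Y \<and> (\<exists>D. frechet_derivatives k f D \<and>
     (\<forall>x. uniform_limit (unit_tuples k) (D k) (D k x) (at x)) \<and>
     (\<forall>j\<le>k. bounded (\<Union>x. D j x ` unit_tuples j)))}"

definition translate_measure :: "'a::real_normed_vector \<Rightarrow> ('a set \<Rightarrow> 'b) \<Rightarrow> 'a set \<Rightarrow> 'b" where
  "translate_measure x \<mu> A = \<mu> ((\<lambda>a. a + x) ` A)"

definition C_k_sv ::
  "nat \<Rightarrow> ('v \<Rightarrow>\<^sub>L 'w) set \<Rightarrow>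
   ('a::real_normed_vector set \<Rightarrow> 'v::real_normed_vector \<Rightarrow>\<^sub>L 'w::real_normed_vector) set" where
  "C_k_sv k Y = {\<mu> \<in> CA Y. semivariation UNIV \<mu> UNIV < \<infinity> \<and>
     C_k k (\<lambda>x. sv_of_measure (translate_measure x \<mu>))}"

section \<open>Mixed derivatives along multivectors\<close>

definition fomin_derivative ::
  "'a \<Rightarrow> ('a::real_normed_vector set \<Rightarrow> 'v::real_normed_vector \<Rightarrow>\<^sub>L 'w::real_normed_vector) \<Rightarrow>
   'a set \<Rightarrow> 'v \<Rightarrow>\<^sub>L 'w" where
  "fomin_derivative h \<mu> = measure_of_sv (Lim (at (0::real))
     (\<lambda>t. (sv_of_measure (translate_measure (t *\<^sub>R h) \<mu>) - sv_of_measure \<mu>) /\<^sub>R t))"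

definition directional_derivative ::
  "'a \<Rightarrow> ('a::real_normed_vector \<Rightarrow> 'b::real_normed_vector) \<Rightarrow> 'a \<Rightarrow> 'b" where
  "directional_derivative h f x = Lim (at (0::real)) (\<lambda>t. (f (x + t *\<^sub>R h) - f x) /\<^sub>R t)"

text \<open>
  A multivector is a multiset \<open>h\<close>, with \<open>h(x) = count h x\<close> and \<open>|h| = size h\<close>. The mixed derivative
  is the common value of the iterated derivatives over all orderings of the multivector.
\<close>

definition mixed_derivative :: "('a \<Rightarrow> 'c \<Rightarrow> 'c) \<Rightarrow> 'a multiset \<Rightarrow> 'c \<Rightarrow> 'c" where
  "mixed_derivative d h f = (THE g. \<forall>xs. mset xs = h \<longrightarrow> foldr d xs f = g)"

definition multibinomial :: "'a multiset \<Rightarrow> 'a multiset \<Rightarrow> real" where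
  "multibinomial \<alpha> \<beta> = (\<Prod>x\<in>set_mset (\<alpha> + \<beta>).
     fact (count \<alpha> x + count \<beta> x) / (fact (count \<alpha> x) * fact (count \<beta> x)))"

section \<open>Dobrakov integral and product of a measure and a function\<close>

text \<open>A simple function is represented canonically, by the level sets of its values.\<close>

definition simple_integral ::
  "('a::topological_space set \<Rightarrow> 'e::real_normed_vector \<Rightarrow>\<^sub>L 'g::real_normed_vector) \<Rightarrow>
   'a set \<Rightarrow> ('a \<Rightarrow> 'e) \<Rightarrow> 'g" where
  "simple_integral m A s = (\<Sum>v\<in>range s. blinfun_apply (m (A \<inter> s -` {v})) v)"

definition dobrakov_approx ::
  "'e set \<Rightarrow> ('a::topological_space set \<Rightarrow> 'e::real_normed_vector \<Rightarrow>\<^sub>L 'g::real_normed_vector) \<Rightarrow>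
   ('a \<Rightarrow> 'e) \<Rightarrow> (nat \<Rightarrow> 'a \<Rightarrow> 'e) \<Rightarrow> bool" where
  "dobrakov_approx E m f s \<longleftrightarrow>
     (\<forall>n. simple_function borel (s n) \<and> range (s n) \<subseteq> E) \<and>
     (\<exists>N\<in>sets borel. semivariation E m N = 0 \<and> (\<forall>x. x \<notin> N \<longrightarrow> (\<lambda>n. s n x) \<longlonglongrightarrow> f x)) \<and>
     (\<forall>A\<in>sets borel. convergent (\<lambda>n. simple_integral m A (s n)))"

definition dobrakov_integral ::
  "'e set \<Rightarrow> ('a::topological_space set \<Rightarrow> 'e::real_normed_vector \<Rightarrow>\<^sub>L 'g::real_normed_vector) \<Rightarrow>
   'a set \<Rightarrow> ('a \<Rightarrow> 'e) \<Rightarrow> 'g" where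
  "dobrakov_integral E m A f =
     (THE I. \<exists>s. dobrakov_approx E m f s \<and> (\<lambda>n. simple_integral m A (s n)) \<longlonglongrightarrow> I)"

definition composition_measure ::
  "('a set \<Rightarrow> 'v::real_normed_vector \<Rightarrow>\<^sub>L 'w::real_normed_vector) \<Rightarrow> 'a set \<Rightarrow> ('v \<Rightarrow>\<^sub>L 'v) \<Rightarrow>\<^sub>L ('v \<Rightarrow>\<^sub>L 'w)" where
  "composition_measure \<mu> A = Blinfun (\<lambda>F. \<mu> A o\<^sub>L F)"

text \<open>The parameter \<open>E\<close> is the space \<open>L(V)\<close> in which the simple functions take their values.\<close>

definition product_measure ::
  "('v \<Rightarrow>\<^sub>L 'v) set \<Rightarrow> ('a::topological_space set \<Rightarrow> 'v::real_normed_vector \<Rightarrow>\<^sub>L 'w::real_normed_vector) \<Rightarrow>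
   ('a \<Rightarrow> 'v \<Rightarrow>\<^sub>L 'v) \<Rightarrow> 'a set \<Rightarrow> 'v \<Rightarrow>\<^sub>L 'w" where
  "product_measure E \<mu> \<phi> A =
     (if A \<in> sets borel then dobrakov_integral E (composition_measure \<mu>) A \<phi> else 0)"

end

theory Submission
  imports Defs
begin

text \<open>
  The orbit of \<open>\<mu>\<phi>\<close> under translations is \<open>x \<mapsto> \<mu>\<^sub>x \<cdot> \<phi>(\<cdot> + x)\<close>. The product \<open>(\<nu>, \<psi>) \<mapsto> \<nu>\<psi>\<close> is
  bilinear and \<open>\<parallel>\<nu>\<psi>\<parallel> \<le> sup |\<psi>| \<cdot> \<parallel>\<nu>\<parallel>\<close> in the semivariation norm, so the theorem would be the product
  rule for a bounded bilinear map if \<open>x \<mapsto> \<phi>(\<cdot> + x)\<close> were \<open>C\<^sup>k\<close> for the supremum norm. It need not be: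
  the \<open>k\<close>-th derivative of \<open>\<phi>\<close> is bounded and continuous, but need not be uniformly continuous. The
  continuity of the semivariation makes up for this. It gives a bounded convergence theorem
  (\<open>sv_product_bounded_convergence\<close>): if \<open>\<psi>\<^sub>n \<rightarrow> 0\<close> pointwise and boundedly, then \<open>\<nu>\<psi>\<^sub>n \<rightarrow> 0\<close> in norm.

  Let \<open>P\<^sub>a\<close> and \<open>Q\<^sub>b\<close> denote the derivatives of \<open>x \<mapsto> \<mu>\<^sub>x\<close> and of \<open>\<phi>\<close> along the tuples of directions
  \<open>a\<close> and \<open>b\<close>. The candidate for the \<open>j\<close>-th derivative along a tuple is the sum of \<open>P\<^sub>a Q\<^sub>b\<close> over the
  \<open>2\<^sup>j\<close> ways to distribute the entries of the tuple over \<open>a\<close> and \<open>b\<close>. In the remainder of its first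
  order expansion, a derivative of \<open>\<phi>\<close> of order less than \<open>k\<close> is Lipschitz for the supremum norm by
  the mean value inequality. A derivative of order \<open>k\<close> occurs only if \<open>a\<close> is empty; it is then
  multiplied by the fixed measure \<open>\<mu>\<^sub>x\<close>, and bounded convergence applies
  (\<open>remainder_right\<close>, \<open>continuity_right\<close>).

  Four further points are needed. The Dobrakov integral is well defined, because two sequences of
  simple functions with the same limit give the same integrals; this is a gliding hump argument, in
  which the continuity of the semivariation replaces the theorem of Vitali, Hahn and Saks
  (\<open>op_integral_limit_zero\<close>). The derivatives of \<open>\<mu>\<close> can again serve as integrators, because the
  measures of continuous semivariation form a closed subspace. The mixed derivatives do not depend
  on the order of the directions, by Schwarz's theorem (\<open>D_permute\<close>). The coefficients
  \<open>C(\<alpha>, \<beta>)\<close> count the ways to split a tuple into parts with multisets \<open>\<alpha>\<close> and \<open>\<beta>\<close>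
  (\<open>sum_masks_eq_sum_splittings\<close>).
\<close>

section \<open>Measures and their semivariation\<close>

text \<open>
  The semivariation as a real number. It is meaningful only where the semivariation is finite, since
  \<open>enn2real\<close> maps \<open>\<infinity>\<close> to \<open>0\<close>.
\<close>

definition sv_mass ::
  "('a::topological_space set \<Rightarrow> 'v::real_normed_vector \<Rightarrow>\<^sub>L 'w::real_normed_vector) \<Rightarrow> 'a set \<Rightarrow> real" where
  "sv_mass \<mu> A = enn2real (semivariation UNIV \<mu> A)"

lemma CA_empty:
  assumes "\<mu> \<in> CA Y"
  shows "\<mu> {} = 0"
proof -
  have "(\<lambda>n::nat. \<mu> {}) sums \<mu> (\<Union>n::nat. {})"
    using assms unfolding CA_def by (auto simp: disjoint_family_on_def)
  then have "(\<lambda>n::nat. \<mu> {}) \<longlonglongrightarrow> 0"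
    using summable_LIMSEQ_zero sums_summable by blast
  then show ?thesis by (simp add: LIMSEQ_const_iff)
qed

lemma CA_Un:
  assumes \<mu>: "\<mu> \<in> CA Y" and "A \<in> sets borel" "B \<in> sets borel" "A \<inter> B = {}"
  shows "\<mu> (A \<union> B) = \<mu> A + \<mu> B"
proof -
  have range: "range (binaryset A B) \<subseteq> sets borel" and disj: "disjoint_family (binaryset A B)"
    using assms by (auto simp: disjoint_family_on_def binaryset_def split: if_splits)
  have "(\<lambda>n. \<mu> (binaryset A B n)) sums \<mu> (\<Union>n. binaryset A B n)"
    using \<mu> range disj unfolding CA_def by blast
  moreover have "(\<lambda>n. \<mu> (binaryset A B n)) sums (\<mu> A + \<mu> B)"
    using binaryset_sums[of \<mu> A B] CA_empty[OF \<mu>] by simp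
  ultimately show ?thesis by (simp add: UN_binaryset_eq sums_unique2)
qed

lemma CA_finite_UN:
  assumes \<mu>: "\<mu> \<in> CA Y" and "finite I" "\<And>i. i \<in> I \<Longrightarrow> B i \<in> sets borel" "disjoint_family_on B I"
  shows "\<mu> (\<Union>i\<in>I. B i) = (\<Sum>i\<in>I. \<mu> (B i))"
  using assms(2-)
proof (induction I)
  case empty
  then show ?case by (simp add: CA_empty[OF \<mu>])
next
  case (insert i I)
  have "\<mu> (B i \<union> (\<Union>i\<in>I. B i)) = \<mu> (B i) + \<mu> (\<Union>i\<in>I. B i)"
    using insert.prems insert.hyps
    by (intro CA_Un[OF \<mu>]) (auto simp: disjoint_family_on_def)
  then show ?case using insert by (auto simp: disjoint_family_on_def)
qed

lemma semivariation_mono: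
  assumes "A \<subseteq> B"
  shows "semivariation E m A \<le> semivariation E m B"
proof (rule semivariation_least)
  fix n :: nat and C v
  assume C: "disjoint_family_on C {..<n}"
    "\<And>i. i < n \<Longrightarrow> C i \<in> sets borel \<and> C i \<subseteq> A \<and> v i \<in> E \<and> norm (v i) \<le> 1"
  show "ennreal (norm (\<Sum>i<n. blinfun_apply (m (C i)) (v i))) \<le> semivariation E m B"
    using C(1) by (rule semivariation_upper) (use C(2) assms in blast)
qed

text \<open>
  The inequality defining the semivariation, scaled to vectors of norm at most \<open>c\<close> and freed from
  the index set \<open>{..<n}\<close>.
\<close>

lemma norm_sum_le_sv_mass:
  assumes fin: "semivariation UNIV \<mu> A < \<infinity>" and I: "finite I"
    and B: "disjoint_family_on B I" "\<And>i. i \<in> I \<Longrightarrow> B i \<in> sets borel \<and> B i \<subseteq> A \<and> norm (w i) \<le> c"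
    and c: "0 \<le> c"
  shows "norm (\<Sum>i\<in>I. blinfun_apply (\<mu> (B i)) (w i)) \<le> c * sv_mass \<mu> A"
proof (cases "c = 0")
  case True
  then have "(\<Sum>i\<in>I. blinfun_apply (\<mu> (B i)) (w i)) = 0"
    using B(2) by (intro sum.neutral) auto
  then show ?thesis using True by simp
next
  case False
  then have c: "c > 0" using c by simp
  obtain h where h: "bij_betw h {..<card I} I"
    using ex_bij_betw_nat_finite[OF I] by (auto simp: atLeast0LessThan)
  have "ennreal (norm (\<Sum>i<card I. blinfun_apply (\<mu> (B (h i))) (w (h i) /\<^sub>R c))) \<le>
      semivariation UNIV \<mu> A"
  proof (rule semivariation_upper)
    show "disjoint_family_on (\<lambda>i. B (h i)) {..<card I}"
      using B(1) h unfolding disjoint_family_on_def bij_betw_def inj_on_def by blast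
    show "B (h i) \<in> sets borel \<and> B (h i) \<subseteq> A \<and> w (h i) /\<^sub>R c \<in> UNIV \<and> norm (w (h i) /\<^sub>R c) \<le> 1"
      if "i < card I" for i
    proof -
      have "h i \<in> I" using h that by (auto simp: bij_betw_def)
      then show ?thesis using B(2)[of "h i"] c by (auto simp: divide_simps)
    qed
  qed
  also have "(\<Sum>i<card I. blinfun_apply (\<mu> (B (h i))) (w (h i) /\<^sub>R c)) =
      (\<Sum>i\<in>I. blinfun_apply (\<mu> (B i)) (w i /\<^sub>R c))"
    using h by (rule sum.reindex_bij_betw)
  also have "\<dots> = (\<Sum>i\<in>I. blinfun_apply (\<mu> (B i)) (w i)) /\<^sub>R c"
    by (simp add: scaleR_sum_right blinfun.scaleR_right)
  finally have "norm (\<Sum>i\<in>I. blinfun_apply (\<mu> (B i)) (w i)) / c \<le> sv_mass \<mu> A"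
    unfolding sv_mass_def using fin c by (subst ennreal_le_iff[symmetric]) (auto simp: divide_inverse mult.commute)
  then show ?thesis using c by (simp add: field_simps)
qed

lemma norm_le_of_semivariation_le:
  assumes "semivariation UNIV \<mu> A \<le> ennreal K" "A \<in> sets borel" "0 \<le> K"
  shows "norm (\<mu> A) \<le> K"
proof (rule norm_blinfun_bound[OF \<open>0 \<le> K\<close>])
  fix v
  have "norm (\<Sum>i\<in>{()}. blinfun_apply (\<mu> A) v) \<le> norm v * sv_mass \<mu> A"
    using assms by (intro norm_sum_le_sv_mass[where B="\<lambda>_. A"]) (auto simp: disjoint_family_on_def intro: le_less_trans)
  also have "norm v * sv_mass \<mu> A \<le> norm v * K"
    unfolding sv_mass_def using assms by (intro mult_left_mono) (simp_all add: enn2real_leI)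
  finally show "norm (blinfun_apply (\<mu> A) v) \<le> K * norm v"
    by (simp add: mult.commute)
qed

text \<open>
  Finite additivity on the Borel sets. Both integrals of simple functions and their limits are
  additive before they are known to be countably additive.
\<close>

definition additive_set_function :: "('a::topological_space set \<Rightarrow> 'y::real_normed_vector) \<Rightarrow> bool" where
  "additive_set_function \<nu> \<longleftrightarrow>
     (\<forall>A\<in>sets borel. \<forall>B\<in>sets borel. A \<inter> B = {} \<longrightarrow> \<nu> (A \<union> B) = \<nu> A + \<nu> B)"

lemma additive_set_functionD:
  "additive_set_function \<nu> \<Longrightarrow> A \<in> sets borel \<Longrightarrow> B \<in> sets borel \<Longrightarrow> A \<inter> B = {} \<Longrightarrow> \<nu> (A \<union> B) = \<nu> A + \<nu> B"
  unfolding additive_set_function_def by blast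

lemma semivariation_split:
  assumes \<nu>: "additive_set_function \<nu>" and B: "B \<in> sets borel"
  shows "semivariation E \<nu> A \<le> semivariation E \<nu> (A \<inter> B) + semivariation E \<nu> (A - B)"
proof (rule semivariation_least)
  fix n :: nat and C v
  assume C: "disjoint_family_on C {..<n}"
    "\<And>i. i < n \<Longrightarrow> C i \<in> sets borel \<and> C i \<subseteq> A \<and> v i \<in> E \<and> norm (v i) \<le> 1"
  have "\<nu> (C i) = \<nu> (C i \<inter> B) + \<nu> (C i - B)" if "i < n" for i
  proof -
    have "\<nu> ((C i \<inter> B) \<union> (C i - B)) = \<nu> (C i \<inter> B) + \<nu> (C i - B)"
      using C(2)[OF that] B by (intro additive_set_functionD[OF \<nu>]) auto
    moreover have "(C i \<inter> B) \<union> (C i - B) = C i" by blast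
    ultimately show ?thesis by simp
  qed
  then have "(\<Sum>i<n. blinfun_apply (\<nu> (C i)) (v i)) =
      (\<Sum>i<n. blinfun_apply (\<nu> (C i \<inter> B)) (v i)) + (\<Sum>i<n. blinfun_apply (\<nu> (C i - B)) (v i))"
    by (simp add: blinfun.add_left sum.distrib)
  then have "ennreal (norm (\<Sum>i<n. blinfun_apply (\<nu> (C i)) (v i))) \<le>
      ennreal (norm (\<Sum>i<n. blinfun_apply (\<nu> (C i \<inter> B)) (v i))) +
      ennreal (norm (\<Sum>i<n. blinfun_apply (\<nu> (C i - B)) (v i)))"
    by (simp add: norm_triangle_ineq flip: ennreal_plus)
  also have "\<dots> \<le> semivariation E \<nu> (A \<inter> B) + semivariation E \<nu> (A - B)"
  proof (intro add_mono semivariation_upper)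
    show "disjoint_family_on (\<lambda>i. C i \<inter> B) {..<n}" "disjoint_family_on (\<lambda>i. C i - B) {..<n}"
      using C(1) by (auto simp: disjoint_family_on_def)
    fix i assume "i < n"
    from C(2)[OF this] B
    show "C i \<inter> B \<in> sets borel \<and> C i \<inter> B \<subseteq> A \<inter> B \<and> v i \<in> E \<and> norm (v i) \<le> 1"
      and "C i - B \<in> sets borel \<and> C i - B \<subseteq> A - B \<and> v i \<in> E \<and> norm (v i) \<le> 1"
      by auto
  qed
  finally show "ennreal (norm (\<Sum>i<n. blinfun_apply (\<nu> (C i)) (v i))) \<le>
      semivariation E \<nu> (A \<inter> B) + semivariation E \<nu> (A - B)" .
qed

text \<open>
  The semivariation is lower semicontinuous under setwise convergence.
\<close>

lemma semivariation_le_of_tendsto: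
  assumes lim: "\<And>B. B \<in> sets borel \<Longrightarrow> B \<subseteq> A \<Longrightarrow> ((\<lambda>n. \<nu> n B) \<longlongrightarrow> \<kappa> B) F"
    and bound: "\<forall>\<^sub>F n in F. semivariation E (\<nu> n) A \<le> ennreal K" and "F \<noteq> bot" "0 \<le> K"
  shows "semivariation E \<kappa> A \<le> ennreal K"
proof (rule semivariation_least)
  fix n :: nat and B v
  assume B: "disjoint_family_on B {..<n}"
    "\<And>i. i < n \<Longrightarrow> B i \<in> sets borel \<and> B i \<subseteq> A \<and> v i \<in> E \<and> norm (v i) \<le> 1"
  have "((\<lambda>m. norm (\<Sum>i<n. blinfun_apply (\<nu> m (B i)) (v i))) \<longlongrightarrow>
      norm (\<Sum>i<n. blinfun_apply (\<kappa> (B i)) (v i))) F"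
    using B by (intro tendsto_intros lim) auto
  moreover have "\<forall>\<^sub>F m in F. norm (\<Sum>i<n. blinfun_apply (\<nu> m (B i)) (v i)) \<le> K"
    using bound
  proof eventually_elim
    case (elim m)
    have "ennreal (norm (\<Sum>i<n. blinfun_apply (\<nu> m (B i)) (v i))) \<le> semivariation E (\<nu> m) A"
      using B by (rule semivariation_upper)
    also note elim
    finally show ?case using \<open>0 \<le> K\<close> by simp
  qed
  ultimately have "norm (\<Sum>i<n. blinfun_apply (\<kappa> (B i)) (v i)) \<le> K"
    using \<open>F \<noteq> bot\<close> by (rule tendsto_upperbound)
  then show "ennreal (norm (\<Sum>i<n. blinfun_apply (\<kappa> (B i)) (v i))) \<le> ennreal K"
    by (rule ennreal_leI)
qed

section \<open>Integrals of simple functions\<close>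

text \<open>
  The integral of an \<open>L(V)\<close>-valued simple function against an \<open>L(V,W)\<close>-valued measure, that is
  \<open>\<Sum> \<mu>(A \<inter> {s = F}) \<circ> F\<close> over the values \<open>F\<close> of \<open>s\<close>.
\<close>

abbreviation op_integral ::
  "('a::topological_space set \<Rightarrow> 'v::real_normed_vector \<Rightarrow>\<^sub>L 'w::real_normed_vector) \<Rightarrow> 'a set \<Rightarrow>
   ('a \<Rightarrow> 'v \<Rightarrow>\<^sub>L 'v) \<Rightarrow> 'v \<Rightarrow>\<^sub>L 'w" where
  "op_integral \<mu> \<equiv> simple_integral (composition_measure \<mu>)"

lemma composition_measure_apply [simp]:
  "blinfun_apply (composition_measure \<mu> A) F = \<mu> A o\<^sub>L F"
  unfolding composition_measure_def
  by (simp add: bounded_linear_Blinfun_apply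
      bounded_bilinear.bounded_linear_right[OF bounded_bilinear_blinfun_compose])

text \<open>
  Measures of finite and continuous semivariation: the admissible integrators.
\<close>

locale csv_measure =
  fixes \<mu> :: "'a::topological_space set \<Rightarrow> 'v::real_normed_vector \<Rightarrow>\<^sub>L 'w::real_normed_vector"
  assumes CA: "\<mu> \<in> CA UNIV"
    and finite_semivariation: "semivariation UNIV \<mu> UNIV < \<infinity>"
    and continuous: "continuous_semivariation \<mu>"
begin

lemma semivariation_finite: "semivariation UNIV \<mu> A < \<infinity>"
  using semivariation_mono[of A UNIV UNIV \<mu>] finite_semivariation by (auto intro: le_less_trans)

lemma semivariation_eq: "semivariation UNIV \<mu> A = ennreal (sv_mass \<mu> A)"
  using semivariation_finite[of A] by (simp add: sv_mass_def less_top)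

lemma sv_mass_nonneg [simp]: "0 \<le> sv_mass \<mu> A"
  by (simp add: sv_mass_def)

lemma sv_mass_mono: "A \<subseteq> B \<Longrightarrow> sv_mass \<mu> A \<le> sv_mass \<mu> B"
  using semivariation_mono[of A B UNIV \<mu>] by (simp add: semivariation_eq)

lemma sv_mass_tendsto_0:
  assumes "range A \<subseteq> sets borel" "decseq A" "(\<Inter>n. A n) = {}"
  shows "(\<lambda>n. sv_mass \<mu> (A n)) \<longlonglongrightarrow> 0"
proof -
  have "(\<lambda>n. ennreal (sv_mass \<mu> (A n))) \<longlonglongrightarrow> ennreal 0"
    using continuous assms by (simp add: continuous_semivariation_def semivariation_eq)
  then show ?thesis by (subst (asm) tendsto_ennreal_iff) auto
qed

text \<open>
  The integral may be computed on the level sets of any simple function through which the integrand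
  factors. Linearity follows by factoring two simple functions through their pair.
\<close>

lemma op_integral_comp:
  assumes g: "simple_function borel g" and A: "A \<in> sets borel"
  shows "op_integral \<mu> A (\<lambda>x. f (g x)) = (\<Sum>y\<in>range g. \<mu> (A \<inter> g -` {y}) o\<^sub>L f y)"
proof -
  have fin: "finite (range g)" and meas: "\<And>y. g -` {y} \<in> sets borel"
    using simple_functionD[OF g] by auto
  have "op_integral \<mu> A (\<lambda>x. f (g x)) =
      (\<Sum>F\<in>f ` range g. \<mu> (A \<inter> (\<lambda>x. f (g x)) -` {F}) o\<^sub>L F)"
    by (simp add: simple_integral_def image_comp comp_def)
  also have "\<dots> = (\<Sum>F\<in>f ` range g. \<Sum>y | y \<in> range g \<and> f y = F. \<mu> (A \<inter> g -` {y}) o\<^sub>L f y)"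
  proof (rule sum.cong[OF refl])
    fix F
    have "A \<inter> (\<lambda>x. f (g x)) -` {F} = (\<Union>y\<in>{y\<in>range g. f y = F}. A \<inter> g -` {y})" by auto
    also have "\<mu> \<dots> = (\<Sum>y | y \<in> range g \<and> f y = F. \<mu> (A \<inter> g -` {y}))"
      using fin meas A by (intro CA_finite_UN[OF CA]) (auto simp: disjoint_family_on_def)
    finally show "\<mu> (A \<inter> (\<lambda>x. f (g x)) -` {F}) o\<^sub>L F =
        (\<Sum>y | y \<in> range g \<and> f y = F. \<mu> (A \<inter> g -` {y}) o\<^sub>L f y)"
      by (simp add: bounded_bilinear.sum_left[OF bounded_bilinear_blinfun_compose])
  qed
  also have "\<dots> = (\<Sum>y\<in>range g. \<mu> (A \<inter> g -` {y}) o\<^sub>L f y)"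
    using fin by (rule sum.image_gen[symmetric])
  finally show ?thesis .
qed

lemma op_integral_eq:
  assumes "simple_function borel s" "A \<in> sets borel"
  shows "op_integral \<mu> A s = (\<Sum>F\<in>range s. \<mu> (A \<inter> s -` {F}) o\<^sub>L F)"
  using op_integral_comp[OF assms, of "\<lambda>F. F"] .

lemma op_integral_add_diff:
  assumes s: "simple_function borel s" and t: "simple_function borel t" and A: "A \<in> sets borel"
  shows "op_integral \<mu> A (\<lambda>x. s x + t x) = op_integral \<mu> A s + op_integral \<mu> A t"
    and "op_integral \<mu> A (\<lambda>x. s x - t x) = op_integral \<mu> A s - op_integral \<mu> A t"
proof -
  have g: "simple_function borel (\<lambda>x. (s x, t x))" using s t by (rule simple_function_Pair)
  note * = op_integral_comp[OF g A]
  show "op_integral \<mu> A (\<lambda>x. s x + t x) = op_integral \<mu> A s + op_integral \<mu> A t"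
    using *[of "\<lambda>y. fst y + snd y"] *[of fst] *[of snd]
    by (simp add: sum.distrib bounded_bilinear.add_right[OF bounded_bilinear_blinfun_compose])
  show "op_integral \<mu> A (\<lambda>x. s x - t x) = op_integral \<mu> A s - op_integral \<mu> A t"
    using *[of "\<lambda>y. fst y - snd y"] *[of fst] *[of snd]
    by (simp add: bounded_bilinear.diff_right[OF bounded_bilinear_blinfun_compose] sum_subtractf)
qed

lemma op_integral_scaleR:
  assumes s: "simple_function borel s" and A: "A \<in> sets borel"
  shows "op_integral \<mu> A (\<lambda>x. r *\<^sub>R s x) = r *\<^sub>R op_integral \<mu> A s"
  using op_integral_comp[OF s A, of "\<lambda>F. r *\<^sub>R F"] op_integral_comp[OF s A, of "\<lambda>F. F"]
  by (simp add: scaleR_sum_right bounded_bilinear.scaleR_right[OF bounded_bilinear_blinfun_compose])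

lemma additive_op_integral:
  assumes s: "simple_function borel s"
  shows "additive_set_function (\<lambda>A. op_integral \<mu> A s)"
  unfolding additive_set_function_def
proof (intro ballI impI)
  fix A B :: "'a set" assume A: "A \<in> sets borel" and B: "B \<in> sets borel" and AB: "A \<inter> B = {}"
  have "\<mu> ((A \<union> B) \<inter> s -` {F}) = \<mu> (A \<inter> s -` {F}) + \<mu> (B \<inter> s -` {F})" for F
    unfolding Int_Un_distrib2
    using simple_functionD(2)[OF s, of "{F}"] A B AB by (intro CA_Un[OF CA]) auto
  then show "op_integral \<mu> (A \<union> B) s = op_integral \<mu> A s + op_integral \<mu> B s"
    using A B s by (simp add: op_integral_eq sum.distrib bounded_bilinear.add_left[OF bounded_bilinear_blinfun_compose])
qed

text \<open>
  For operators \<open>F\<close> with norm at most \<open>c\<close> the vectors \<open>F v\<close> have norm at most \<open>c\<close> whenever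
  \<open>\<parallel>v\<parallel> \<le> 1\<close>, so the semivariation of the indefinite integral is controlled by that of \<open>\<mu>\<close>.
\<close>

lemma semivariation_op_integral_le:
  assumes s: "simple_function borel s" and c: "\<And>x. x \<in> A \<Longrightarrow> norm (s x) \<le> c" "0 \<le> c"
  shows "semivariation UNIV (\<lambda>B. op_integral \<mu> B s) A \<le> ennreal (c * sv_mass \<mu> A)"
proof (rule semivariation_least)
  fix n :: nat and B and v :: "nat \<Rightarrow> 'v"
  assume B: "disjoint_family_on B {..<n}"
    "\<And>i. i < n \<Longrightarrow> B i \<in> sets borel \<and> B i \<subseteq> A \<and> v i \<in> UNIV \<and> norm (v i) \<le> 1"
  define w where "w = (\<lambda>(i, F). if B i \<inter> s -` {F} = {} then 0 else blinfun_apply F (v i))"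
  have "(\<Sum>i<n. blinfun_apply (op_integral \<mu> (B i) s) (v i)) =
      (\<Sum>i<n. \<Sum>F\<in>range s. blinfun_apply (\<mu> (B i \<inter> s -` {F})) (w (i, F)))"
    using B(2) s
    by (intro sum.cong refl)
      (auto simp: op_integral_eq blinfun.sum_left w_def CA_empty[OF CA] intro!: sum.cong)
  also have "\<dots> = (\<Sum>p\<in>{..<n} \<times> range s. blinfun_apply (\<mu> (B (fst p) \<inter> s -` {snd p})) (w p))"
    by (simp add: sum.cartesian_product case_prod_beta')
  also have "norm \<dots> \<le> c * sv_mass \<mu> A"
  proof (rule norm_sum_le_sv_mass[OF semivariation_finite])
    show "finite ({..<n} \<times> range s)" using simple_functionD(1)[OF s] by simp
    show "disjoint_family_on (\<lambda>p. B (fst p) \<inter> s -` {snd p}) ({..<n} \<times> range s)"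
      using B(1) by (auto simp: disjoint_family_on_def)
    fix p assume p: "p \<in> {..<n} \<times> range s"
    obtain i F where p': "p = (i, F)" by force
    have "norm (w p) \<le> c"
    proof (cases "B i \<inter> s -` {F} = {}")
      case False
      then obtain x where x: "x \<in> B i" "s x = F" by auto
      have "norm (blinfun_apply F (v i)) \<le> norm F * norm (v i)" by (rule norm_blinfun)
      also have "\<dots> \<le> c * 1" using x B(2)[of i] p p' c by (intro mult_mono) auto
      finally show ?thesis using False by (simp add: w_def p')
    qed (simp add: w_def p' c)
    then show "B (fst p) \<inter> s -` {snd p} \<in> sets borel \<and> B (fst p) \<inter> s -` {snd p} \<subseteq> A \<and> norm (w p) \<le> c"
      using p p' B(2)[of i] simple_functionD(2)[OF s, of "{F}"] by auto
  qed (fact c(2))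
  finally show "ennreal (norm (\<Sum>i<n. blinfun_apply (op_integral \<mu> (B i) s) (v i))) \<le>
      ennreal (c * sv_mass \<mu> A)" by (rule ennreal_leI)
qed

lemma norm_op_integral_le:
  assumes s: "simple_function borel s" and A: "A \<in> sets borel"
    and c: "\<And>x. x \<in> A \<Longrightarrow> norm (s x) \<le> c" "0 \<le> c"
  shows "norm (op_integral \<mu> A s) \<le> c * sv_mass \<mu> A"
  by (rule norm_le_of_semivariation_le[of "\<lambda>B. op_integral \<mu> B s"])
    (use semivariation_op_integral_le[OF s c] A c in auto)

end

section \<open>Bounded pointwise limits of simple functions\<close>

context csv_measure begin

text \<open>
  A form of Egorov's theorem. The indices \<open>i\<close> run over a countable type so that single sequences
  and pairs of indices, as in the Cauchy criterion, are covered alike; \<open>J j\<close> is the \<open>j\<close>-th tail.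
\<close>

lemma simple_limit_semivariation:
  fixes s :: "'i::countable \<Rightarrow> 'a \<Rightarrow> 'v \<Rightarrow>\<^sub>L 'v" and J :: "nat \<Rightarrow> 'i set"
  assumes s: "\<And>i. simple_function borel (s i)" and K: "\<And>i x. norm (s i x) \<le> K"
    and A: "A \<in> sets borel" and J: "decseq J"
    and c: "\<And>x. x \<in> A \<Longrightarrow> \<exists>j. \<forall>i\<in>J j. norm (s i x) \<le> c" "0 \<le> c" and e: "e > 0"
  shows "\<exists>j. \<forall>i\<in>J j. semivariation UNIV (\<lambda>B. op_integral \<mu> B (s i)) A \<le> ennreal (c * sv_mass \<mu> A + e)"
proof -
  have K0: "0 \<le> K" using K[of undefined undefined] norm_ge_zero order_trans by blast
  \<comment> \<open>the sets where the bound \<open>c\<close> still fails decrease to the empty set\<close>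
  define N where "N j = A \<inter> (\<Union>i\<in>J j. {x. norm (s i x) > c})" for j
  have 1: "{x. norm (s i x) > c} \<in> sets borel" for i
    using simple_functionD(2)[OF s, of i "{y. norm y > c}"] by (simp add: vimage_def)
  have N: "N j \<in> sets borel" for j
    unfolding N_def using A 1 by (intro sets.Int sets.countable_UN') auto
  have "(\<lambda>j. sv_mass \<mu> (N j)) \<longlonglongrightarrow> 0"
  proof (rule sv_mass_tendsto_0)
    show "range N \<subseteq> sets borel" using N by auto
    show "decseq N" using J unfolding decseq_def N_def by blast
    show "(\<Inter>j. N j) = {}" using c(1) unfolding N_def by (fastforce simp: not_less)
  qed
  then have "(\<lambda>j. K * sv_mass \<mu> (N j)) \<longlonglongrightarrow> 0" by (rule tendsto_mult_right_zero)
  then have "\<forall>\<^sub>F j in sequentially. K * sv_mass \<mu> (N j) < e" using e by (rule order_tendstoD)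
  then obtain j where j: "K * sv_mass \<mu> (N j) < e" by (auto simp: eventually_sequentially)
  have "semivariation UNIV (\<lambda>B. op_integral \<mu> B (s i)) A \<le> ennreal (c * sv_mass \<mu> A + e)"
    if i: "i \<in> J j" for i
  proof -
    have "semivariation UNIV (\<lambda>B. op_integral \<mu> B (s i)) A \<le>
        semivariation UNIV (\<lambda>B. op_integral \<mu> B (s i)) (A \<inter> N j) +
        semivariation UNIV (\<lambda>B. op_integral \<mu> B (s i)) (A - N j)"
      by (rule semivariation_split[OF additive_op_integral[OF s] N])
    also have "\<dots> \<le> ennreal (K * sv_mass \<mu> (A \<inter> N j)) + ennreal (c * sv_mass \<mu> (A - N j))"
      using K K0 i c(2) by (intro add_mono semivariation_op_integral_le[OF s])
        (force simp: N_def not_less)+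
    also have "\<dots> = ennreal (K * sv_mass \<mu> (A \<inter> N j) + c * sv_mass \<mu> (A - N j))"
      using K0 c(2) by simp
    also have "\<dots> \<le> ennreal (c * sv_mass \<mu> A + e)"
    proof (rule ennreal_leI)
      have "K * sv_mass \<mu> (A \<inter> N j) \<le> K * sv_mass \<mu> (N j)"
        using K0 by (intro mult_left_mono sv_mass_mono) auto
      moreover have "c * sv_mass \<mu> (A - N j) \<le> c * sv_mass \<mu> A"
        using c(2) by (intro mult_left_mono sv_mass_mono) auto
      ultimately show "K * sv_mass \<mu> (A \<inter> N j) + c * sv_mass \<mu> (A - N j) \<le> c * sv_mass \<mu> A + e"
        using j by linarith
    qed
    finally show ?thesis .
  qed
  then show ?thesis by blast
qed

lemma convergent_op_integral:
  assumes banach: "complete (UNIV :: ('v \<Rightarrow>\<^sub>L 'w) set)"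
    and s: "\<And>n::nat. simple_function borel (s n)" and K: "\<And>n x. norm (s n x) \<le> K"
    and lim: "\<And>x. convergent (\<lambda>n. s n x)" and A: "A \<in> sets borel"
  shows "convergent (\<lambda>n. op_integral \<mu> A (s n))"
proof -
  have "Cauchy (\<lambda>n. op_integral \<mu> A (s n))"
  proof (rule metric_CauchyI)
    fix e :: real assume e: "e > 0"
    define c where "c = e / 3 / (sv_mass \<mu> A + 1)"
    have pos: "sv_mass \<mu> A + 1 > 0" using sv_mass_nonneg[of A] by linarith
    have c: "c > 0" "c * sv_mass \<mu> A \<le> e / 3"
      using e pos by (auto simp: c_def divide_simps mult_left_mono)
    have "\<exists>j. \<forall>p\<in>{j..}\<times>{j..}.
        semivariation UNIV (\<lambda>B. op_integral \<mu> B (\<lambda>x. s (fst p) x - s (snd p) x)) A \<le>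
        ennreal (c * sv_mass \<mu> A + e / 3)"
    proof (rule simple_limit_semivariation)
      show "simple_function borel (\<lambda>x. s (fst p) x - s (snd p) x)" for p
        using simple_function_compose2[OF s s] .
      show "norm (s (fst p) x - s (snd p) x) \<le> K + K" for p x
        using norm_triangle_ineq4[of "s (fst p) x" "s (snd p) x"] K[of "fst p" x] K[of "snd p" x]
        by linarith
      show "decseq (\<lambda>j. {j..} \<times> {j..})" by (auto simp: decseq_def)
      show "\<exists>j. \<forall>p\<in>{j..}\<times>{j..}. norm (s (fst p) x - s (snd p) x) \<le> c" for x
        using convergent_Cauchy[OF lim, of x] metric_CauchyD[OF _ c(1)] c(1)
        by (force simp: dist_norm intro: less_imp_le)
    qed (use A e c in auto)
    then obtain j where j: "\<And>m n. m \<ge> j \<Longrightarrow> n \<ge> j \<Longrightarrow>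
        semivariation UNIV (\<lambda>B. op_integral \<mu> B (\<lambda>x. s m x - s n x)) A \<le> ennreal (c * sv_mass \<mu> A + e / 3)"
      by force
    have "dist (op_integral \<mu> A (s m)) (op_integral \<mu> A (s n)) < e" if "m \<ge> j" "n \<ge> j" for m n
    proof -
      have "norm (op_integral \<mu> A (\<lambda>x. s m x - s n x)) \<le> c * sv_mass \<mu> A + e / 3"
        using norm_le_of_semivariation_le[OF j[OF that] A] c e by simp
      then show ?thesis
        using op_integral_add_diff(2)[OF s s A, of m n] c(2) e by (simp add: dist_norm)
    qed
    then show "\<exists>j. \<forall>m\<ge>j. \<forall>n\<ge>j. dist (op_integral \<mu> A (s m)) (op_integral \<mu> A (s n)) < e" by blast
  qed
  then show ?thesis using banach by (auto simp: complete_def convergent_def)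
qed

text \<open>
  Uniqueness of the limit of the integrals, for simple functions that need not be uniformly bounded.
  On \<open>E j\<close> the functions \<open>s n\<close> with \<open>n \<ge> j\<close> are uniformly small, and each single \<open>s n\<close> has small
  integrals off \<open>E j\<close> for large \<open>j\<close>, because it is bounded. So along a subsequence \<open>m\<close> the integrals of
  \<open>s (m i)\<close> are concentrated on disjoint sets \<open>B i\<close>. If the limit on \<open>A\<close> were not zero, then the integrals
  over the union of the \<open>B i\<close> with even \<open>i\<close> would be small for odd \<open>i\<close> and close to \<open>\<nu> A\<close> for even \<open>i\<close>,
  and so could not converge.
\<close>

lemma op_integral_limit_zero:
  assumes s: "\<And>n::nat. simple_function borel (s n)"
    and N: "N \<in> sets borel" "\<And>B. B \<in> sets borel \<Longrightarrow> B \<subseteq> N \<Longrightarrow> \<mu> B = 0"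
    and lim: "\<And>x. x \<notin> N \<Longrightarrow> (\<lambda>n. s n x) \<longlonglongrightarrow> 0"
    and int: "\<And>A. A \<in> sets borel \<Longrightarrow> (\<lambda>n. op_integral \<mu> A (s n)) \<longlonglongrightarrow> \<nu> A"
    and A: "A \<in> sets borel"
  shows "\<nu> A = 0"
proof (rule ccontr)
  assume "\<nu> A \<noteq> 0"
  \<comment> \<open>the errors below add up to \<open>6 * e\<close>\<close>
  define e where "e = norm (\<nu> A) / 8"
  have e: "e > 0" using \<open>\<nu> A \<noteq> 0\<close> by (simp add: e_def)
  define I where "I n B = op_integral \<mu> B (s n)" for n B
  define d where "d = e / (sv_mass \<mu> UNIV + 1)"
  have pos: "sv_mass \<mu> UNIV + 1 > 0" using sv_mass_nonneg[of UNIV] by linarith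
  have d: "d > 0" "d * sv_mass \<mu> UNIV \<le> e"
    using e pos by (auto simp: d_def divide_simps mult_left_mono)
  define E where "E j = A \<inter> (\<Inter>n\<in>{j..}. {x. norm (s n x) \<le> d}) - N" for j
  have E: "E j \<in> sets borel" for j
  proof -
    have "{x. norm (s n x) \<le> d} \<in> sets borel" for n
      using simple_functionD(2)[OF s, of n "{y. norm y \<le> d}"] by (simp add: vimage_def)
    then have "(\<Inter>n\<in>{j..}. {x. norm (s n x) \<le> d}) \<in> sets borel"
      by (intro sets.countable_INT') auto
    then show ?thesis unfolding E_def using A N(1) by auto
  qed
  have E_mono: "E i \<subseteq> E j" if "i \<le> j" for i j using that unfolding E_def by fastforce
  have add: "I n (B \<union> C) = I n B + I n C" if "B \<in> sets borel" "C \<in> sets borel" "B \<inter> C = {}" for n B C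
    unfolding I_def using additive_op_integral[OF s, of n] that by (rule additive_set_functionD)
  have small: "norm (I n B) \<le> e" if "B \<in> sets borel" "B \<subseteq> E j" "n \<ge> j" for n B j
  proof -
    have "norm (I n B) \<le> d * sv_mass \<mu> B"
      unfolding I_def using that d by (intro norm_op_integral_le[OF s]) (auto simp: E_def)
    also have "\<dots> \<le> d * sv_mass \<mu> UNIV" using d by (intro mult_left_mono sv_mass_mono) auto
    finally show ?thesis using d by linarith
  qed
  have tail: "\<exists>j\<ge>n. \<forall>B\<in>sets borel. B \<subseteq> A - E j \<longrightarrow> norm (I n B) \<le> e" for n
  proof -
    obtain C where C: "\<And>x. norm (s n x) \<le> C" "C \<ge> 0"
    proof -
      have "bounded (range (s n))" using simple_functionD(1)[OF s] by (simp add: finite_imp_bounded)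
      then show ?thesis using that by (auto simp: bounded_pos intro: less_imp_le)
    qed
    have "(\<lambda>j. sv_mass \<mu> (A - N - E j)) \<longlonglongrightarrow> 0"
    proof (rule sv_mass_tendsto_0)
      show "range (\<lambda>j. A - N - E j) \<subseteq> sets borel" using A N(1) E by auto
      show "decseq (\<lambda>j. A - N - E j)" unfolding decseq_def using E_mono by blast
      have "\<exists>j. x \<in> E j" if "x \<in> A - N" for x
      proof -
        have "\<forall>\<^sub>F n in sequentially. norm (s n x) < d"
          using lim[of x] that d(1) by (auto simp: tendsto_iff dist_norm)
        then show ?thesis using that by (force simp: E_def eventually_sequentially)
      qed
      then show "(\<Inter>j. A - N - E j) = {}" by blast
    qed
    then have "(\<lambda>j. C * sv_mass \<mu> (A - N - E j)) \<longlonglongrightarrow> 0" by (rule tendsto_mult_right_zero)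
    then have "\<forall>\<^sub>F j in sequentially. C * sv_mass \<mu> (A - N - E j) < e" using e by (rule order_tendstoD)
    then have "\<forall>\<^sub>F j in sequentially. j \<ge> n \<and> C * sv_mass \<mu> (A - N - E j) < e"
      using eventually_ge_at_top by eventually_elim auto
    then obtain j where j: "j \<ge> n" "C * sv_mass \<mu> (A - N - E j) < e"
      by (auto simp: eventually_sequentially)
    have "norm (I n B) \<le> e" if B: "B \<in> sets borel" "B \<subseteq> A - E j" for B
    proof -
      have "I n B = I n (B - N) + I n (B \<inter> N)"
        using add[of "B - N" "B \<inter> N" n] B N(1) by (auto simp: Un_Diff_Int)
      also have "I n (B \<inter> N) = 0"
      proof -
        have "\<mu> (B \<inter> N \<inter> s n -` {F}) = 0" for F
          using B(1) N(1) simple_functionD(2)[OF s, of n "{F}"] by (intro N(2)) auto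
        then show ?thesis
          unfolding I_def using B(1) N(1)
          by (simp add: op_integral_eq[OF s] bounded_bilinear.zero_left[OF bounded_bilinear_blinfun_compose])
      qed
      finally have "norm (I n B) = norm (I n (B - N))" by simp
      also have "\<dots> \<le> C * sv_mass \<mu> (B - N)"
        unfolding I_def using B N(1) C by (intro norm_op_integral_le[OF s]) auto
      also have "\<dots> \<le> C * sv_mass \<mu> (A - N - E j)"
        using B C by (intro mult_left_mono sv_mass_mono) auto
      finally show ?thesis using j(2) by linarith
    qed
    then show ?thesis using j(1) by blast
  qed
  then obtain J where J: "\<And>n. J n \<ge> n"
    "\<And>n B. B \<in> sets borel \<Longrightarrow> B \<subseteq> A - E (J n) \<Longrightarrow> norm (I n B) \<le> e" by metis
  define m where "m i = ((\<lambda>n. Suc (J n)) ^^ i) 0" for i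
  have m_Suc: "m (Suc i) = Suc (J (m i))" for i by (simp add: m_def)
  have m_less: "m i < m (Suc i)" for i using J(1)[of "m i"] by (simp add: m_Suc)
  then have m_mono: "strict_mono m" by (simp add: strict_mono_Suc_iff)
  define B where "B i = E (J (m i)) - E (m i)" for i
  have B: "B i \<in> sets borel" for i using E by (auto simp: B_def)
  have B_disj: "B i \<inter> B j = {}" if "i < j" for i j
  proof -
    have "m (Suc i) \<le> m j" using that m_mono by (simp add: strict_mono_less_eq)
    then have "E (J (m i)) \<subseteq> E (m j)" by (intro E_mono) (simp add: m_Suc)
    then show ?thesis by (auto simp: B_def)
  qed
  then have B_disj: "B i \<inter> B j = {}" if "i \<noteq> j" for i j
    using that by (metis Int_commute linorder_neqE_nat)
  have BA: "B i \<subseteq> A" for i by (auto simp: B_def E_def)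
  have hump: "norm (I (m i) C - I (m i) (C \<inter> B i)) \<le> 2 * e" if C: "C \<in> sets borel" "C \<subseteq> A" for C i
  proof -
    define n where "n = m i"
    have En: "E n \<subseteq> E (J n)" using J(1) by (rule E_mono)
    have "C = (C \<inter> B i) \<union> ((C \<inter> E n) \<union> (C - E (J n)))"
      using En by (auto simp: B_def n_def)
    also have "I n \<dots> = I n (C \<inter> B i) + I n ((C \<inter> E n) \<union> (C - E (J n)))"
      using C B E En by (intro add) (auto simp: B_def n_def)
    also have "I n ((C \<inter> E n) \<union> (C - E (J n))) = I n (C \<inter> E n) + I n (C - E (J n))"
      using C E En by (intro add) auto
    finally have "norm (I n C - I n (C \<inter> B i)) \<le> norm (I n (C \<inter> E n)) + norm (I n (C - E (J n)))"
      by (simp add: norm_triangle_ineq)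
    also have "\<dots> \<le> e + e"
      using C E by (intro add_mono small[of _ n] J(2)) auto
    finally show ?thesis by (simp add: n_def)
  qed
  define U where "U = (\<Union>i. B (2 * i))"
  have U: "U \<in> sets borel" "U \<subseteq> A" using B BA by (auto simp: U_def)
  have U_even: "U \<inter> B (2 * i) = B (2 * i)" for i by (auto simp: U_def)
  have U_odd: "U \<inter> B (Suc (2 * i)) = {}" for i
  proof -
    have "2 * j \<noteq> Suc (2 * i)" for j by presburger
    then have "B (2 * j) \<inter> B (Suc (2 * i)) = {}" for j by (intro B_disj)
    then show ?thesis unfolding U_def by blast
  qed
  have I_lim: "(\<lambda>i. I (m (f i)) C) \<longlonglongrightarrow> \<nu> C" if "C \<in> sets borel" "strict_mono f" for f C
  proof -
    have "strict_mono (\<lambda>i. m (f i))" using m_mono that(2) by (simp add: strict_mono_def)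
    from LIMSEQ_subseq_LIMSEQ[OF int[OF that(1)] this] show ?thesis unfolding I_def comp_def .
  qed
  have "norm (\<nu> U) \<le> 2 * e"
  proof (rule tendsto_upperbound)
    show "(\<lambda>i. norm (I (m (Suc (2 * i))) U)) \<longlonglongrightarrow> norm (\<nu> U)"
      using U(1) by (intro tendsto_norm I_lim) (auto simp: strict_mono_def)
    have "I n {} = 0" for n using CA_empty[OF CA] s by (simp add: I_def op_integral_eq)
    then have "norm (I (m (Suc (2 * i))) U) \<le> 2 * e" for i
      using hump[OF U, of "Suc (2 * i)"] U_odd[of i] by simp
    then show "\<forall>\<^sub>F i in sequentially. norm (I (m (Suc (2 * i))) U) \<le> 2 * e" by simp
  qed simp
  moreover have "norm (\<nu> U - \<nu> A) \<le> 4 * e"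
  proof (rule tendsto_upperbound)
    show "(\<lambda>i. norm (I (m (2 * i)) U - I (m (2 * i)) A)) \<longlonglongrightarrow> norm (\<nu> U - \<nu> A)"
      using U(1) A by (intro tendsto_norm tendsto_diff I_lim) (auto simp: strict_mono_def)
    have "norm (I (m (2 * i)) U - I (m (2 * i)) A) \<le> 4 * e" for i
    proof -
      have "A \<inter> B (2 * i) = B (2 * i)" using BA by auto
      then show ?thesis
        using hump[OF U, of "2 * i"] hump[OF A order.refl, of "2 * i"] U_even[of i]
          norm_triangle_ineq4[of "I (m (2 * i)) U - I (m (2 * i)) (B (2 * i))"
            "I (m (2 * i)) A - I (m (2 * i)) (B (2 * i))"]
        by (simp add: algebra_simps)
    qed
    then show "\<forall>\<^sub>F i in sequentially. norm (I (m (2 * i)) U - I (m (2 * i)) A) \<le> 4 * e" by simp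
  qed simp
  ultimately have "norm (\<nu> A) \<le> 6 * e"
    using norm_triangle_ineq4[of "\<nu> U" "\<nu> U - \<nu> A"] by simp
  then show False using e by (simp add: e_def)
qed

end

section \<open>The Dobrakov integral of a bounded limit of simple functions\<close>

text \<open>
  The properties of the space \<open>L(V)\<close> of operators that are linear over the scalar field, as far as the
  product needs them. The identity operator serves to recognise null sets.
\<close>

locale operator_space =
  fixes E :: "('v::banach \<Rightarrow>\<^sub>L 'v) set"
  assumes subspace: "subspace E" and closed: "closed E" and id_in: "id_blinfun \<in> E"

text \<open>
  Uniformly bounded simple functions with values in \<open>E\<close> that converge to \<open>\<psi>\<close> everywhere.
\<close>

definition bounded_simple_approx ::
  "('v::real_normed_vector \<Rightarrow>\<^sub>L 'v) set \<Rightarrow> ('a::topological_space \<Rightarrow> 'v \<Rightarrow>\<^sub>L 'v) \<Rightarrow>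
   (nat \<Rightarrow> 'a \<Rightarrow> 'v \<Rightarrow>\<^sub>L 'v) \<Rightarrow> bool" where
  "bounded_simple_approx E \<psi> s \<longleftrightarrow> (\<forall>n. simple_function borel (s n) \<and> range (s n) \<subseteq> E) \<and>
     (\<exists>K. \<forall>n x. norm (s n x) \<le> K) \<and> (\<forall>x. (\<lambda>n. s n x) \<longlonglongrightarrow> \<psi> x)"

text \<open>
  \<open>L(V)\<close> need not be separable, so simple approximations are taken in the domain: composing \<open>\<psi>\<close>
  with simple functions that converge to the identity of the Euclidean space also keeps the values
  in \<open>E\<close> and preserves every bound of \<open>\<psi>\<close>.
\<close>

lemma continuous_imp_bounded_simple_approx:
  fixes \<psi> :: "'a::euclidean_space \<Rightarrow> 'v::real_normed_vector \<Rightarrow>\<^sub>L 'v"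
  assumes cont: "continuous_on UNIV \<psi>" and C: "\<And>x. norm (\<psi> x) \<le> C" and E: "range \<psi> \<subseteq> E"
  shows "\<exists>s. bounded_simple_approx E \<psi> s"
proof -
  obtain F :: "nat \<Rightarrow> 'a \<Rightarrow> 'a" where F: "\<And>i. simple_function borel (F i)" "\<And>x. (\<lambda>i. F i x) \<longlonglongrightarrow> x"
    using borel_measurable_implies_sequence_metric[of "\<lambda>x::'a. x" borel 0] by auto
  have "bounded_simple_approx E \<psi> (\<lambda>n x. \<psi> (F n x))"
    unfolding bounded_simple_approx_def
  proof (intro conjI allI)
    fix n show "simple_function borel (\<lambda>x. \<psi> (F n x))" using F(1) by (rule simple_function_compose1)
    show "range (\<lambda>x. \<psi> (F n x)) \<subseteq> E" using E by auto
  next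
    show "\<exists>K. \<forall>n x. norm (\<psi> (F n x)) \<le> K" using C by blast
  next
    fix x
    have "isCont \<psi> x" using cont by (simp add: continuous_on_eq_continuous_at)
    then show "(\<lambda>n. \<psi> (F n x)) \<longlonglongrightarrow> \<psi> x" using F(2) isCont_tendsto_compose by blast
  qed
  then show ?thesis by blast
qed

text \<open>
  A null set for the semivariation of \<open>F \<mapsto> \<mu>(A) \<circ> F\<close> is a null set for \<open>\<mu>\<close>, as \<open>F\<close> may be the
  identity.
\<close>

lemma null_of_semivariation_composition:
  assumes "semivariation E (composition_measure \<mu>) N = 0" "id_blinfun \<in> E" "B \<in> sets borel" "B \<subseteq> N"
  shows "\<mu> B = 0"
proof -
  have "ennreal (norm (\<Sum>i<Suc 0. blinfun_apply (composition_measure \<mu> B) id_blinfun)) \<le>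
      semivariation E (composition_measure \<mu>) N"
    using assms norm_blinfun_id_le
    by (intro semivariation_upper[where B="\<lambda>_. B"]) (auto simp: disjoint_family_on_def)
  then have "\<mu> B o\<^sub>L id_blinfun = 0" using assms(1) by simp
  then have "blinfun_apply (\<mu> B o\<^sub>L id_blinfun) v = 0" for v by simp
  then show ?thesis by (intro blinfun_eqI) simp
qed

lemma product_measure_limit:
  fixes \<mu> :: "'a::topological_space set \<Rightarrow> 'v::banach \<Rightarrow>\<^sub>L 'w::banach"
  assumes E: "operator_space E" and \<mu>: "csv_measure \<mu>" and s: "bounded_simple_approx E \<psi> s"
    and A: "A \<in> sets borel"
  shows "(\<lambda>n. op_integral \<mu> A (s n)) \<longlonglongrightarrow> product_measure E \<mu> \<psi> A"
proof -
  interpret operator_space E by fact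
  interpret csv_measure \<mu> by fact
  have conv: "convergent (\<lambda>n. op_integral \<mu> A (s n))" if "A \<in> sets borel" for A
  proof -
    obtain K where "\<And>n x. norm (s n x) \<le> K" using s by (auto simp: bounded_simple_approx_def)
    then show ?thesis
      using s that by (intro convergent_op_integral[of s K])
        (auto simp: bounded_simple_approx_def convergent_def complete_UNIV)
  qed
  have s_approx: "dobrakov_approx E (composition_measure \<mu>) \<psi> s"
    unfolding dobrakov_approx_def
  proof (intro conjI ballI)
    have "semivariation E (composition_measure \<mu>) {} \<le> 0"
      by (rule semivariation_least) (auto simp: CA_empty[OF CA])
    then show "\<exists>N\<in>sets borel. semivariation E (composition_measure \<mu>) N = 0 \<and>
        (\<forall>x. x \<notin> N \<longrightarrow> (\<lambda>n. s n x) \<longlonglongrightarrow> \<psi> x)"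
      using s by (intro bexI[of _ "{}"]) (auto simp: bounded_simple_approx_def)
  qed (use s conv in \<open>auto simp: bounded_simple_approx_def\<close>)
  obtain I where I: "(\<lambda>n. op_integral \<mu> A (s n)) \<longlonglongrightarrow> I"
    using conv[OF A] by (auto simp: convergent_def)
  have "dobrakov_integral E (composition_measure \<mu>) A \<psi> = I"
    unfolding dobrakov_integral_def
  proof (rule the_equality)
    show "\<exists>s. dobrakov_approx E (composition_measure \<mu>) \<psi> s \<and> (\<lambda>n. op_integral \<mu> A (s n)) \<longlonglongrightarrow> I"
      using s_approx I by blast
    fix I' assume "\<exists>t. dobrakov_approx E (composition_measure \<mu>) \<psi> t \<and> (\<lambda>n. op_integral \<mu> A (t n)) \<longlonglongrightarrow> I'"
    then obtain t where t: "dobrakov_approx E (composition_measure \<mu>) \<psi> t"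
      and I': "(\<lambda>n. op_integral \<mu> A (t n)) \<longlonglongrightarrow> I'" by blast
    obtain N where N: "N \<in> sets borel" "semivariation E (composition_measure \<mu>) N = 0"
      "\<And>x. x \<notin> N \<Longrightarrow> (\<lambda>n. t n x) \<longlonglongrightarrow> \<psi> x"
      using t by (auto simp: dobrakov_approx_def)
    have simp: "simple_function borel (s n)" "simple_function borel (t n)" for n
      using s t by (auto simp: bounded_simple_approx_def dobrakov_approx_def)
    define \<nu> where "\<nu> B = lim (\<lambda>n. op_integral \<mu> B (\<lambda>x. t n x - s n x))" for B
    have \<nu>: "(\<lambda>n. op_integral \<mu> B (\<lambda>x. t n x - s n x)) \<longlonglongrightarrow> \<nu> B" if "B \<in> sets borel" for B
    proof -
      have "convergent (\<lambda>n. op_integral \<mu> B (t n) - op_integral \<mu> B (s n))"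
        using t that conv[OF that] by (intro convergent_diff) (auto simp: dobrakov_approx_def)
      then show ?thesis
        unfolding \<nu>_def convergent_LIMSEQ_iff by (simp add: op_integral_add_diff(2)[OF simp(2) simp(1) that])
    qed
    have "\<nu> A = 0"
    proof (rule op_integral_limit_zero[OF _ N(1) _ _ \<nu> A])
      show "simple_function borel (\<lambda>x. t n x - s n x)" for n
        using simple_function_compose2[OF simp(2) simp(1)] .
      show "\<mu> B = 0" if "B \<in> sets borel" "B \<subseteq> N" for B
        using null_of_semivariation_composition[OF N(2) id_in that] .
      show "(\<lambda>n. t n x - s n x) \<longlonglongrightarrow> 0" if "x \<notin> N" for x
      proof -
        have "(\<lambda>n. s n x) \<longlonglongrightarrow> \<psi> x" using s by (simp add: bounded_simple_approx_def)
        from tendsto_diff[OF N(3)[OF that] this] show ?thesis by simp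
      qed
    qed
    moreover have "\<nu> A = I' - I"
      using tendsto_diff[OF I' I] \<nu>[OF A]
      by (simp add: op_integral_add_diff(2)[OF simp(2) simp(1) A] LIMSEQ_unique)
    ultimately show "I' = I" by simp
  qed
  then show ?thesis using I A by (simp add: product_measure_def)
qed

section \<open>The product of a measure and a bounded continuous function\<close>

text \<open>
  The bounded continuous functions with values in \<open>E\<close>.
\<close>

definition Cb :: "'y set \<Rightarrow> ('a::topological_space \<Rightarrow> 'y::real_normed_vector) set" where
  "Cb E = {\<psi>. continuous_on UNIV \<psi> \<and> bounded (range \<psi>) \<and> range \<psi> \<subseteq> E}"

lemma CbI:
  assumes "continuous_on UNIV \<psi>" "\<And>x. norm (\<psi> x) \<le> C" "\<And>x. \<psi> x \<in> E"
  shows "\<psi> \<in> Cb E"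
  using assms by (auto simp: Cb_def bounded_iff)

lemma Cb_bound:
  assumes "\<psi> \<in> Cb E"
  obtains C where "0 < C" "\<And>x. norm (\<psi> x) \<le> C"
  using assms by (auto simp: Cb_def bounded_pos)

lemma Cb_add: "subspace E \<Longrightarrow> \<psi> \<in> Cb E \<Longrightarrow> \<psi>' \<in> Cb E \<Longrightarrow> (\<lambda>x. \<psi> x + \<psi>' x) \<in> Cb E"
  by (auto simp: Cb_def intro!: continuous_intros bounded_plus_comp subspace_add)

lemma Cb_scaleR: "subspace E \<Longrightarrow> \<psi> \<in> Cb E \<Longrightarrow> (\<lambda>x. r *\<^sub>R \<psi> x) \<in> Cb E"
  by (auto simp: Cb_def intro!: continuous_intros bounded_scaleR_comp subspace_scale)

lemma Cb_diff: "subspace E \<Longrightarrow> \<psi> \<in> Cb E \<Longrightarrow> \<psi>' \<in> Cb E \<Longrightarrow> (\<lambda>x. \<psi> x - \<psi>' x) \<in> Cb E"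
  by (auto simp: Cb_def intro!: continuous_intros bounded_minus_comp subspace_diff)

lemma Cb_translate: "\<psi> \<in> Cb E \<Longrightarrow> (\<lambda>a. \<psi> (a + x)) \<in> Cb E" for x :: "'a::real_normed_vector"
proof -
  assume \<psi>: "\<psi> \<in> Cb E"
  then have "continuous_on UNIV (\<lambda>a. \<psi> (a + x))"
    using continuous_on_compose2[of UNIV \<psi> UNIV "\<lambda>a. a + x"]
    by (simp add: Cb_def continuous_on_add)
  then show ?thesis using \<psi> by (auto simp: Cb_def bounded_iff)
qed

lemma bounded_simple_approx_simple: "bounded_simple_approx E \<psi> s \<Longrightarrow> simple_function borel (s n)"
  by (simp add: bounded_simple_approx_def)

lemma Cb_approx:
  fixes \<psi> :: "'a::euclidean_space \<Rightarrow> 'v::real_normed_vector \<Rightarrow>\<^sub>L 'v"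
  assumes "\<psi> \<in> Cb E"
  obtains s where "bounded_simple_approx E \<psi> s"
proof -
  obtain C where "\<And>x. norm (\<psi> x) \<le> C" using assms by (metis Cb_bound)
  then have "\<exists>s. bounded_simple_approx E \<psi> s"
    using assms by (intro continuous_imp_bounded_simple_approx) (auto simp: Cb_def)
  then show thesis using that by blast
qed

locale csv_product = operator_space E + csv_measure \<mu>
  for E :: "('v::banach \<Rightarrow>\<^sub>L 'v) set"
    and \<mu> :: "'a::euclidean_space set \<Rightarrow> 'v \<Rightarrow>\<^sub>L 'w::banach"
begin

lemmas limit = product_measure_limit[OF operator_space_axioms csv_measure_axioms]

lemma product_measure_add_right:
  assumes \<psi>: "\<psi> \<in> Cb E" and \<psi>': "\<psi>' \<in> Cb E" and A: "A \<in> sets borel"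
  shows "product_measure E \<mu> (\<lambda>x. \<psi> x + \<psi>' x) A = product_measure E \<mu> \<psi> A + product_measure E \<mu> \<psi>' A"
proof -
  obtain s where s: "bounded_simple_approx E \<psi> s" using \<psi> by (rule Cb_approx)
  obtain t where t: "bounded_simple_approx E \<psi>' t" using \<psi>' by (rule Cb_approx)
  have "bounded_simple_approx E (\<lambda>x. \<psi> x + \<psi>' x) (\<lambda>n x. s n x + t n x)"
    unfolding bounded_simple_approx_def
  proof (intro conjI allI)
    obtain K L where "\<And>n x. norm (s n x) \<le> K" "\<And>n x. norm (t n x) \<le> L"
      using s t by (auto simp: bounded_simple_approx_def)
    then have "norm (s n x + t n x) \<le> K + L" for n x
      by (meson add_mono norm_triangle_ineq order_trans)
    then show "\<exists>K. \<forall>n x. norm (s n x + t n x) \<le> K" by blast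
  qed (use s t subspace in \<open>auto simp: bounded_simple_approx_def image_subset_iff intro!: tendsto_add subspace_add\<close>)
  from limit[OF this A] have "(\<lambda>n. op_integral \<mu> A (s n) + op_integral \<mu> A (t n)) \<longlonglongrightarrow>
      product_measure E \<mu> (\<lambda>x. \<psi> x + \<psi>' x) A"
    using op_integral_add_diff(1)[OF bounded_simple_approx_simple[OF s] bounded_simple_approx_simple[OF t] A]
    by simp
  moreover have "(\<lambda>n. op_integral \<mu> A (s n) + op_integral \<mu> A (t n)) \<longlonglongrightarrow>
      product_measure E \<mu> \<psi> A + product_measure E \<mu> \<psi>' A"
    by (intro tendsto_add limit s t A)
  ultimately show ?thesis by (rule LIMSEQ_unique)
qed

lemma product_measure_scaleR_right:
  assumes \<psi>: "\<psi> \<in> Cb E" and A: "A \<in> sets borel"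
  shows "product_measure E \<mu> (\<lambda>x. r *\<^sub>R \<psi> x) A = r *\<^sub>R product_measure E \<mu> \<psi> A"
proof -
  obtain s where s: "bounded_simple_approx E \<psi> s" using \<psi> by (rule Cb_approx)
  have "bounded_simple_approx E (\<lambda>x. r *\<^sub>R \<psi> x) (\<lambda>n x. r *\<^sub>R s n x)"
    unfolding bounded_simple_approx_def
  proof (intro conjI allI)
    obtain K where "\<And>n x. norm (s n x) \<le> K" using s by (auto simp: bounded_simple_approx_def)
    then have "norm (r *\<^sub>R s n x) \<le> \<bar>r\<bar> * K" for n x by (simp add: mult_left_mono)
    then show "\<exists>K. \<forall>n x. norm (r *\<^sub>R s n x) \<le> K" by blast
    show "simple_function borel (\<lambda>x. r *\<^sub>R s n x)" for n
      using bounded_simple_approx_simple[OF s] by (rule simple_function_compose1)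
  qed (use s subspace in \<open>auto simp: bounded_simple_approx_def image_subset_iff intro!: tendsto_scaleR subspace_scale\<close>)
  from limit[OF this A] have "(\<lambda>n. r *\<^sub>R op_integral \<mu> A (s n)) \<longlonglongrightarrow>
      product_measure E \<mu> (\<lambda>x. r *\<^sub>R \<psi> x) A"
    by (simp add: op_integral_scaleR[OF bounded_simple_approx_simple[OF s] A])
  moreover have "(\<lambda>n. r *\<^sub>R op_integral \<mu> A (s n)) \<longlonglongrightarrow> r *\<^sub>R product_measure E \<mu> \<psi> A"
    by (intro tendsto_scaleR tendsto_const limit s A)
  ultimately show ?thesis by (rule LIMSEQ_unique)
qed

lemma additive_product_measure:
  assumes \<psi>: "\<psi> \<in> Cb E"
  shows "additive_set_function (product_measure E \<mu> \<psi>)"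
  unfolding additive_set_function_def
proof (intro ballI impI)
  fix A B :: "'a set" assume A: "A \<in> sets borel" "B \<in> sets borel" "A \<inter> B = {}"
  obtain s where s: "bounded_simple_approx E \<psi> s" using \<psi> by (rule Cb_approx)
  have "(\<lambda>n. op_integral \<mu> (A \<union> B) (s n)) \<longlonglongrightarrow> product_measure E \<mu> \<psi> (A \<union> B)"
    using A by (intro limit s) auto
  moreover have "op_integral \<mu> (A \<union> B) (s n) = op_integral \<mu> A (s n) + op_integral \<mu> B (s n)" for n
    using additive_set_functionD[OF additive_op_integral[OF bounded_simple_approx_simple[OF s]] A] .
  moreover have "(\<lambda>n. op_integral \<mu> A (s n) + op_integral \<mu> B (s n)) \<longlonglongrightarrow>
      product_measure E \<mu> \<psi> A + product_measure E \<mu> \<psi> B"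
    using A by (intro tendsto_add limit s)
  ultimately show "product_measure E \<mu> \<psi> (A \<union> B) = product_measure E \<mu> \<psi> A + product_measure E \<mu> \<psi> B"
    using LIMSEQ_unique by auto
qed

lemma semivariation_product_measure_le:
  assumes \<psi>: "\<psi> \<in> Cb E" and A: "A \<in> sets borel" and c: "\<And>x. x \<in> A \<Longrightarrow> norm (\<psi> x) \<le> c" "0 \<le> c"
  shows "semivariation UNIV (product_measure E \<mu> \<psi>) A \<le> ennreal (c * sv_mass \<mu> A)"
proof (rule ennreal_le_epsilon)
  fix e :: real assume e: "e > 0"
  define d where "d = e / 2 / (sv_mass \<mu> A + 1)"
  have pos: "sv_mass \<mu> A + 1 > 0" using sv_mass_nonneg[of A] by linarith
  have d: "d > 0" "d * sv_mass \<mu> A \<le> e / 2"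
    using e pos by (auto simp: d_def divide_simps mult_left_mono)
  obtain s where s: "bounded_simple_approx E \<psi> s" using \<psi> by (rule Cb_approx)
  obtain K where K: "\<And>n x. norm (s n x) \<le> K" using s by (auto simp: bounded_simple_approx_def)
  have "\<exists>j. \<forall>n\<in>{j..}. semivariation UNIV (\<lambda>B. op_integral \<mu> B (s n)) A \<le>
      ennreal ((c + d) * sv_mass \<mu> A + e / 2)"
  proof (rule simple_limit_semivariation[OF bounded_simple_approx_simple[OF s] K A])
    show "decseq (\<lambda>j::nat. {j..})" by (auto simp: decseq_def)
    show "\<exists>j. \<forall>n\<in>{j..}. norm (s n x) \<le> c + d" if "x \<in> A" for x
    proof -
      have "(\<lambda>n. norm (s n x)) \<longlonglongrightarrow> norm (\<psi> x)"
        using s by (intro tendsto_norm) (simp add: bounded_simple_approx_def)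
      then have "\<forall>\<^sub>F n in sequentially. norm (s n x) < c + d"
        using c(1)[OF that] d(1) by (intro order_tendstoD) auto
      then show ?thesis by (force simp: eventually_sequentially)
    qed
  qed (use c d e in auto)
  then have ev: "\<forall>\<^sub>F n in sequentially. semivariation UNIV (\<lambda>B. op_integral \<mu> B (s n)) A \<le>
      ennreal ((c + d) * sv_mass \<mu> A + e / 2)"
    by (auto simp: eventually_sequentially)
  have "semivariation UNIV (product_measure E \<mu> \<psi>) A \<le> ennreal ((c + d) * sv_mass \<mu> A + e / 2)"
    by (rule semivariation_le_of_tendsto[OF _ ev]) (use limit[OF s] c d e in auto)
  also have "\<dots> \<le> ennreal (c * sv_mass \<mu> A + e)"
    using d by (intro ennreal_leI) (simp add: algebra_simps)
  also have "\<dots> = ennreal (c * sv_mass \<mu> A) + ennreal e"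
    using c e by simp
  finally show "semivariation UNIV (product_measure E \<mu> \<psi>) A \<le> ennreal (c * sv_mass \<mu> A) + ennreal e" .
qed

lemma finite_semivariation_product_measure:
  assumes \<psi>: "\<psi> \<in> Cb E"
  shows "semivariation UNIV (product_measure E \<mu> \<psi>) UNIV < \<infinity>"
proof -
  obtain C where C: "0 < C" "\<And>x. norm (\<psi> x) \<le> C" using Cb_bound[OF \<psi>] by metis
  have "semivariation UNIV (product_measure E \<mu> \<psi>) UNIV \<le> ennreal (C * sv_mass \<mu> UNIV)"
    using C by (intro semivariation_product_measure_le[OF \<psi>]) auto
  then show ?thesis by (auto intro: le_less_trans)
qed

lemma product_measure_in_CA:
  assumes \<psi>: "\<psi> \<in> Cb E"
    and Y: "closed Y" "subspace Y" "\<And>A F. A \<in> sets borel \<Longrightarrow> F \<in> E \<Longrightarrow> \<mu> A o\<^sub>L F \<in> Y"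
  shows "product_measure E \<mu> \<psi> \<in> CA Y"
  unfolding CA_def
proof (intro CollectI conjI ballI allI impI)
  let ?\<nu> = "product_measure E \<mu> \<psi>"
  obtain s where s: "bounded_simple_approx E \<psi> s" using \<psi> by (rule Cb_approx)
  note ss = bounded_simple_approx_simple[OF s]
  show "?\<nu> A \<in> Y" if A: "A \<in> sets borel" for A
  proof (rule closed_sequentially[OF Y(1) _ limit[OF s A]])
    fix n
    have "range (s n) \<subseteq> E" using s by (simp add: bounded_simple_approx_def)
    then show "op_integral \<mu> A (s n) \<in> Y"
      unfolding op_integral_eq[OF ss A]
      using A simple_functionD(2)[OF ss, of n] by (intro subspace_sum Y) auto
  qed
  show "?\<nu> A = 0" if "A \<notin> sets borel" for A
    using that by (simp add: product_measure_def)
  fix A :: "nat \<Rightarrow> 'a set" assume A: "range A \<subseteq> sets borel" "disjoint_family A"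
  obtain C where C: "0 < C" "\<And>x. norm (\<psi> x) \<le> C" using Cb_bound[OF \<psi>] by metis
  \<comment> \<open>finite additivity reduces the claim to the tails \<open>T n\<close>, which decrease to the empty set\<close>
  define T where "T n = (\<Union>i\<in>{n..}. A i)" for n
  have T: "T n \<in> sets borel" for n unfolding T_def using A(1) by (intro sets.countable_UN') auto
  have head: "?\<nu> (\<Union>i. A i) = (\<Sum>i<n. ?\<nu> (A i)) + ?\<nu> (T n)" for n
  proof (induction n)
    case 0
    show ?case by (simp add: T_def)
  next
    case (Suc n)
    have "T n = A n \<union> T (Suc n)"
    proof -
      have "{n..} = insert n {Suc n..}" by auto
      then show ?thesis by (simp add: T_def)
    qed
    moreover have "?\<nu> (A n \<union> T (Suc n)) = ?\<nu> (A n) + ?\<nu> (T (Suc n))"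
    proof (rule additive_set_functionD[OF additive_product_measure[OF \<psi>]])
      have "A n \<inter> A i = {}" if "i \<ge> Suc n" for i
        using that by (intro disjoint_family_onD[OF A(2)]) auto
      then show "A n \<inter> T (Suc n) = {}" unfolding T_def by blast
    qed (use A(1) T in auto)
    ultimately have "?\<nu> (T n) = ?\<nu> (A n) + ?\<nu> (T (Suc n))" by simp
    then show ?case using Suc by simp
  qed
  have "(\<lambda>n. sv_mass \<mu> (T n)) \<longlonglongrightarrow> 0"
  proof (rule sv_mass_tendsto_0)
    show "range T \<subseteq> sets borel" using T by auto
    show "decseq T" unfolding decseq_def T_def by fastforce
    show "(\<Inter>n. T n) = {}"
    proof -
      have "x \<notin> (\<Inter>n. T n)" for x
      proof
        assume x: "x \<in> (\<Inter>n. T n)"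
        then obtain i where i: "x \<in> A i" by (auto simp: T_def)
        from x have "x \<in> T (Suc i)" by blast
        then obtain j where "j \<ge> Suc i" "x \<in> A j" by (auto simp: T_def)
        then show False using i disjoint_family_onD[OF A(2), of i j] by auto
      qed
      then show ?thesis by blast
    qed
  qed
  then have lim: "(\<lambda>n. C * sv_mass \<mu> (T n)) \<longlonglongrightarrow> 0" by (rule tendsto_mult_right_zero)
  have "(\<lambda>n. ?\<nu> (T n)) \<longlonglongrightarrow> 0"
  proof (rule tendsto_norm_zero_cancel, rule tendsto_sandwich[OF _ _ tendsto_const lim])
    have "norm (?\<nu> (T n)) \<le> C * sv_mass \<mu> (T n)" for n
      using C by (intro norm_le_of_semivariation_le[OF semivariation_product_measure_le[OF \<psi> T[of n]] T]) auto
    then show "\<forall>\<^sub>F n in sequentially. norm (?\<nu> (T n)) \<le> C * sv_mass \<mu> (T n)" by simp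
  qed simp
  then have "(\<lambda>n. ?\<nu> (\<Union>i. A i) - ?\<nu> (T n)) \<longlonglongrightarrow> ?\<nu> (\<Union>i. A i) - 0"
    by (intro tendsto_diff tendsto_const)
  moreover have "?\<nu> (\<Union>i. A i) - ?\<nu> (T n) = (\<Sum>i<n. ?\<nu> (A i))" for n
    using head[of n] by simp
  ultimately show "(\<lambda>n. ?\<nu> (A n)) sums ?\<nu> (\<Union>n. A n)"
    unfolding sums_def by simp
qed

end

lemma CA_subset: "Y \<subseteq> Z \<Longrightarrow> CA Y \<subseteq> CA Z"
  by (auto simp: CA_def)

lemma product_measure_add_left:
  fixes \<mu> \<mu>' :: "'a::euclidean_space set \<Rightarrow> 'v::banach \<Rightarrow>\<^sub>L 'w::banach"
  assumes E: "operator_space E" and \<mu>: "csv_measure \<mu>" "csv_measure \<mu>'" "csv_measure (\<lambda>A. \<mu> A + \<mu>' A)"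
    and \<psi>: "\<psi> \<in> Cb E" and A: "A \<in> sets borel"
  shows "product_measure E (\<lambda>A. \<mu> A + \<mu>' A) \<psi> A = product_measure E \<mu> \<psi> A + product_measure E \<mu>' \<psi> A"
proof -
  obtain s where s: "bounded_simple_approx E \<psi> s" using \<psi> by (rule Cb_approx)
  have "op_integral (\<lambda>A. \<mu> A + \<mu>' A) A (s n) = op_integral \<mu> A (s n) + op_integral \<mu>' A (s n)" for n
    by (simp add: simple_integral_def sum.distrib bounded_bilinear.add_left[OF bounded_bilinear_blinfun_compose])
  then have "(\<lambda>n. op_integral \<mu> A (s n) + op_integral \<mu>' A (s n)) \<longlonglongrightarrow>
      product_measure E (\<lambda>A. \<mu> A + \<mu>' A) \<psi> A"
    using product_measure_limit[OF E \<mu>(3) s A] by simp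
  moreover have "(\<lambda>n. op_integral \<mu> A (s n) + op_integral \<mu>' A (s n)) \<longlonglongrightarrow>
      product_measure E \<mu> \<psi> A + product_measure E \<mu>' \<psi> A"
    by (intro tendsto_add product_measure_limit[OF E _ s A] \<mu>)
  ultimately show ?thesis by (rule LIMSEQ_unique)
qed

lemma product_measure_scaleR_left:
  fixes \<mu> :: "'a::euclidean_space set \<Rightarrow> 'v::banach \<Rightarrow>\<^sub>L 'w::banach"
  assumes E: "operator_space E" and \<mu>: "csv_measure \<mu>" "csv_measure (\<lambda>A. r *\<^sub>R \<mu> A)"
    and \<psi>: "\<psi> \<in> Cb E" and A: "A \<in> sets borel"
  shows "product_measure E (\<lambda>A. r *\<^sub>R \<mu> A) \<psi> A = r *\<^sub>R product_measure E \<mu> \<psi> A"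
proof -
  obtain s where s: "bounded_simple_approx E \<psi> s" using \<psi> by (rule Cb_approx)
  have "op_integral (\<lambda>A. r *\<^sub>R \<mu> A) A (s n) = r *\<^sub>R op_integral \<mu> A (s n)" for n
    by (simp add: simple_integral_def scaleR_sum_right bounded_bilinear.scaleR_left[OF bounded_bilinear_blinfun_compose])
  then have "(\<lambda>n. r *\<^sub>R op_integral \<mu> A (s n)) \<longlonglongrightarrow> product_measure E (\<lambda>A. r *\<^sub>R \<mu> A) \<psi> A"
    using product_measure_limit[OF E \<mu>(2) s A] by simp
  moreover have "(\<lambda>n. r *\<^sub>R op_integral \<mu> A (s n)) \<longlonglongrightarrow> r *\<^sub>R product_measure E \<mu> \<psi> A"
    by (intro tendsto_scaleR tendsto_const product_measure_limit[OF E _ s A] \<mu>)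
  ultimately show ?thesis by (rule LIMSEQ_unique)
qed

section \<open>Translations of measures\<close>

lemma borel_translate: "(\<lambda>a. a + x) ` A \<in> sets borel" if "A \<in> sets borel"
  for x :: "'a::real_normed_vector"
proof -
  have "(\<lambda>a. a + x) ` A = (\<lambda>a. a - x) -` A \<inter> space borel"
    by (auto simp: image_iff) (metis diff_add_cancel)
  also have "(\<lambda>a. a - x) \<in> measurable borel borel"
    by (intro borel_measurable_continuous_onI continuous_intros)
  then have "(\<lambda>a. a - x) -` A \<inter> space borel \<in> sets borel" using that by (rule measurable_sets)
  finally show ?thesis .
qed

lemma borel_translate_iff: "(\<lambda>a. a + x) ` A \<in> sets borel \<longleftrightarrow> A \<in> sets borel"
  for x :: "'a::real_normed_vector"
proof
  assume "(\<lambda>a. a + x) ` A \<in> sets borel"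
  from borel_translate[OF this, of "-x"] show "A \<in> sets borel" by (simp add: image_image)
qed (rule borel_translate)

lemma inj_translate: "inj (\<lambda>a. a + x)" for x :: "'a::real_normed_vector"
  by (rule injI) simp

lemma CA_D:
  assumes "\<mu> \<in> CA Y"
  shows CA_value: "A \<in> sets borel \<Longrightarrow> \<mu> A \<in> Y" and CA_outside: "A \<notin> sets borel \<Longrightarrow> \<mu> A = 0"
    and CA_sums: "range B \<subseteq> sets borel \<Longrightarrow> disjoint_family B \<Longrightarrow> (\<lambda>n. \<mu> (B n)) sums \<mu> (\<Union>n. B n)"
proof -
  have *: "(\<forall>A\<in>sets borel. \<mu> A \<in> Y)" "(\<forall>A. A \<notin> sets borel \<longrightarrow> \<mu> A = 0)"
     "(\<forall>A::nat \<Rightarrow> 'a set. range A \<subseteq> sets borel \<longrightarrow> disjoint_family A \<longrightarrow>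
        (\<lambda>n. \<mu> (A n)) sums \<mu> (\<Union>n. A n))"
    by (insert assms, unfold CA_def mem_Collect_eq) ((elim conjE)?, assumption)+
  show "A \<in> sets borel \<Longrightarrow> \<mu> A \<in> Y" using *(1) by (rule bspec)
  show "A \<notin> sets borel \<Longrightarrow> \<mu> A = 0" using *(2)[rule_format] .
  show "range B \<subseteq> sets borel \<Longrightarrow> disjoint_family B \<Longrightarrow> (\<lambda>n. \<mu> (B n)) sums \<mu> (\<Union>n. B n)"
    using *(3)[rule_format] .
qed

lemma translate_measure_in_CA:
  assumes \<mu>: "\<mu> \<in> CA Y"
  shows "translate_measure x \<mu> \<in> CA Y"
  unfolding CA_def
proof (intro CollectI conjI ballI allI impI)
  show "translate_measure x \<mu> A \<in> Y" if "A \<in> sets borel" for A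
    unfolding translate_measure_def using that by (intro CA_value[OF \<mu>] borel_translate)
  show "translate_measure x \<mu> A = 0" if "A \<notin> sets borel" for A
    unfolding translate_measure_def using that by (intro CA_outside[OF \<mu>]) (simp add: borel_translate_iff)
  fix A :: "nat \<Rightarrow> 'a set" assume A: "range A \<subseteq> sets borel" "disjoint_family A"
  have "(\<lambda>n. \<mu> ((\<lambda>a. a + x) ` A n)) sums \<mu> (\<Union>n. (\<lambda>a. a + x) ` A n)"
  proof (rule CA_sums[OF \<mu>])
    show "range (\<lambda>n. (\<lambda>a. a + x) ` A n) \<subseteq> sets borel" using A(1) by (auto intro!: borel_translate)
    show "disjoint_family (\<lambda>n. (\<lambda>a. a + x) ` A n)"
      unfolding disjoint_family_on_def using disjoint_family_onD[OF A(2)] by fastforce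
  qed
  then show "(\<lambda>n. translate_measure x \<mu> (A n)) sums translate_measure x \<mu> (\<Union>n. A n)"
    by (simp add: translate_measure_def image_UN)
qed

lemma semivariation_translate_le:
  "semivariation E (translate_measure x \<mu>) A \<le> semivariation E \<mu> ((\<lambda>a. a + x) ` A)"
proof (rule semivariation_least)
  fix n :: nat and C v
  assume C: "disjoint_family_on C {..<n}"
    "\<And>i. i < n \<Longrightarrow> C i \<in> sets borel \<and> C i \<subseteq> A \<and> v i \<in> E \<and> norm (v i) \<le> 1"
  show "ennreal (norm (\<Sum>i<n. blinfun_apply (translate_measure x \<mu> (C i)) (v i))) \<le>
      semivariation E \<mu> ((\<lambda>a. a + x) ` A)"
    unfolding translate_measure_def
  proof (rule semivariation_upper)
    show "disjoint_family_on (\<lambda>i. (\<lambda>a. a + x) ` C i) {..<n}"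
      using C(1) by (auto simp: disjoint_family_on_def; blast)
    show "(\<lambda>a. a + x) ` C i \<in> sets borel \<and> (\<lambda>a. a + x) ` C i \<subseteq> (\<lambda>a. a + x) ` A \<and> v i \<in> E \<and> norm (v i) \<le> 1"
      if "i < n" for i
      using C(2)[OF that] by (auto intro!: borel_translate)
  qed
qed

lemma translate_translate: "translate_measure x (translate_measure y \<mu>) = translate_measure (x + y) \<mu>"
  by (rule ext) (simp add: translate_measure_def image_image add.assoc)

lemma translate_0: "translate_measure 0 \<mu> = \<mu>"
  by (rule ext) (simp add: translate_measure_def)

lemma semivariation_translate:
  "semivariation E (translate_measure x \<mu>) A = semivariation E \<mu> ((\<lambda>a. a + x) ` A)"
proof (rule antisym[OF semivariation_translate_le])
  have "semivariation E (translate_measure (-x) (translate_measure x \<mu>)) ((\<lambda>a. a + x) ` A) \<le>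
      semivariation E (translate_measure x \<mu>) ((\<lambda>a. a + - x) ` (\<lambda>a. a + x) ` A)"
    by (rule semivariation_translate_le)
  then show "semivariation E \<mu> ((\<lambda>a. a + x) ` A) \<le> semivariation E (translate_measure x \<mu>) A"
    by (simp add: translate_translate translate_0 image_image)
qed

lemma semivariation_translate_UNIV:
  "semivariation E (translate_measure x \<mu>) UNIV = semivariation E \<mu> UNIV"
proof -
  have "(\<lambda>a. a + x) ` UNIV = UNIV" by (metis surj_plus_right)
  then show ?thesis by (simp add: semivariation_translate)
qed

lemma csv_measure_translate:
  assumes "csv_measure \<mu>"
  shows "csv_measure (translate_measure x \<mu>)"
proof -
  interpret csv_measure \<mu> by fact
  show ?thesis
  proof
    show "translate_measure x \<mu> \<in> CA UNIV" using CA by (rule translate_measure_in_CA)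
    show "semivariation UNIV (translate_measure x \<mu>) UNIV < \<infinity>"
      using finite_semivariation by (simp add: semivariation_translate_UNIV)
    show "continuous_semivariation (translate_measure x \<mu>)"
      unfolding continuous_semivariation_def semivariation_translate
    proof (intro allI impI)
      fix A :: "nat \<Rightarrow> 'a set" assume A: "range A \<subseteq> sets borel" "decseq A" "(\<Inter>n. A n) = {}"
      have "range (\<lambda>n. (\<lambda>a. a + x) ` A n) \<subseteq> sets borel" using A(1) by (auto intro!: borel_translate)
      moreover have "decseq (\<lambda>n. (\<lambda>a. a + x) ` A n)" using A(2) by (auto simp: decseq_def)
      moreover have "(\<Inter>n. (\<lambda>a. a + x) ` A n) = {}"
        using A(3) image_INT[of "\<lambda>a. a + x" UNIV UNIV A] by (simp add: inj_translate)
      ultimately show "(\<lambda>n. semivariation UNIV \<mu> ((\<lambda>a. a + x) ` A n)) \<longlonglongrightarrow> 0"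
        using continuous unfolding continuous_semivariation_def by blast
    qed
  qed
qed

lemma product_measure_translate:
  fixes \<mu> :: "'a::euclidean_space set \<Rightarrow> 'v::banach \<Rightarrow>\<^sub>L 'w::banach"
  assumes E: "operator_space E" and \<mu>: "csv_measure \<mu>" and \<psi>: "\<psi> \<in> Cb E"
  shows "translate_measure x (product_measure E \<mu> \<psi>) =
    product_measure E (translate_measure x \<mu>) (\<lambda>a. \<psi> (a + x))"
proof
  fix A :: "'a set"
  show "translate_measure x (product_measure E \<mu> \<psi>) A =
    product_measure E (translate_measure x \<mu>) (\<lambda>a. \<psi> (a + x)) A"
  proof (cases "A \<in> sets borel")
    case True
    obtain s where s: "bounded_simple_approx E \<psi> s" using \<psi> by (rule Cb_approx)
    have surj: "range (\<lambda>a. f (a + x)) = range f" for f :: "'a \<Rightarrow> 'v \<Rightarrow>\<^sub>L 'v"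
      by (metis (no_types) image_image surj_plus_right)
    have "bounded_simple_approx E (\<lambda>a. \<psi> (a + x)) (\<lambda>n a. s n (a + x))"
      unfolding bounded_simple_approx_def
    proof (intro conjI allI)
      fix n
      show "simple_function borel (\<lambda>a. s n (a + x))"
        using simple_function_comp[of "\<lambda>a. a + x" borel borel "s n"] bounded_simple_approx_simple[OF s, of n]
        by (simp add: comp_def borel_measurable_continuous_onI continuous_intros)
      show "range (\<lambda>a. s n (a + x)) \<subseteq> E" using s by (auto simp: bounded_simple_approx_def)
    next
      obtain K where "\<And>n x. norm (s n x) \<le> K" using s by (auto simp: bounded_simple_approx_def)
      then show "\<exists>K. \<forall>n a. norm (s n (a + x)) \<le> K" by blast
    qed (use s in \<open>auto simp: bounded_simple_approx_def\<close>)
    from product_measure_limit[OF E csv_measure_translate[OF \<mu>] this True, of x]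
    have "(\<lambda>n. op_integral (translate_measure x \<mu>) A (\<lambda>a. s n (a + x))) \<longlonglongrightarrow>
        product_measure E (translate_measure x \<mu>) (\<lambda>a. \<psi> (a + x)) A" .
    moreover have "op_integral (translate_measure x \<mu>) A (\<lambda>a. s n (a + x)) =
        op_integral \<mu> ((\<lambda>a. a + x) ` A) (s n)" for n
    proof -
      have "(\<lambda>a. a + x) ` (A \<inter> (\<lambda>a. s n (a + x)) -` {F}) = (\<lambda>a. a + x) ` A \<inter> s n -` {F}" for F
        by auto
      then show ?thesis by (simp add: simple_integral_def surj translate_measure_def)
    qed
    ultimately have "(\<lambda>n. op_integral \<mu> ((\<lambda>a. a + x) ` A) (s n)) \<longlonglongrightarrow>
        product_measure E (translate_measure x \<mu>) (\<lambda>a. \<psi> (a + x)) A" by simp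
    then show ?thesis
      using product_measure_limit[OF E \<mu> s borel_translate[OF True, of x]] LIMSEQ_unique
      by (auto simp: translate_measure_def)
  qed (simp add: translate_measure_def product_measure_def borel_translate_iff)
qed

section \<open>Products and translations in the space of measures\<close>

lemma measure_of_sv_CA: "measure_of_sv \<nu> \<in> CA UNIV"
  and measure_of_sv_finite: "semivariation UNIV (measure_of_sv \<nu>) UNIV < \<infinity>"
  using measure_of_sv[of \<nu>] by auto

lemma sv_eqI: "measure_of_sv \<nu> = measure_of_sv \<nu>' \<Longrightarrow> \<nu> = \<nu>'"
  by (simp add: measure_of_sv_inject)

text \<open>
  Measures vanish off the Borel sets, so equality needs to be checked on Borel sets only.
\<close>

lemma measure_of_sv_eqI:
  assumes "\<And>A. A \<in> sets borel \<Longrightarrow> measure_of_sv \<nu> A = measure_of_sv \<nu>' A"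
  shows "\<nu> = \<nu>'"
proof (rule sv_eqI, rule ext)
  fix A show "measure_of_sv \<nu> A = measure_of_sv \<nu>' A"
    using assms[of A] CA_outside[OF measure_of_sv_CA, of A \<nu>] CA_outside[OF measure_of_sv_CA, of A \<nu>']
    by (cases "A \<in> sets borel") simp_all
qed

lemma measure_of_sv_add: "measure_of_sv (\<nu> + \<nu>') = (\<lambda>A. measure_of_sv \<nu> A + measure_of_sv \<nu>' A)"
  and measure_of_sv_scaleR: "measure_of_sv (r *\<^sub>R \<nu>) = (\<lambda>A. r *\<^sub>R measure_of_sv \<nu> A)"
  and measure_of_sv_zero: "measure_of_sv 0 = (\<lambda>A. 0)"
  by (simp_all add: plus_sv_measure.rep_eq scaleR_sv_measure.rep_eq zero_sv_measure.rep_eq)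

lemma measure_of_sv_sum: "measure_of_sv (\<Sum>i\<in>I. \<nu> i) A = (\<Sum>i\<in>I. measure_of_sv (\<nu> i) A)"
  by (induction I rule: infinite_finite_induct) (simp_all add: measure_of_sv_add measure_of_sv_zero)

lemma norm_sv: "norm \<nu> = sv_mass (measure_of_sv \<nu>) UNIV"
  by (simp add: norm_sv_measure.rep_eq sv_mass_def)

lemma semivariation_le_norm: "semivariation UNIV (measure_of_sv \<nu>) A \<le> ennreal (norm \<nu>)"
proof -
  have "semivariation UNIV (measure_of_sv \<nu>) A \<le> semivariation UNIV (measure_of_sv \<nu>) UNIV"
    by (rule semivariation_mono) simp
  also have "\<dots> = ennreal (norm \<nu>)"
    using measure_of_sv_finite[of \<nu>] by (simp add: norm_sv sv_mass_def less_top)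
  finally show ?thesis .
qed

text \<open>
  The measures of continuous semivariation, as a subspace of the normed space of measures of finite
  semivariation.
\<close>

definition csv_space :: "('a::topological_space, 'v::real_normed_vector, 'w::real_normed_vector) sv_measure set" where
  "csv_space = {\<nu>. continuous_semivariation (measure_of_sv \<nu>)}"

lemma csv_space_iff: "\<nu> \<in> csv_space \<longleftrightarrow> csv_measure (measure_of_sv \<nu>)"
  by (simp add: csv_space_def csv_measure_def measure_of_sv_CA measure_of_sv_finite[unfolded infinity_ennreal_def])

lemma csv_spaceD: "\<nu> \<in> csv_space \<Longrightarrow> csv_measure (measure_of_sv \<nu>)"
  by (simp add: csv_space_iff)

lemma csv_spaceI:
  assumes "\<And>A::nat \<Rightarrow> 'a::topological_space set. range A \<subseteq> sets borel \<Longrightarrow> decseq A \<Longrightarrow> (\<Inter>n. A n) = {} \<Longrightarrow>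
    (\<lambda>n. semivariation UNIV (measure_of_sv \<nu>) (A n)) \<longlonglongrightarrow> 0"
  shows "\<nu> \<in> csv_space"
  using assms unfolding csv_space_def continuous_semivariation_def by blast

lemma csv_spaceE:
  assumes "\<nu> \<in> csv_space" "range A \<subseteq> sets borel" "decseq A" "(\<Inter>n. A n) = {}"
  shows "(\<lambda>n. semivariation UNIV (measure_of_sv \<nu>) (A n)) \<longlonglongrightarrow> 0"
  using assms unfolding csv_space_def continuous_semivariation_def by blast

lemma tendsto_0_ennreal_sandwich:
  fixes f g :: "nat \<Rightarrow> ennreal"
  assumes "g \<longlonglongrightarrow> 0" "\<And>n. f n \<le> g n"
  shows "f \<longlonglongrightarrow> 0"
  by (rule tendsto_sandwich[OF _ _ tendsto_const assms(1)]) (simp_all add: assms(2))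

lemma subspace_csv_space: "subspace csv_space"
proof (rule subspaceI)
  show "0 \<in> csv_space"
    by (rule csv_spaceI) (simp add: measure_of_sv_zero semivariation_zero)
next
  fix \<nu> \<nu>' :: "('a, 'b, 'c) sv_measure" assume \<nu>: "\<nu> \<in> csv_space" "\<nu>' \<in> csv_space"
  show "\<nu> + \<nu>' \<in> csv_space"
  proof (rule csv_spaceI)
    fix A :: "nat \<Rightarrow> 'a set" assume A: "range A \<subseteq> sets borel" "decseq A" "(\<Inter>n. A n) = {}"
    have "(\<lambda>n. semivariation UNIV (measure_of_sv \<nu>) (A n) + semivariation UNIV (measure_of_sv \<nu>') (A n)) \<longlonglongrightarrow> 0 + 0"
      using A \<nu> by (intro tendsto_add csv_spaceE)
    then have "(\<lambda>n. semivariation UNIV (measure_of_sv \<nu>) (A n) + semivariation UNIV (measure_of_sv \<nu>') (A n)) \<longlonglongrightarrow> 0"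
      by simp
    then show "(\<lambda>n. semivariation UNIV (measure_of_sv (\<nu> + \<nu>')) (A n)) \<longlonglongrightarrow> 0"
      by (rule tendsto_0_ennreal_sandwich) (simp add: measure_of_sv_add semivariation_add)
  qed
next
  fix \<nu> :: "('a, 'b, 'c) sv_measure" and r :: real assume \<nu>: "\<nu> \<in> csv_space"
  show "r *\<^sub>R \<nu> \<in> csv_space"
  proof (rule csv_spaceI)
    fix A :: "nat \<Rightarrow> 'a set" assume A: "range A \<subseteq> sets borel" "decseq A" "(\<Inter>n. A n) = {}"
    have "(\<lambda>n. ennreal \<bar>r\<bar> * semivariation UNIV (measure_of_sv \<nu>) (A n)) \<longlonglongrightarrow> ennreal \<bar>r\<bar> * 0"
      by (rule ennreal_tendsto_cmult[OF _ csv_spaceE[OF \<nu> A]]) simp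
    then have "(\<lambda>n. ennreal \<bar>r\<bar> * semivariation UNIV (measure_of_sv \<nu>) (A n)) \<longlonglongrightarrow> 0" by simp
    then show "(\<lambda>n. semivariation UNIV (measure_of_sv (r *\<^sub>R \<nu>)) (A n)) \<longlonglongrightarrow> 0"
      by (rule tendsto_0_ennreal_sandwich) (simp add: measure_of_sv_scaleR semivariation_scaleR_le)
  qed
qed

lemma closed_csv_space: "closed csv_space"
proof -
  have "\<nu> \<in> csv_space" if \<nu>: "\<nu> \<in> closure csv_space" for \<nu> :: "('a::topological_space, 'b::real_normed_vector, 'c::real_normed_vector) sv_measure"
  proof (rule csv_spaceI)
    fix A :: "nat \<Rightarrow> 'a set" assume A: "range A \<subseteq> sets borel" "decseq A" "(\<Inter>n. A n) = {}"
    have "(\<lambda>n. sv_mass (measure_of_sv \<nu>) (A n)) \<longlonglongrightarrow> 0"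
    proof (rule LIMSEQ_I)
      fix e :: real assume e: "e > 0"
      then obtain \<nu>' where \<nu>': "\<nu>' \<in> csv_space" "dist \<nu>' \<nu> < e / 2"
        using \<nu> unfolding closure_approachable by (metis half_gt_zero)
      interpret csv_measure "measure_of_sv \<nu>'" using \<nu>'(1) by (rule csv_spaceD)
      have "(\<lambda>n. sv_mass (measure_of_sv \<nu>') (A n)) \<longlonglongrightarrow> 0" using A by (rule sv_mass_tendsto_0)
      then have "\<forall>\<^sub>F n in sequentially. sv_mass (measure_of_sv \<nu>') (A n) < e / 2"
        using e by (intro order_tendstoD) auto
      then obtain N where N: "\<And>n. n \<ge> N \<Longrightarrow> sv_mass (measure_of_sv \<nu>') (A n) < e / 2"
        by (auto simp: eventually_sequentially)
      have "norm (sv_mass (measure_of_sv \<nu>) (A n) - 0) < e" if "n \<ge> N" for n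
      proof -
        have "measure_of_sv \<nu> = (\<lambda>A. measure_of_sv (\<nu> - \<nu>') A + measure_of_sv \<nu>' A)"
          by (subst measure_of_sv_add[symmetric]) simp
        then have "semivariation UNIV (measure_of_sv \<nu>) (A n) \<le>
            semivariation UNIV (measure_of_sv (\<nu> - \<nu>')) (A n) + semivariation UNIV (measure_of_sv \<nu>') (A n)"
          by (metis semivariation_add)
        also have "\<dots> \<le> ennreal (norm (\<nu> - \<nu>')) + ennreal (sv_mass (measure_of_sv \<nu>') (A n))"
          by (intro add_mono semivariation_le_norm) (simp add: semivariation_eq)
        also have "\<dots> = ennreal (norm (\<nu> - \<nu>') + sv_mass (measure_of_sv \<nu>') (A n))" by simp
        finally have "sv_mass (measure_of_sv \<nu>) (A n) \<le> norm (\<nu> - \<nu>') + sv_mass (measure_of_sv \<nu>') (A n)"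
          unfolding sv_mass_def[of "measure_of_sv \<nu>"] by (intro enn2real_leI) simp_all
        then show ?thesis
          using \<nu>'(2) N[OF that] by (simp add: dist_norm norm_minus_commute sv_mass_def)
      qed
      then show "\<exists>N. \<forall>n\<ge>N. norm (sv_mass (measure_of_sv \<nu>) (A n) - 0) < e" by blast
    qed
    moreover have "semivariation UNIV (measure_of_sv \<nu>) (A n) = ennreal (sv_mass (measure_of_sv \<nu>) (A n))" for n
      using le_less_trans[OF semivariation_le_norm[of \<nu> "A n"]] by (simp add: sv_mass_def less_top)
    ultimately show "(\<lambda>n. semivariation UNIV (measure_of_sv \<nu>) (A n)) \<longlonglongrightarrow> 0"
      using tendsto_ennrealI by fastforce
  qed
  then show ?thesis by (meson closure_subset_eq subsetI)
qed

text \<open>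
  The translation \<open>\<nu> \<mapsto> \<nu>\<^sub>x\<close>, a linear isometry.
\<close>

definition sv_translate ::
  "'a \<Rightarrow> ('a::real_normed_vector, 'v::real_normed_vector, 'w::real_normed_vector) sv_measure \<Rightarrow> ('a, 'v, 'w) sv_measure" where
  "sv_translate x \<nu> = sv_of_measure (translate_measure x (measure_of_sv \<nu>))"

lemma measure_of_sv_translate: "measure_of_sv (sv_translate x \<nu>) = translate_measure x (measure_of_sv \<nu>)"
  unfolding sv_translate_def
  by (rule sv_of_measure_inverse)
    (simp add: translate_measure_in_CA measure_of_sv_CA semivariation_translate_UNIV
      measure_of_sv_finite[unfolded infinity_ennreal_def])

lemma sv_translate_add: "sv_translate x (\<nu> + \<nu>') = sv_translate x \<nu> + sv_translate x \<nu>'"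
  by (rule sv_eqI) (simp add: measure_of_sv_translate measure_of_sv_add translate_measure_def fun_eq_iff)

lemma sv_translate_scaleR: "sv_translate x (r *\<^sub>R \<nu>) = r *\<^sub>R sv_translate x \<nu>"
  by (rule sv_eqI) (simp add: measure_of_sv_translate measure_of_sv_scaleR translate_measure_def fun_eq_iff)

lemma norm_sv_translate: "norm (sv_translate x \<nu>) = norm \<nu>"
  by (simp add: norm_sv sv_mass_def measure_of_sv_translate semivariation_translate_UNIV)

lemma bounded_linear_sv_translate: "bounded_linear (sv_translate x)"
  by (rule bounded_linear_intro[of _ 1]) (simp_all add: sv_translate_add sv_translate_scaleR norm_sv_translate)

lemma sv_translate_in_csv_space: "\<nu> \<in> csv_space \<Longrightarrow> sv_translate x \<nu> \<in> csv_space"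
  by (simp add: csv_space_iff measure_of_sv_translate csv_measure_translate)

lemma sv_translate_sv_translate: "sv_translate x (sv_translate y \<nu>) = sv_translate (x + y) \<nu>"
  by (rule sv_eqI) (simp add: measure_of_sv_translate translate_translate)

lemma sv_translate_0: "sv_translate 0 \<nu> = \<nu>"
  by (rule sv_eqI) (simp add: measure_of_sv_translate translate_0)

text \<open>
  The product \<open>\<nu>\<psi>\<close> as an element of the normed space of measures. It is meaningful for \<open>\<nu>\<close> of
  continuous semivariation and bounded continuous \<open>\<psi>\<close>, see \<open>measure_of_sv_product\<close> below.
\<close>

definition sv_product ::
  "('v \<Rightarrow>\<^sub>L 'v) set \<Rightarrow> ('a::topological_space, 'v::real_normed_vector, 'w::real_normed_vector) sv_measure \<Rightarrow>
   ('a \<Rightarrow> 'v \<Rightarrow>\<^sub>L 'v) \<Rightarrow> ('a, 'v, 'w) sv_measure" where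
  "sv_product E \<nu> \<psi> = sv_of_measure (product_measure E (measure_of_sv \<nu>) \<psi>)"

context operator_space begin

lemma csv_product_sv: "\<nu> \<in> csv_space \<Longrightarrow> csv_product E (measure_of_sv \<nu>)"
  for \<nu> :: "('a::euclidean_space, 'v, 'w::banach) sv_measure"
  by (simp add: csv_product_def operator_space_axioms csv_space_iff)

lemma measure_of_sv_product:
  fixes \<nu> :: "('a::euclidean_space, 'v, 'w::banach) sv_measure"
  assumes \<nu>: "\<nu> \<in> csv_space" and \<psi>: "\<psi> \<in> Cb E"
  shows "measure_of_sv (sv_product E \<nu> \<psi>) = product_measure E (measure_of_sv \<nu>) \<psi>"
proof -
  interpret csv_product E "measure_of_sv \<nu>" using \<nu> by (rule csv_product_sv)
  show ?thesis
    unfolding sv_product_def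
    using product_measure_in_CA[OF \<psi>, of UNIV] finite_semivariation_product_measure[OF \<psi>]
    by (intro sv_of_measure_inverse) simp
qed

lemma sv_product_add_right:
  fixes \<nu> :: "('a::euclidean_space, 'v, 'w::banach) sv_measure"
  assumes \<nu>: "\<nu> \<in> csv_space" and \<psi>: "\<psi> \<in> Cb E" "\<psi>' \<in> Cb E"
  shows "sv_product E \<nu> (\<lambda>x. \<psi> x + \<psi>' x) = sv_product E \<nu> \<psi> + sv_product E \<nu> \<psi>'"
  by (rule measure_of_sv_eqI)
    (simp add: measure_of_sv_add measure_of_sv_product \<nu> \<psi> Cb_add[OF subspace]
      csv_product.product_measure_add_right[OF csv_product_sv[OF \<nu>]])

lemma sv_product_scaleR_right:
  fixes \<nu> :: "('a::euclidean_space, 'v, 'w::banach) sv_measure"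
  assumes \<nu>: "\<nu> \<in> csv_space" and \<psi>: "\<psi> \<in> Cb E"
  shows "sv_product E \<nu> (\<lambda>x. r *\<^sub>R \<psi> x) = r *\<^sub>R sv_product E \<nu> \<psi>"
  by (rule measure_of_sv_eqI)
    (simp add: measure_of_sv_scaleR measure_of_sv_product \<nu> \<psi> Cb_scaleR[OF subspace]
      csv_product.product_measure_scaleR_right[OF csv_product_sv[OF \<nu>]])

lemma sv_product_diff_right:
  fixes \<nu> :: "('a::euclidean_space, 'v, 'w::banach) sv_measure"
  assumes \<nu>: "\<nu> \<in> csv_space" and \<psi>: "\<psi> \<in> Cb E" "\<psi>' \<in> Cb E"
  shows "sv_product E \<nu> (\<lambda>x. \<psi> x - \<psi>' x) = sv_product E \<nu> \<psi> - sv_product E \<nu> \<psi>'"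
  using sv_product_add_right[OF \<nu> \<psi>(1) Cb_scaleR[OF subspace \<psi>(2), of "-1"]]
    sv_product_scaleR_right[OF \<nu> \<psi>(2), of "-1"] by simp

lemma sv_product_add_left:
  fixes \<nu> \<nu>' :: "('a::euclidean_space, 'v, 'w::banach) sv_measure"
  assumes \<nu>: "\<nu> \<in> csv_space" "\<nu>' \<in> csv_space" and \<psi>: "\<psi> \<in> Cb E"
  shows "sv_product E (\<nu> + \<nu>') \<psi> = sv_product E \<nu> \<psi> + sv_product E \<nu>' \<psi>"
proof (rule measure_of_sv_eqI)
  fix A :: "'a set" assume A: "A \<in> sets borel"
  have \<nu>\<nu>': "\<nu> + \<nu>' \<in> csv_space" using subspace_csv_space \<nu> by (rule subspace_add)
  show "measure_of_sv (sv_product E (\<nu> + \<nu>') \<psi>) A = measure_of_sv (sv_product E \<nu> \<psi> + sv_product E \<nu>' \<psi>) A"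
    using product_measure_add_left[OF operator_space_axioms csv_spaceD[OF \<nu>(1)] csv_spaceD[OF \<nu>(2)]
        csv_spaceD[OF \<nu>\<nu>', unfolded measure_of_sv_add] \<psi> A]
    by (simp add: measure_of_sv_product \<nu> \<nu>\<nu>' \<psi> measure_of_sv_add)
qed

lemma sv_product_scaleR_left:
  fixes \<nu> :: "('a::euclidean_space, 'v, 'w::banach) sv_measure"
  assumes \<nu>: "\<nu> \<in> csv_space" and \<psi>: "\<psi> \<in> Cb E"
  shows "sv_product E (r *\<^sub>R \<nu>) \<psi> = r *\<^sub>R sv_product E \<nu> \<psi>"
proof (rule measure_of_sv_eqI)
  fix A :: "'a set" assume A: "A \<in> sets borel"
  have \<nu>': "r *\<^sub>R \<nu> \<in> csv_space" using subspace_csv_space \<nu> by (rule subspace_scale)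
  show "measure_of_sv (sv_product E (r *\<^sub>R \<nu>) \<psi>) A = measure_of_sv (r *\<^sub>R sv_product E \<nu> \<psi>) A"
    using product_measure_scaleR_left[OF operator_space_axioms csv_spaceD[OF \<nu>]
        csv_spaceD[OF \<nu>', unfolded measure_of_sv_scaleR] \<psi> A]
    by (simp add: measure_of_sv_product \<nu> \<nu>' \<psi> measure_of_sv_scaleR)
qed

lemma sv_product_diff_left:
  fixes \<nu> \<nu>' :: "('a::euclidean_space, 'v, 'w::banach) sv_measure"
  assumes \<nu>: "\<nu> \<in> csv_space" "\<nu>' \<in> csv_space" and \<psi>: "\<psi> \<in> Cb E"
  shows "sv_product E (\<nu> - \<nu>') \<psi> = sv_product E \<nu> \<psi> - sv_product E \<nu>' \<psi>"
  using sv_product_add_left[OF \<nu>(1) subspace_scale[OF subspace_csv_space \<nu>(2), of "-1"] \<psi>]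
    sv_product_scaleR_left[OF \<nu>(2) \<psi>, of "-1"] by simp

text \<open>
  The bound \<open>c\<close> holds off \<open>A\<close>; on \<open>A\<close> only the cruder bound \<open>C\<close> is available, which is harmless if \<open>A\<close>
  has small semivariation.
\<close>

lemma norm_sv_product_local:
  fixes \<nu> :: "('a::euclidean_space, 'v, 'w::banach) sv_measure"
  assumes \<nu>: "\<nu> \<in> csv_space" and \<psi>: "\<psi> \<in> Cb E" and A: "A \<in> sets borel"
    and c: "\<And>x. x \<notin> A \<Longrightarrow> norm (\<psi> x) \<le> c" "0 \<le> c" and C: "\<And>x. norm (\<psi> x) \<le> C"
  shows "norm (sv_product E \<nu> \<psi>) \<le> c * norm \<nu> + C * sv_mass (measure_of_sv \<nu>) A"
proof -
  interpret csv_product E "measure_of_sv \<nu>" using \<nu> by (rule csv_product_sv)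
  have C0: "0 \<le> C" using C[of undefined] norm_ge_zero order_trans by blast
  let ?p = "product_measure E (measure_of_sv \<nu>) \<psi>"
  have "semivariation UNIV ?p UNIV \<le> semivariation UNIV ?p (UNIV \<inter> A) + semivariation UNIV ?p (UNIV - A)"
    by (rule semivariation_split[OF additive_product_measure[OF \<psi>] A])
  also have "\<dots> \<le> ennreal (C * sv_mass (measure_of_sv \<nu>) (UNIV \<inter> A)) + ennreal (c * sv_mass (measure_of_sv \<nu>) (UNIV - A))"
    using A C C0 c by (intro add_mono semivariation_product_measure_le[OF \<psi>]) auto
  also have "\<dots> = ennreal (C * sv_mass (measure_of_sv \<nu>) A + c * sv_mass (measure_of_sv \<nu>) (UNIV - A))"
    using C0 c by simp
  finally have "norm (sv_product E \<nu> \<psi>) \<le> C * sv_mass (measure_of_sv \<nu>) A + c * sv_mass (measure_of_sv \<nu>) (UNIV - A)"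
    unfolding norm_sv measure_of_sv_product[OF \<nu> \<psi>] sv_mass_def[of ?p]
    using C0 c by (intro enn2real_leI) auto
  moreover have "c * sv_mass (measure_of_sv \<nu>) (UNIV - A) \<le> c * norm \<nu>"
    unfolding norm_sv using c by (intro mult_left_mono sv_mass_mono) auto
  ultimately show ?thesis by linarith
qed

lemma norm_sv_product_le:
  fixes \<nu> :: "('a::euclidean_space, 'v, 'w::banach) sv_measure"
  assumes \<nu>: "\<nu> \<in> csv_space" and \<psi>: "\<psi> \<in> Cb E" and c: "\<And>x. norm (\<psi> x) \<le> c"
  shows "norm (sv_product E \<nu> \<psi>) \<le> c * norm \<nu>"
proof -
  have "0 \<le> c" using c[of undefined] norm_ge_zero order_trans by blast
  moreover have "sv_mass (measure_of_sv \<nu>) {} = 0"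
  proof -
    have "semivariation UNIV (measure_of_sv \<nu>) {} \<le> 0"
      by (rule semivariation_least) (auto simp: CA_empty[OF measure_of_sv_CA])
    then show ?thesis by (simp add: sv_mass_def)
  qed
  ultimately show ?thesis
    using norm_sv_product_local[OF \<nu> \<psi>, of "{}" c c] c by simp
qed

text \<open>
  The bounded convergence theorem, with convergence in the semivariation norm.
\<close>

lemma sv_product_bounded_convergence:
  fixes \<nu> :: "('a::euclidean_space, 'v, 'w::banach) sv_measure"
  assumes \<nu>: "\<nu> \<in> csv_space" and \<psi>: "\<And>n::nat. \<psi> n \<in> Cb E" and C: "\<And>n x. norm (\<psi> n x) \<le> C"
    and lim: "\<And>x. (\<lambda>n. \<psi> n x) \<longlonglongrightarrow> 0"
  shows "(\<lambda>n. sv_product E \<nu> (\<psi> n)) \<longlonglongrightarrow> 0"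
proof (rule LIMSEQ_I)
  fix e :: real assume e: "e > 0"
  interpret csv_product E "measure_of_sv \<nu>" using \<nu> by (rule csv_product_sv)
  define c where "c = e / 3 / (norm \<nu> + 1)"
  have pos: "norm \<nu> + 1 > 0" using norm_ge_zero[of \<nu>] by linarith
  have c: "c > 0" "c * norm \<nu> \<le> e / 3"
    using e pos by (auto simp: c_def divide_simps mult_left_mono)
  define N where "N j = (\<Union>n\<in>{j..}. {x. norm (\<psi> n x) > c})" for j
  have N: "N j \<in> sets borel" for j
  proof -
    have "open {x. norm (\<psi> n x) > c}" for n
      using \<psi>[of n] by (intro open_Collect_less continuous_intros) (auto simp: Cb_def)
    then have "open (N j)" unfolding N_def by blast
    then show ?thesis by (rule borel_open)
  qed
  have "(\<lambda>j. sv_mass (measure_of_sv \<nu>) (N j)) \<longlonglongrightarrow> 0"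
  proof (rule sv_mass_tendsto_0)
    show "range N \<subseteq> sets borel" using N by auto
    show "decseq N" unfolding decseq_def N_def by fastforce
    have "\<exists>j. x \<notin> N j" for x
    proof -
      have "\<forall>\<^sub>F n in sequentially. norm (\<psi> n x) < c"
        using lim[of x] c(1) by (auto simp: tendsto_iff dist_norm)
      then show ?thesis by (force simp: N_def eventually_sequentially)
    qed
    then show "(\<Inter>j. N j) = {}" by blast
  qed
  then have "(\<lambda>j. C * sv_mass (measure_of_sv \<nu>) (N j)) \<longlonglongrightarrow> 0" by (rule tendsto_mult_right_zero)
  then have "\<forall>\<^sub>F j in sequentially. C * sv_mass (measure_of_sv \<nu>) (N j) < e / 3"
    using e by (intro order_tendstoD) auto
  then obtain j where j: "C * sv_mass (measure_of_sv \<nu>) (N j) < e / 3" by (auto simp: eventually_sequentially)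
  have "norm (sv_product E \<nu> (\<psi> n) - 0) < e" if "n \<ge> j" for n
  proof -
    have "norm (sv_product E \<nu> (\<psi> n)) \<le> c * norm \<nu> + C * sv_mass (measure_of_sv \<nu>) (N j)"
    proof (rule norm_sv_product_local[OF \<nu> \<psi> N])
      show "norm (\<psi> n x) \<le> c" if "x \<notin> N j" for x using that \<open>n \<ge> j\<close> by (force simp: N_def)
    qed (use c C in auto)
    then show ?thesis using c j e by simp
  qed
  then show "\<exists>j. \<forall>n\<ge>j. norm (sv_product E \<nu> (\<psi> n) - 0) < e" by blast
qed

lemma sv_translate_product:
  fixes \<nu> :: "('a::euclidean_space, 'v, 'w::banach) sv_measure"
  assumes \<nu>: "\<nu> \<in> csv_space" and \<psi>: "\<psi> \<in> Cb E"
  shows "sv_translate x (sv_product E \<nu> \<psi>) = sv_product E (sv_translate x \<nu>) (\<lambda>a. \<psi> (a + x))"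
  by (rule sv_eqI)
    (simp add: measure_of_sv_translate measure_of_sv_product \<nu> \<psi> sv_translate_in_csv_space Cb_translate
      product_measure_translate[OF operator_space_axioms csv_spaceD[OF \<nu>] \<psi>])

end

section \<open>Iterated Frechet derivatives\<close>

lemma norm_diff_le_add: "norm a \<le> r \<Longrightarrow> norm b \<le> s \<Longrightarrow> norm (a - b) \<le> r + s"
  for a b :: "'a::real_normed_vector"
  by (rule norm_triangle_le_diff) (rule add_mono)

lemma bounded_multilinear_linear:
  assumes "bounded_multilinear j T" "length hs = j" "i < j"
  shows "linear (\<lambda>h. T (hs[i := h]))"
  using assms unfolding bounded_multilinear_def by metis

lemma multilinear_scale_tail:
  assumes T: "bounded_multilinear j T" and len: "length a + length hs = j"
  shows "T (a @ map ((*\<^sub>R) c) hs) = c ^ length hs *\<^sub>R T (a @ hs)"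
  using len
proof (induction hs arbitrary: a)
  case (Cons h hs)
  have "linear (\<lambda>h'. T ((a @ h # hs)[length a := h']))"
    using Cons.prems by (intro bounded_multilinear_linear[OF T]) auto
  then have lin: "linear (\<lambda>h'. T (a @ h' # hs))" by simp
  have "T (a @ map ((*\<^sub>R) c) (h # hs)) = T ((a @ [c *\<^sub>R h]) @ map ((*\<^sub>R) c) hs)" by simp
  also have "\<dots> = c ^ length hs *\<^sub>R T ((a @ [c *\<^sub>R h]) @ hs)"
    using Cons.prems by (intro Cons.IH) simp
  also have "T ((a @ [c *\<^sub>R h]) @ hs) = c *\<^sub>R T (a @ h # hs)"
    using linear_scale[OF lin, of c h] by simp
  finally show ?case by simp
qed simp

lemma multilinear_first:
  assumes "bounded_multilinear (Suc j) T" "length hs = j"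
  shows "linear (\<lambda>h. T (h # hs))"
  using bounded_multilinear_linear[OF assms(1), of "0 # hs" 0] assms(2) by simp

text \<open>
  By homogeneity, statements that are uniform on \<open>unit_tuples\<close> extend to arbitrary tuples.
\<close>

lemma scale_to_unit_tuple:
  obtains c :: real where "c > 0" "map ((*\<^sub>R) (inverse c)) hs \<in> unit_tuples (length hs)"
proof
  define c where "c = 1 + (\<Sum>h\<leftarrow>hs. norm h)"
  have le: "norm h \<le> (\<Sum>h\<leftarrow>hs. norm h)" if "h \<in> set hs" for h
    using that by (intro member_le_sum_list) auto
  have "0 \<le> (\<Sum>h\<leftarrow>hs. norm h)" by (intro sum_list_nonneg) auto
  then show c: "c > 0" by (simp add: c_def)
  show "map ((*\<^sub>R) (inverse c)) hs \<in> unit_tuples (length hs)"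
  proof -
    have "norm (inverse c *\<^sub>R h) \<le> 1" if "h \<in> set hs" for h
      using le[OF that] c by (simp add: c_def divide_simps)
    then show ?thesis by (auto simp: unit_tuples_def)
  qed
qed

lemma norm_multilinear_first_le:
  assumes T: "bounded_multilinear (Suc j) T" and hs: "hs \<in> unit_tuples j"
    and C: "\<And>hs. hs \<in> unit_tuples (Suc j) \<Longrightarrow> norm (T hs) \<le> C"
  shows "norm (T (w # hs)) \<le> C * norm w"
proof (cases "w = 0")
  case True
  have "linear (\<lambda>h. T (h # hs))" using T hs by (intro multilinear_first) (auto simp: unit_tuples_def)
  from linear_0[OF this] show ?thesis using True by simp
next
  case False
  have lin: "linear (\<lambda>h. T (h # hs))" using T hs by (intro multilinear_first) (auto simp: unit_tuples_def)
  have "norm (T ((w /\<^sub>R norm w) # hs)) \<le> C"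
    using hs False by (intro C) (auto simp: unit_tuples_def)
  then show ?thesis
    using False linear_scale[OF lin, of "inverse (norm w)" w] by (simp add: field_simps)
qed

lemma has_derivative_directional_limit:
  assumes "(g has_derivative g') (at x)"
  shows "((\<lambda>t. (g (x + t *\<^sub>R h) - g x) /\<^sub>R t) \<longlongrightarrow> g' h) (at (0::real))"
proof -
  have "((\<lambda>t::real. x + t *\<^sub>R h) has_derivative (\<lambda>t. t *\<^sub>R h)) (at 0)"
    by (auto intro!: derivative_eq_intros)
  moreover have "(g has_derivative g') (at (x + 0 *\<^sub>R h))" using assms by simp
  ultimately have "((\<lambda>t. g (x + t *\<^sub>R h)) has_derivative (\<lambda>t. g' (t *\<^sub>R h))) (at 0)"
    by (rule has_derivative_compose)
  then have "((\<lambda>t. norm (g (x + t *\<^sub>R h) - g x - g' (t *\<^sub>R h)) / norm t) \<longlongrightarrow> 0) (at 0)"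
    by (simp add: has_derivative_iff_norm)
  moreover have "norm (g (x + t *\<^sub>R h) - g x - g' (t *\<^sub>R h)) / norm t =
      norm ((g (x + t *\<^sub>R h) - g x) /\<^sub>R t - g' h)" if "t \<noteq> 0" for t
  proof -
    have "(g (x + t *\<^sub>R h) - g x) /\<^sub>R t - g' h = (g (x + t *\<^sub>R h) - g x - g' (t *\<^sub>R h)) /\<^sub>R t"
      using that linear_scale[OF has_derivative_linear[OF assms], of t h] by (simp add: scaleR_diff_right)
    then show ?thesis by (simp add: divide_inverse mult.commute)
  qed
  ultimately have "((\<lambda>t. norm ((g (x + t *\<^sub>R h) - g x) /\<^sub>R t - g' h)) \<longlongrightarrow> 0) (at 0)"
    by (subst (asm) tendsto_cong[where g="\<lambda>t. norm ((g (x + t *\<^sub>R h) - g x) /\<^sub>R t - g' h)"])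
      (auto simp: eventually_at_filter)
  then show ?thesis by (simp add: tendsto_norm_zero_iff LIM_zero_iff)
qed

text \<open>
  The second difference of \<open>f\<close> approximates the second derivative up to \<open>o(s\<^sup>2)\<close>. Besides \<open>f\<close>
  itself only \<open>y \<mapsto> Df y v\<close> has to be differentiable, and this only at \<open>x\<close>. The mean value inequality is applied to the increment
  of \<open>f\<close> in the direction \<open>u\<close> along the segment in the direction \<open>v\<close>.
\<close>

lemma second_difference_bound:
  fixes f :: "'a::real_normed_vector \<Rightarrow> 'b::real_normed_vector"
  assumes f: "\<And>y. (f has_derivative Df y) (at y)"
    and S: "((\<lambda>y. Df y v) has_derivative S) (at x)" and e: "e > 0"
  shows "\<exists>d>0. \<forall>s. 0 < s \<and> s < d \<longrightarrow>
    norm (f (x + s *\<^sub>R u + s *\<^sub>R v) - f (x + s *\<^sub>R u) - f (x + s *\<^sub>R v) + f x - s\<^sup>2 *\<^sub>R S u) \<le> e * s\<^sup>2"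
proof -
  define c where "c = norm u + 2 * norm v + 1"
  have c: "c > 0" unfolding c_def using norm_ge_zero[of u] norm_ge_zero[of v] by linarith
  have linS: "linear S" using S by (rule has_derivative_linear)
  obtain d where d: "d > 0" "\<And>y. norm (y - x) < d \<Longrightarrow>
      norm (Df y v - Df x v - S (y - x)) \<le> e / c * norm (y - x)"
    using S e c unfolding has_derivative_at_alt by (metis divide_pos_pos)
  have "norm (f (x + s *\<^sub>R u + s *\<^sub>R v) - f (x + s *\<^sub>R u) - f (x + s *\<^sub>R v) + f x - s\<^sup>2 *\<^sub>R S u) \<le> e * s\<^sup>2"
    if s: "0 < s" "s < d / c" for s
  proof -
    define g where "g t = f (x + s *\<^sub>R u + t *\<^sub>R v) - f (x + t *\<^sub>R v) - t *\<^sub>R s *\<^sub>R S u" for t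
    define g' where "g' t = Df (x + s *\<^sub>R u + t *\<^sub>R v) v - Df (x + t *\<^sub>R v) v - s *\<^sub>R S u" for t
    have deriv: "(g has_derivative (\<lambda>r. r *\<^sub>R g' t)) (at t within {0..s})" for t
    proof -
      have "((\<lambda>t. f (y + t *\<^sub>R v)) has_derivative (\<lambda>r. Df (y + t *\<^sub>R v) (r *\<^sub>R v))) (at t within {0..s})" for y
        by (rule has_derivative_compose[OF _ f]) (auto intro!: derivative_eq_intros)
      moreover have "Df y (r *\<^sub>R v) = r *\<^sub>R Df y v" for y r
        using f[of y] by (intro linear_scale has_derivative_linear)
      ultimately have "((\<lambda>t. f (y + t *\<^sub>R v)) has_derivative (\<lambda>r. r *\<^sub>R Df (y + t *\<^sub>R v) v)) (at t within {0..s})" for y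
        by simp
      then have "(g has_derivative (\<lambda>r. r *\<^sub>R Df (x + s *\<^sub>R u + t *\<^sub>R v) v - r *\<^sub>R Df (x + t *\<^sub>R v) v - r *\<^sub>R s *\<^sub>R S u))
          (at t within {0..s})"
        unfolding g_def by (intro has_derivative_diff has_derivative_scaleR_left has_derivative_ident)
      then show ?thesis unfolding g'_def by (simp only: scaleR_diff_right)
    qed
    have bound: "norm (g' t) \<le> e * s" if t: "t \<in> {0..s}" for t
    proof -
      have cs: "c * s < d" using s c by (simp add: field_simps)
      have tv: "norm (t *\<^sub>R v) \<le> s * norm v" using t by (auto intro!: mult_right_mono)
      have n1: "norm (s *\<^sub>R u + t *\<^sub>R v) \<le> s * norm u + s * norm v"
        using norm_triangle_ineq[of "s *\<^sub>R u" "t *\<^sub>R v"] tv s by simp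
      have csum: "c * s = s * norm u + s * norm v + s * norm v + s" by (simp add: c_def algebra_simps)
      have nonneg: "0 \<le> s * norm u" "0 \<le> s * norm v" using s by auto
      have "norm (Df (x + (s *\<^sub>R u + t *\<^sub>R v)) v - Df x v - S (s *\<^sub>R u + t *\<^sub>R v)) \<le> e / c * norm (s *\<^sub>R u + t *\<^sub>R v)"
      proof -
        have "norm (s *\<^sub>R u + t *\<^sub>R v) < d" using n1 cs csum nonneg s by linarith
        then show ?thesis using d(2)[of "x + (s *\<^sub>R u + t *\<^sub>R v)"] by simp
      qed
      moreover have "norm (Df (x + t *\<^sub>R v) v - Df x v - S (t *\<^sub>R v)) \<le> e / c * norm (t *\<^sub>R v)"
      proof -
        have "norm (t *\<^sub>R v) < d" using tv cs csum nonneg s by linarith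
        then show ?thesis using d(2)[of "x + t *\<^sub>R v"] by simp
      qed
      moreover have "g' t = (Df (x + (s *\<^sub>R u + t *\<^sub>R v)) v - Df x v - S (s *\<^sub>R u + t *\<^sub>R v)) -
          (Df (x + t *\<^sub>R v) v - Df x v - S (t *\<^sub>R v))"
        by (simp add: g'_def linear_add[OF linS] linear_scale[OF linS] add.assoc)
      ultimately have "norm (g' t) \<le> e / c * norm (s *\<^sub>R u + t *\<^sub>R v) + e / c * norm (t *\<^sub>R v)"
        by (simp only: norm_diff_le_add)
      also have "\<dots> = e / c * (norm (s *\<^sub>R u + t *\<^sub>R v) + norm (t *\<^sub>R v))" by (simp add: algebra_simps)
      also have "\<dots> \<le> e / c * (c * s)"
        using n1 tv csum nonneg s e c by (intro mult_left_mono) auto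
      finally show ?thesis using c by simp
    qed
    have "norm (g s - g 0) \<le> e * s * norm (s - 0)"
    proof (rule differentiable_bound[OF _ deriv])
      show "onorm (\<lambda>r. r *\<^sub>R g' t) \<le> e * s" if "t \<in> {0..s}" for t
        using bound[OF that] by (intro onorm_le) (simp add: mult.commute mult_left_mono)
    qed (use s in auto)
    moreover have "g s - g 0 = f (x + s *\<^sub>R u + s *\<^sub>R v) - f (x + s *\<^sub>R u) - f (x + s *\<^sub>R v) + f x - s\<^sup>2 *\<^sub>R S u"
      by (simp add: g_def power2_eq_square)
    ultimately show ?thesis using s by (simp add: power2_eq_square)
  qed
  moreover have "d / c > 0" using d c by simp
  ultimately show ?thesis by blast
qed

text \<open>
  Schwarz's theorem: the second difference is symmetric in \<open>u\<close> and \<open>v\<close>.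
\<close>

lemma second_derivative_symmetric:
  fixes f :: "'a::real_normed_vector \<Rightarrow> 'b::real_normed_vector"
  assumes f: "\<And>y. (f has_derivative Df y) (at y)"
    and S: "((\<lambda>y. Df y v) has_derivative S) (at x)"
    and S': "((\<lambda>y. Df y u) has_derivative S') (at x)"
  shows "S u = S' v"
proof (rule ccontr)
  assume "S u \<noteq> S' v"
  define e where "e = norm (S u - S' v) / 3"
  have e: "e > 0" using \<open>S u \<noteq> S' v\<close> by (simp add: e_def)
  obtain d where d: "d > 0" "\<And>s. 0 < s \<and> s < d \<Longrightarrow>
    norm (f (x + s *\<^sub>R u + s *\<^sub>R v) - f (x + s *\<^sub>R u) - f (x + s *\<^sub>R v) + f x - s\<^sup>2 *\<^sub>R S u) \<le> e * s\<^sup>2"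
    using second_difference_bound[OF f S e, of u] by blast
  obtain d' where d': "d' > 0" "\<And>s. 0 < s \<and> s < d' \<Longrightarrow>
    norm (f (x + s *\<^sub>R v + s *\<^sub>R u) - f (x + s *\<^sub>R v) - f (x + s *\<^sub>R u) + f x - s\<^sup>2 *\<^sub>R S' v) \<le> e * s\<^sup>2"
    using second_difference_bound[OF f S' e, of v] by blast
  define s where "s = min d d' / 2"
  have s: "s > 0" "s < d" "s < d'" using d(1) d'(1) by (auto simp: s_def)
  define q where "q = f (x + s *\<^sub>R u + s *\<^sub>R v) - f (x + s *\<^sub>R u) - f (x + s *\<^sub>R v) + f x"
  have "norm (q - s\<^sup>2 *\<^sub>R S u) \<le> e * s\<^sup>2" using d(2)[of s] s by (simp add: q_def)
  moreover have "norm (q - s\<^sup>2 *\<^sub>R S' v) \<le> e * s\<^sup>2"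
    using d'(2)[of s] s by (simp add: q_def algebra_simps)
  ultimately have "norm ((q - s\<^sup>2 *\<^sub>R S' v) - (q - s\<^sup>2 *\<^sub>R S u)) \<le> e * s\<^sup>2 + e * s\<^sup>2"
    by (simp only: norm_diff_le_add)
  then have "norm (s\<^sup>2 *\<^sub>R (S u - S' v)) \<le> s\<^sup>2 * (2 * e)" by (simp add: algebra_simps)
  then have "norm (S u - S' v) \<le> 2 * e" using s by simp
  then show False using e by (simp add: e_def)
qed

text \<open>
  A function together with its Frechet derivatives \<open>D j\<close> of order \<open>j \<le> k\<close>. The newest direction is the
  head of the list, so \<open>D (length hs) x hs\<close> is the iterated directional derivative \<open>foldr\<close> over \<open>hs\<close>.
\<close>

locale frechet_family =
  fixes k :: nat and f :: "'a::euclidean_space \<Rightarrow> 'b::real_normed_vector"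
    and D :: "nat \<Rightarrow> 'a \<Rightarrow> 'a list \<Rightarrow> 'b"
  assumes frechet: "frechet_derivatives k f D"
begin

lemma D_0: "D 0 x [] = f x"
  using frechet by (simp add: frechet_derivatives_def)

lemma multilinear: "j \<le> k \<Longrightarrow> bounded_multilinear j (D j x)"
  using frechet by (simp add: frechet_derivatives_def)

lemma uniform_derivative: "j < k \<Longrightarrow> uniform_limit (unit_tuples j)
    (\<lambda>y hs. (D j y hs - D j x hs - D (Suc j) x ((y - x) # hs)) /\<^sub>R norm (y - x)) (\<lambda>hs. 0) (at x)"
  using frechet by (simp add: frechet_derivatives_def)

lemma linear_first: "length hs < k \<Longrightarrow> linear (\<lambda>w. D (Suc (length hs)) x (w # hs))"
  by (intro multilinear_first[where j="length hs"] multilinear) auto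

lemma scale: "length hs \<le> k \<Longrightarrow> D (length hs) x (map ((*\<^sub>R) c) hs) = c ^ length hs *\<^sub>R D (length hs) x hs"
  using multilinear_scale_tail[OF multilinear, of "length hs" "[]" hs] by simp

lemma scale_tail:
  "length hs < k \<Longrightarrow> D (Suc (length hs)) x (w # map ((*\<^sub>R) c) hs) = c ^ length hs *\<^sub>R D (Suc (length hs)) x (w # hs)"
  using multilinear_scale_tail[OF multilinear, of "Suc (length hs)" "[w]" hs] by simp

lemma has_derivative_D:
  assumes "length hs < k"
  shows "((\<lambda>y. D (length hs) y hs) has_derivative (\<lambda>w. D (Suc (length hs)) x (w # hs))) (at x)"
proof -
  let ?j = "length hs"
  obtain c :: real where c: "c > 0" "map ((*\<^sub>R) (inverse c)) hs \<in> unit_tuples ?j"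
    using scale_to_unit_tuple[of hs] by metis
  define us where "us = map ((*\<^sub>R) (inverse c)) hs"
  have us: "length us = ?j" "hs = map ((*\<^sub>R) c) us"
    using c(1) by (simp_all add: us_def comp_def)
  have "((\<lambda>y. (D ?j y us - D ?j x us - D (Suc ?j) x ((y - x) # us)) /\<^sub>R norm (y - x)) \<longlongrightarrow> 0) (at x)"
    using tendsto_uniform_limitI[OF uniform_derivative[OF assms] c(2)] by (simp add: us_def)
  moreover have "bounded_linear (\<lambda>w. D (Suc ?j) x (w # us))"
    using linear_first[of us x] assms us(1) by (simp add: linear_conv_bounded_linear)
  ultimately have "((\<lambda>y. D ?j y us) has_derivative (\<lambda>w. D (Suc ?j) x (w # us))) (at x)"
    by (simp add: has_derivative_within inverse_eq_divide diff_diff_eq)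
  then have "((\<lambda>y. c ^ ?j *\<^sub>R D ?j y us) has_derivative (\<lambda>w. c ^ ?j *\<^sub>R D (Suc ?j) x (w # us))) (at x)"
    by (rule has_derivative_scaleR_right)
  moreover have "D ?j y hs = c ^ ?j *\<^sub>R D ?j y us" for y
    using scale[of us y c] assms unfolding us(1) us(2)[symmetric] by simp
  moreover have "D (Suc ?j) x (w # hs) = c ^ ?j *\<^sub>R D (Suc ?j) x (w # us)" for w
    using scale_tail[of us x w c] assms unfolding us(1) us(2)[symmetric] by simp
  ultimately show ?thesis by (simp only:)
qed

lemma directional_limit:
  assumes "length hs < k"
  shows "((\<lambda>t. (D (length hs) (x + t *\<^sub>R h) hs - D (length hs) x hs) /\<^sub>R t) \<longlongrightarrow> D (Suc (length hs)) x (h # hs)) (at (0::real))"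
  using has_derivative_directional_limit[OF has_derivative_D[OF assms]] .

lemma directional_derivative_eq:
  assumes "length hs < k"
  shows "directional_derivative h (\<lambda>x. D (length hs) x hs) = (\<lambda>x. D (Suc (length hs)) x (h # hs))"
  unfolding directional_derivative_def
  by (rule ext, rule tendsto_Lim[OF _ directional_limit[OF assms]]) simp

lemma D_cong_tail:
  assumes len: "length hs' = length hs" "length hs < k"
    and eq: "\<And>x. D (length hs) x hs = D (length hs) x hs'"
  shows "D (Suc (length hs)) x (h # hs) = D (Suc (length hs)) x (h # hs')"
proof -
  have "((\<lambda>t. (D (length hs) (x + t *\<^sub>R h) hs - D (length hs) x hs) /\<^sub>R t) \<longlongrightarrow> D (Suc (length hs)) x (h # hs')) (at 0)"
    using directional_limit[of hs' x h] len by (simp add: eq)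
  from tendsto_unique[OF _ directional_limit[OF len(2)] this] show ?thesis by simp
qed

lemma D_swap:
  assumes "Suc (Suc (length hs)) \<le> k"
  shows "D (Suc (Suc (length hs))) x (u # v # hs) = D (Suc (Suc (length hs))) x (v # u # hs)"
  using second_derivative_symmetric[OF has_derivative_D, of hs v _ x u]
    has_derivative_D[of "v # hs" x] has_derivative_D[of "u # hs" x] assms by simp

text \<open>
  Adjacent directions may be exchanged by Schwarz's theorem; an equality of lower derivatives, as
  functions of the base point, may be differentiated once more.
\<close>

lemma D_permute:
  assumes "mset xs = mset ys" "length xs \<le> k"
  shows "D (length xs) x xs = D (length xs) x ys"
  using assms
proof (induction "length xs" arbitrary: xs ys x rule: less_induct)
  case less
  show ?case
  proof (cases xs)
    case Nil
    then show ?thesis using less.prems by simp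
  next
    case (Cons a xs')
    have len: "length ys = length xs" using less.prems(1) by (metis size_mset)
    then obtain b ys' where ys: "ys = b # ys'" using Cons by (cases ys) auto
    have len': "length ys' = length xs'" using len Cons ys by simp
    have step: "D (Suc (length us)) y (c # us) = D (Suc (length us)) y (c # vs)"
      if "mset us = mset vs" "length us = length xs'" for us vs c y
    proof (rule D_cong_tail)
      show "length vs = length us" using that(1) by (metis size_mset)
      show "length us < k" using that(2) Cons less.prems(2) by simp
      show "D (length us) x us = D (length us) x vs" for x
        using that Cons less.prems(2) by (intro less.hyps) auto
    qed
    show ?thesis
    proof (cases "a = b")
      case True
      then show ?thesis using step[of xs' ys' x a] less.prems(1) Cons ys by simp
    next
      case False
      then have "b \<in> set xs'" "a \<in> set ys'"
        using less.prems(1) Cons ys by (metis list.set_intros(1) set_ConsD set_mset_mset)+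
      define zs where "zs = remove1 b xs'"
      have xs': "mset xs' = mset (b # zs)" using \<open>b \<in> set xs'\<close> by (simp add: zs_def)
      have "add_mset a (mset xs') = add_mset b (mset ys')" using less.prems(1) Cons ys by simp
      then have ys': "mset (a # zs) = mset ys'" using xs' by simp
      have lenz: "length xs' = Suc (length zs)" using xs' by (metis length_Cons size_mset)
      have "D (length xs) x xs = D (length xs) x (a # b # zs)"
        using step[OF xs', of x a] Cons by simp
      also have "\<dots> = D (length xs) x (b # a # zs)"
        using D_swap[of zs x a b] less.prems(2) Cons lenz by simp
      also have "\<dots> = D (length xs) x (b # ys')"
        using step[OF ys', of x b] Cons lenz by simp
      finally show ?thesis using ys by simp
    qed
  qed
qed

lemma foldr_directional_derivative:
  "length hs \<le> k \<Longrightarrow> foldr directional_derivative hs f = (\<lambda>x. D (length hs) x hs)"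
  by (induction hs) (simp_all add: D_0 directional_derivative_eq)

lemma norm_D_diff_le:
  assumes j: "j < k" and C: "\<And>z hs. hs \<in> unit_tuples (Suc j) \<Longrightarrow> norm (D (Suc j) z hs) \<le> C"
    and hs: "hs \<in> unit_tuples j"
  shows "norm (D j y hs - D j x hs) \<le> C * norm (y - x)"
proof (rule differentiable_bound[of UNIV])
  have len: "length hs = j" using hs by (simp add: unit_tuples_def)
  show "((\<lambda>y. D j y hs) has_derivative (\<lambda>w. D (Suc j) z (w # hs))) (at z within UNIV)" for z
    using has_derivative_D[of hs z] len j by simp
  show "onorm (\<lambda>w. D (Suc j) z (w # hs)) \<le> C" for z
    using j by (intro onorm_le norm_multilinear_first_le[OF multilinear hs C]) auto
qed auto

lemma norm_D_linearization_le:
  assumes j: "Suc j < k" and C: "\<And>z hs. hs \<in> unit_tuples (Suc (Suc j)) \<Longrightarrow> norm (D (Suc (Suc j)) z hs) \<le> C"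
    and hs: "hs \<in> unit_tuples j" and C0: "0 \<le> C"
  shows "norm (D j y hs - D j x hs - D (Suc j) x ((y - x) # hs)) \<le> C * (norm (y - x))\<^sup>2"
proof -
  have len: "length hs = j" using hs by (simp add: unit_tuples_def)
  have lin: "linear (\<lambda>w. D (Suc j) z (w # hs))" for z using linear_first[of hs z] len j by simp
  have d: "norm (D (Suc j) z (w # hs) - D (Suc j) x (w # hs)) \<le> C * norm (z - x) * norm w" for z w
  proof (cases "w = 0")
    case True
    then show ?thesis by (simp add: linear_0[OF lin])
  next
    case False
    have "D (Suc j) z ((w /\<^sub>R norm w) # hs) - D (Suc j) x ((w /\<^sub>R norm w) # hs) =
        (D (Suc j) z (w # hs) - D (Suc j) x (w # hs)) /\<^sub>R norm w"
      using linear_scale[OF lin[of z], of "inverse (norm w)" w] linear_scale[OF lin[of x], of "inverse (norm w)" w]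
      by (simp only: scaleR_diff_right)
    moreover have "norm (D (Suc j) z ((w /\<^sub>R norm w) # hs) - D (Suc j) x ((w /\<^sub>R norm w) # hs)) \<le> C * norm (z - x)"
      using hs False by (intro norm_D_diff_le[OF j C]) (auto simp: unit_tuples_def)
    ultimately have "norm (D (Suc j) z (w # hs) - D (Suc j) x (w # hs)) / norm w \<le> C * norm (z - x)"
      by (simp add: divide_inverse mult.commute)
    then show ?thesis using False by (simp add: pos_divide_le_eq)
  qed
  have "norm (D j y hs - D j x hs - D (Suc j) x ((y - x) # hs)) \<le> norm (y - x) * (C * norm (y - x))"
  proof (rule differentiable_bound_linearization[where S="closed_segment x y" and f'="\<lambda>z w. D (Suc j) z (w # hs)"])
    show "x + t *\<^sub>R (y - x) \<in> closed_segment x y" if "t \<in> {0..1}" for t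
      using that unfolding closed_segment_def by (auto simp: algebra_simps intro!: exI[of _ t])
    show "((\<lambda>y. D j y hs) has_derivative (\<lambda>w. D (Suc j) z (w # hs))) (at z within closed_segment x y)" for z
      using has_derivative_D[of hs z] len j by (auto intro: has_derivative_at_withinI)
    show "onorm ((\<lambda>w. D (Suc j) z (w # hs)) - (\<lambda>w. D (Suc j) x (w # hs))) \<le> C * norm (y - x)"
      if z: "z \<in> closed_segment x y" for z
    proof (rule onorm_le)
      fix w :: 'a
      have "norm (z - x) \<le> norm (y - x)" using segment_bound1[OF z] by (simp add: norm_minus_commute)
      then have "C * norm (z - x) * norm w \<le> C * norm (y - x) * norm w"
        using C0 by (intro mult_right_mono mult_left_mono) auto
      then show "norm (((\<lambda>w. D (Suc j) z (w # hs)) - (\<lambda>w. D (Suc j) x (w # hs))) w) \<le> C * norm (y - x) * norm w"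
        using d[of z w] by simp
    qed
  qed auto
  then show ?thesis by (simp add: power2_eq_square algebra_simps)
qed

end

lemma mixed_derivative_eq:
  assumes "\<And>xs. mset xs = h \<Longrightarrow> foldr d xs f = g"
  shows "mixed_derivative d h f = g"
  unfolding mixed_derivative_def
proof (rule the_equality)
  obtain xs where xs: "mset xs = h" using ex_mset by blast
  show "g' = g" if "\<forall>xs. mset xs = h \<longrightarrow> foldr d xs f = g'" for g'
    using that assms xs by metis
qed (use assms in blast)

lemma (in frechet_family) mixed_directional_derivative:
  assumes "length hs \<le> k"
  shows "mixed_derivative directional_derivative (mset hs) f = (\<lambda>x. D (length hs) x hs)"
proof (rule mixed_derivative_eq)
  fix xs assume xs: "mset xs = mset hs"
  then have len: "length xs = length hs" by (metis size_mset)
  show "foldr directional_derivative xs f = (\<lambda>x. D (length hs) x hs)"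
    using foldr_directional_derivative[of xs] D_permute[OF xs] assms len by auto
qed

text \<open>
  The derivatives of the orbit of a measure \<open>\<mu>\<close> under translations. They commute with translations,
  and therefore their values at \<open>0\<close> are the mixed Fomin derivatives of \<open>\<mu>\<close>.
\<close>

locale translation_family =
  frechet_family k "\<lambda>x. sv_of_measure (translate_measure x \<mu>)" D
  for k :: nat and \<mu> :: "'a::euclidean_space set \<Rightarrow> 'v::real_normed_vector \<Rightarrow>\<^sub>L 'w::real_normed_vector"
    and D :: "nat \<Rightarrow> 'a \<Rightarrow> 'a list \<Rightarrow> ('a, 'v, 'w) sv_measure" +
  assumes \<mu>_CA: "\<mu> \<in> CA UNIV" and \<mu>_finite: "semivariation UNIV \<mu> UNIV < \<infinity>"
begin

abbreviation m :: "('a, 'v, 'w) sv_measure" where "m \<equiv> sv_of_measure \<mu>"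

lemma measure_of_m: "measure_of_sv m = \<mu>"
  using \<mu>_CA \<mu>_finite by (intro sv_of_measure_inverse) simp

lemma orbit: "sv_of_measure (translate_measure x \<mu>) = sv_translate x m"
  by (simp add: sv_translate_def measure_of_m)

lemma D_translate:
  "length hs \<le> k \<Longrightarrow> D (length hs) (x + y) hs = sv_translate x (D (length hs) y hs)"
proof (induction hs arbitrary: y)
  case Nil
  then show ?case by (simp add: D_0 orbit sv_translate_sv_translate)
next
  case (Cons h hs)
  let ?q = "\<lambda>t. (D (length hs) (y + t *\<^sub>R h) hs - D (length hs) y hs) /\<^sub>R t"
  interpret \<tau>: bounded_linear "sv_translate x" by (rule bounded_linear_sv_translate)
  have lim: "(?q \<longlongrightarrow> D (Suc (length hs)) y (h # hs)) (at 0)"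
    using Cons.prems by (intro directional_limit) simp
  have eq: "sv_translate x (?q t) = (D (length hs) ((x + y) + t *\<^sub>R h) hs - D (length hs) (x + y) hs) /\<^sub>R t" for t
    using Cons.IH[of "y + t *\<^sub>R h"] Cons.IH[of y] Cons.prems by (simp add: \<tau>.scaleR \<tau>.diff add.assoc)
  have "((\<lambda>t. sv_translate x (?q t)) \<longlongrightarrow> sv_translate x (D (Suc (length hs)) y (h # hs))) (at 0)"
    using lim by (rule \<tau>.tendsto)
  then have lim1: "((\<lambda>t. (D (length hs) ((x + y) + t *\<^sub>R h) hs - D (length hs) (x + y) hs) /\<^sub>R t)
      \<longlongrightarrow> sv_translate x (D (Suc (length hs)) y (h # hs))) (at 0)"
    unfolding eq .
  have "((\<lambda>t. (D (length hs) ((x + y) + t *\<^sub>R h) hs - D (length hs) (x + y) hs) /\<^sub>R t)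
      \<longlongrightarrow> D (Suc (length hs)) (x + y) (h # hs)) (at 0)"
    using Cons.prems by (intro directional_limit) simp
  from tendsto_unique[OF _ this lim1] show ?case by simp
qed

lemma foldr_fomin_derivative:
  "length hs \<le> k \<Longrightarrow> foldr fomin_derivative hs \<mu> = measure_of_sv (D (length hs) 0 hs)"
proof (induction hs)
  case Nil
  then show ?case by (simp add: D_0 orbit sv_translate_0 measure_of_m)
next
  case (Cons h hs)
  have "fomin_derivative h (measure_of_sv (D (length hs) 0 hs)) =
      measure_of_sv (Lim (at 0) (\<lambda>t. (sv_translate (t *\<^sub>R h) (D (length hs) 0 hs) - D (length hs) 0 hs) /\<^sub>R t))"
    by (simp add: fomin_derivative_def sv_translate_def measure_of_sv_inverse)
  also have "(\<lambda>t. (sv_translate (t *\<^sub>R h) (D (length hs) 0 hs) - D (length hs) 0 hs) /\<^sub>R t) =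
      (\<lambda>t. (D (length hs) (0 + t *\<^sub>R h) hs - D (length hs) 0 hs) /\<^sub>R t)"
  proof
    fix t :: real
    show "(sv_translate (t *\<^sub>R h) (D (length hs) 0 hs) - D (length hs) 0 hs) /\<^sub>R t =
        (D (length hs) (0 + t *\<^sub>R h) hs - D (length hs) 0 hs) /\<^sub>R t"
      using D_translate[of hs "t *\<^sub>R h" 0] Cons.prems by simp
  qed
  also have "Lim (at 0) \<dots> = D (Suc (length hs)) 0 (h # hs)"
    using Cons.prems by (intro tendsto_Lim directional_limit) simp_all
  finally show ?case using Cons by simp
qed

lemma mixed_fomin_derivative:
  assumes "length hs \<le> k"
  shows "mixed_derivative fomin_derivative (mset hs) \<mu> = measure_of_sv (D (length hs) 0 hs)"
proof (rule mixed_derivative_eq)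
  fix xs assume xs: "mset xs = mset hs"
  then have len: "length xs = length hs" by (metis size_mset)
  show "foldr fomin_derivative xs \<mu> = measure_of_sv (D (length hs) 0 hs)"
    using foldr_fomin_derivative[of xs] D_permute[OF xs] assms len by auto
qed

lemma D_in_csv_space:
  assumes \<mu>: "continuous_semivariation \<mu>"
  shows "length hs \<le> k \<Longrightarrow> D (length hs) x hs \<in> csv_space"
proof (induction hs arbitrary: x)
  case Nil
  have "m \<in> csv_space" using \<mu> by (simp add: csv_space_def measure_of_m)
  then show ?case by (simp add: D_0 orbit sv_translate_in_csv_space)
next
  case (Cons h hs)
  have "((\<lambda>t. (D (length hs) (x + t *\<^sub>R h) hs - D (length hs) x hs) /\<^sub>R t) \<longlongrightarrow> D (Suc (length hs)) x (h # hs)) (at (0::real))"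
    using Cons.prems by (intro directional_limit) simp
  then have "D (Suc (length hs)) x (h # hs) \<in> csv_space"
  proof (rule Lim_in_closed_set[OF closed_csv_space, rotated 2])
    show "\<forall>\<^sub>F t in at 0. (D (length hs) (x + t *\<^sub>R h) hs - D (length hs) x hs) /\<^sub>R t \<in> csv_space"
      using Cons by (intro always_eventually allI subspace_scale subspace_diff subspace_csv_space) auto
  qed simp
  then show ?case by simp
qed

end

section \<open>Splitting a tuple of directions\<close>

text \<open>
  A list of Booleans, a mask, distributes the entries of a tuple over two tuples: \<open>pick\<close> keeps the
  entries marked \<open>True\<close> and \<open>omit\<close> the others, both in the original order.
\<close>

fun pick :: "bool list \<Rightarrow> 'a list \<Rightarrow> 'a list" where
  "pick (b # m) (x # xs) = (if b then x # pick m xs else pick m xs)"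
| "pick _ _ = []"

abbreviation omit :: "bool list \<Rightarrow> 'a list \<Rightarrow> 'a list" where
  "omit m \<equiv> pick (map Not m)"

abbreviation masks :: "nat \<Rightarrow> bool list set" where
  "masks j \<equiv> {m. length m = j}"

lemma finite_masks: "finite (masks j)"
  using finite_lists_length_eq[of "UNIV :: bool set" j] by simp

lemma masks_0: "masks 0 = {[]}"
  by auto

lemma sum_masks_Suc:
  "(\<Sum>m\<in>masks (Suc j). F m) = (\<Sum>m\<in>masks j. F (True # m) + F (False # m))"
  for F :: "bool list \<Rightarrow> 'b::comm_monoid_add"
proof -
  have "masks (Suc j) = (Cons True ` masks j) \<union> (Cons False ` masks j)"
  proof (intro set_eqI iffI)
    fix m assume "m \<in> masks (Suc j)"
    then show "m \<in> (Cons True ` masks j) \<union> (Cons False ` masks j)" by (cases m) auto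
  qed auto
  then have "sum F (masks (Suc j)) = sum F (Cons True ` masks j) + sum F (Cons False ` masks j)"
    by (simp only:) (rule sum.union_disjoint, auto simp: finite_masks)
  then show ?thesis by (simp add: sum.reindex sum.distrib)
qed

lemma length_pick: "length m = length xs \<Longrightarrow> length (pick m xs) = length (filter id m)"
  by (induction m xs rule: list_induct2) auto

lemma length_omit: "length m = length xs \<Longrightarrow> length (omit m xs) = length (filter Not m)"
  by (induction m xs rule: list_induct2) auto

lemma length_filter_id_Not: "length (filter id m) + length (filter Not m) = length m"
  by (induction m) auto

lemma set_pick: "set (pick m xs) \<subseteq> set xs"
  by (induction m xs rule: pick.induct) auto

lemma pick_unit_tuples:
  "hs \<in> unit_tuples (length m) \<Longrightarrow> pick m hs \<in> unit_tuples (length (filter id m))"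
  using set_pick[of m hs] by (auto simp: unit_tuples_def length_pick)

lemma omit_unit_tuples:
  "hs \<in> unit_tuples (length m) \<Longrightarrow> omit m hs \<in> unit_tuples (length (filter Not m))"
  using set_pick[of "map Not m" hs] by (auto simp: unit_tuples_def length_omit)

text \<open>
  Changing one entry of the tuple changes one entry of exactly one of the two parts; this is why the
  sum over all masks is multilinear.
\<close>

lemma pick_update:
  assumes "length m = length xs" "i < length xs"
  shows "(\<exists>i'<length (pick m xs). \<forall>h. pick m (xs[i := h]) = (pick m xs)[i' := h] \<and> omit m (xs[i := h]) = omit m xs) \<or>
    (\<exists>i'<length (omit m xs). \<forall>h. omit m (xs[i := h]) = (omit m xs)[i' := h] \<and> pick m (xs[i := h]) = pick m xs)"
  using assms
proof (induction m xs arbitrary: i rule: list_induct2)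
  case (Cons b m x xs)
  show ?case
  proof (cases i)
    case 0
    then show ?thesis by (cases b) (auto intro!: exI[of _ 0])
  next
    case (Suc l)
    then have "l < length xs" using Cons.prems by simp
    from Cons.IH[OF this] show ?thesis
    proof (elim disjE exE conjE)
      fix i' assume i': "i' < length (pick m xs)"
        "\<forall>h. pick m (xs[l := h]) = (pick m xs)[i' := h] \<and> omit m (xs[l := h]) = omit m xs"
      show ?thesis
        by (rule disjI1, rule exI[of _ "if b then Suc i' else i'"]) (use i' Suc in auto)
    next
      fix i' assume i': "i' < length (omit m xs)"
        "\<forall>h. omit m (xs[l := h]) = (omit m xs)[i' := h] \<and> pick m (xs[l := h]) = pick m xs"
      show ?thesis
        by (rule disjI2, rule exI[of _ "if b then i' else Suc i'"]) (use i' Suc in auto)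
    qed
  qed
qed simp

section \<open>Multibinomial coefficients\<close>

lemma multibinomial_superset:
  assumes "finite W" "set_mset (\<alpha> + \<beta>) \<subseteq> W"
  shows "multibinomial \<alpha> \<beta> =
    (\<Prod>x\<in>W. fact (count \<alpha> x + count \<beta> x) / (fact (count \<alpha> x) * fact (count \<beta> x)))"
  unfolding multibinomial_def
  by (rule prod.mono_neutral_left[OF assms]) (auto simp: not_in_iff)

lemma fact_pascal:
  assumes "0 < a + b"
  shows "(fact (a + b) / (fact a * fact b) :: real) =
    (if 0 < a then fact (a - 1 + b) / (fact (a - 1) * fact b) else 0) +
    (if 0 < b then fact (a + (b - 1)) / (fact a * fact (b - 1)) else 0)"
proof (cases a)
  case 0
  then show ?thesis using assms by simp
next
  case (Suc a')
  show ?thesis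
  proof (cases b)
    case 0
    then show ?thesis using Suc by simp
  next
    case (Suc b')
    have "fact (Suc a' + Suc b') = (real (Suc a') + real (Suc b')) * fact (a' + Suc b')" by simp
    then show ?thesis using \<open>a = Suc a'\<close> Suc by (simp add: divide_simps) (simp add: algebra_simps)
  qed
qed

text \<open>
  Pascal's rule: the coefficients differ only in the factor for \<open>x\<close>.
\<close>

lemma multibinomial_pascal:
  assumes x: "x \<in># \<alpha> + \<beta>"
  shows "multibinomial \<alpha> \<beta> =
    (if x \<in># \<alpha> then multibinomial (\<alpha> - {#x#}) \<beta> else 0) +
    (if x \<in># \<beta> then multibinomial \<alpha> (\<beta> - {#x#}) else 0)"
proof -
  define W where "W = set_mset (\<alpha> + \<beta>)"
  define t where "t a b = (fact (a + b) / (fact a * fact b) :: real)" for a b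
  define R where "R = (\<Prod>y\<in>W - {x}. t (count \<alpha> y) (count \<beta> y))"
  have W: "finite W" "x \<in> W" using x by (auto simp: W_def)
  have eq: "multibinomial \<gamma> \<delta> = t (count \<gamma> x) (count \<delta> x) * R"
    if "set_mset (\<gamma> + \<delta>) \<subseteq> W" "\<And>y. y \<noteq> x \<Longrightarrow> count \<gamma> y = count \<alpha> y" "\<And>y. y \<noteq> x \<Longrightarrow> count \<delta> y = count \<beta> y" for \<gamma> \<delta>
  proof -
    have "multibinomial \<gamma> \<delta> = (\<Prod>y\<in>W. t (count \<gamma> y) (count \<delta> y))"
      using multibinomial_superset[OF W(1) that(1)] by (simp add: t_def)
    also have "\<dots> = t (count \<gamma> x) (count \<delta> x) * (\<Prod>y\<in>W - {x}. t (count \<gamma> y) (count \<delta> y))"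
      using W by (rule prod.remove)
    also have "(\<Prod>y\<in>W - {x}. t (count \<gamma> y) (count \<delta> y)) = R"
      unfolding R_def using that by (intro prod.cong) auto
    finally show ?thesis .
  qed
  have "multibinomial \<alpha> \<beta> = t (count \<alpha> x) (count \<beta> x) * R"
    by (rule eq) (auto simp: W_def)
  moreover have "multibinomial (\<alpha> - {#x#}) \<beta> = t (count \<alpha> x - 1) (count \<beta> x) * R"
    by (subst eq) (auto simp: W_def dest: in_diffD)
  moreover have "multibinomial \<alpha> (\<beta> - {#x#}) = t (count \<alpha> x) (count \<beta> x - 1) * R"
    by (subst eq) (auto simp: W_def dest: in_diffD)
  moreover have "0 < count \<alpha> x + count \<beta> x"
    using x by (simp add: count_greater_zero_iff[symmetric] del: count_greater_zero_iff)
  note fact_pascal[OF this, folded t_def]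
  ultimately show ?thesis
    by (auto simp: algebra_simps count_greater_zero_iff[symmetric] simp del: count_greater_zero_iff)
qed

lemma finite_splittings: "finite {(\<alpha>, \<beta>). \<alpha> + \<beta> = (h :: 'a multiset)}"
proof (induction h)
  case empty
  have "{(\<alpha>, \<beta>). \<alpha> + \<beta> = ({#} :: 'a multiset)} = {({#}, {#})}" by auto
  then show ?case by simp
next
  case (add x h)
  have "{(\<alpha>, \<beta>). \<alpha> + \<beta> = add_mset x h} \<subseteq>
      (\<lambda>(\<alpha>, \<beta>). (add_mset x \<alpha>, \<beta>)) ` {(\<alpha>, \<beta>). \<alpha> + \<beta> = h} \<union>
      (\<lambda>(\<alpha>, \<beta>). (\<alpha>, add_mset x \<beta>)) ` {(\<alpha>, \<beta>). \<alpha> + \<beta> = h}"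
  proof clarify
    fix \<alpha> \<beta> assume eq: "\<alpha> + \<beta> = add_mset x h"
      and no: "(\<alpha>, \<beta>) \<notin> (\<lambda>(\<alpha>, \<beta>). (\<alpha>, add_mset x \<beta>)) ` {(\<alpha>, \<beta>). \<alpha> + \<beta> = h}"
    have "x \<in># \<alpha> + \<beta>" using eq by simp
    then consider \<alpha>' where "\<alpha> = add_mset x \<alpha>'" | \<beta>' where "\<beta> = add_mset x \<beta>'"
      by (auto dest: multi_member_split)
    then show "(\<alpha>, \<beta>) \<in> (\<lambda>(\<alpha>, \<beta>). (add_mset x \<alpha>, \<beta>)) ` {(\<alpha>, \<beta>). \<alpha> + \<beta> = h}"
    proof cases
      case 1
      then show ?thesis using eq by (force simp: image_iff)
    next
      case 2
      then show ?thesis using eq no by (force simp: image_iff)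
    qed
  qed
  then show ?case by (rule finite_subset) (simp add: add.IH)
qed

lemma sum_splittings_left:
  fixes G :: "'a multiset \<Rightarrow> 'a multiset \<Rightarrow> 'b::comm_monoid_add"
  shows "(\<Sum>(\<alpha>, \<beta>)\<in>{(\<alpha>, \<beta>). \<alpha> + \<beta> = h}. G (add_mset x \<alpha>) \<beta>) =
    (\<Sum>(\<alpha>, \<beta>)\<in>{(\<alpha>, \<beta>). \<alpha> + \<beta> = add_mset x h}. if x \<in># \<alpha> then G \<alpha> \<beta> else 0)"
proof -
  have "(\<Sum>(\<alpha>, \<beta>)\<in>{(\<alpha>, \<beta>). \<alpha> + \<beta> = add_mset x h}. if x \<in># \<alpha> then G \<alpha> \<beta> else 0) =
      (\<Sum>(\<alpha>, \<beta>)\<in>{(\<alpha>, \<beta>). \<alpha> + \<beta> = add_mset x h \<and> x \<in># \<alpha>}. G \<alpha> \<beta>)"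
    by (rule sum.mono_neutral_cong_right[OF finite_splittings]) (auto split: if_splits)
  also have "\<dots> = (\<Sum>(\<alpha>, \<beta>)\<in>{(\<alpha>, \<beta>). \<alpha> + \<beta> = h}. G (add_mset x \<alpha>) \<beta>)"
    by (rule sum.reindex_bij_witness[of _ "\<lambda>(\<alpha>, \<beta>). (add_mset x \<alpha>, \<beta>)" "\<lambda>(\<alpha>, \<beta>). (\<alpha> - {#x#}, \<beta>)"])
      (auto dest: multi_member_split)
  finally show ?thesis ..
qed

lemma sum_splittings_right:
  fixes G :: "'a multiset \<Rightarrow> 'a multiset \<Rightarrow> 'b::comm_monoid_add"
  shows "(\<Sum>(\<alpha>, \<beta>)\<in>{(\<alpha>, \<beta>). \<alpha> + \<beta> = h}. G \<alpha> (add_mset x \<beta>)) =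
    (\<Sum>(\<alpha>, \<beta>)\<in>{(\<alpha>, \<beta>). \<alpha> + \<beta> = add_mset x h}. if x \<in># \<beta> then G \<alpha> \<beta> else 0)"
proof -
  have swap: "(\<Sum>(\<alpha>, \<beta>)\<in>{(\<alpha>, \<beta>). \<alpha> + \<beta> = h'}. H \<alpha> \<beta>) = (\<Sum>(\<alpha>, \<beta>)\<in>{(\<alpha>, \<beta>). \<alpha> + \<beta> = h'}. H \<beta> \<alpha>)"
    for h' :: "'a multiset" and H :: "'a multiset \<Rightarrow> 'a multiset \<Rightarrow> 'b"
    by (rule sum.reindex_bij_witness[of _ "\<lambda>(\<alpha>, \<beta>). (\<beta>, \<alpha>)" "\<lambda>(\<alpha>, \<beta>). (\<beta>, \<alpha>)"]) (auto simp: add.commute)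
  show ?thesis
    using sum_splittings_left[of "\<lambda>\<alpha> \<beta>. G \<beta> \<alpha>" x h]
      swap[of "\<lambda>\<alpha> \<beta>. G \<beta> (add_mset x \<alpha>)" h] swap[of "\<lambda>\<alpha> \<beta>. if x \<in># \<alpha> then G \<beta> \<alpha> else 0" "add_mset x h"]
    by simp
qed

text \<open>
  The number of masks that split \<open>xs\<close> into parts with multisets \<open>\<alpha>\<close> and \<open>\<beta>\<close> is the multibinomial
  coefficient; the first entry goes to either part, which is Pascal's rule.
\<close>

lemma sum_masks_eq_sum_splittings:
  fixes g :: "'a multiset \<Rightarrow> 'a multiset \<Rightarrow> 'b::real_vector"
  shows "(\<Sum>m\<in>masks (length xs). g (mset (pick m xs)) (mset (omit m xs))) =
    (\<Sum>(\<alpha>, \<beta>)\<in>{(\<alpha>, \<beta>). \<alpha> + \<beta> = mset xs}. multibinomial \<alpha> \<beta> *\<^sub>R g \<alpha> \<beta>)"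
proof (induction xs arbitrary: g)
  case Nil
  have "{(\<alpha>, \<beta>). \<alpha> + \<beta> = ({#} :: 'a multiset)} = {({#}, {#})}" by auto
  then show ?case by (simp add: masks_0 multibinomial_def)
next
  case (Cons x xs)
  let ?S = "\<lambda>h. {(\<alpha>, \<beta>). \<alpha> + \<beta> = (h :: 'a multiset)}"
  define L where "L \<alpha> \<beta> = multibinomial (\<alpha> - {#x#}) \<beta> *\<^sub>R g \<alpha> \<beta>" for \<alpha> \<beta>
  define R where "R \<alpha> \<beta> = multibinomial \<alpha> (\<beta> - {#x#}) *\<^sub>R g \<alpha> \<beta>" for \<alpha> \<beta>
  have "(\<Sum>m\<in>masks (length (x # xs)). g (mset (pick m (x # xs))) (mset (omit m (x # xs)))) =
      (\<Sum>m\<in>masks (length xs). g (add_mset x (mset (pick m xs))) (mset (omit m xs))) +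
      (\<Sum>m\<in>masks (length xs). g (mset (pick m xs)) (add_mset x (mset (omit m xs))))"
    by (simp add: sum_masks_Suc sum.distrib)
  also have "\<dots> = (\<Sum>(\<alpha>, \<beta>)\<in>?S (mset xs). L (add_mset x \<alpha>) \<beta>) + (\<Sum>(\<alpha>, \<beta>)\<in>?S (mset xs). R \<alpha> (add_mset x \<beta>))"
    using Cons.IH[of "\<lambda>\<alpha> \<beta>. g (add_mset x \<alpha>) \<beta>"] Cons.IH[of "\<lambda>\<alpha> \<beta>. g \<alpha> (add_mset x \<beta>)"]
    by (simp add: L_def R_def)
  also have "\<dots> = (\<Sum>(\<alpha>, \<beta>)\<in>?S (add_mset x (mset xs)). (if x \<in># \<alpha> then L \<alpha> \<beta> else 0) + (if x \<in># \<beta> then R \<alpha> \<beta> else 0))"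
    unfolding sum_splittings_left sum_splittings_right by (simp add: sum.distrib case_prod_unfold)
  also have "\<dots> = (\<Sum>(\<alpha>, \<beta>)\<in>?S (add_mset x (mset xs)). multibinomial \<alpha> \<beta> *\<^sub>R g \<alpha> \<beta>)"
  proof (rule sum.cong[OF refl], clarify)
    fix \<alpha> \<beta> :: "'a multiset" assume "\<alpha> + \<beta> = add_mset x (mset xs)"
    then have "x \<in># \<alpha> + \<beta>" by simp
    from multibinomial_pascal[OF this]
    show "(if x \<in># \<alpha> then L \<alpha> \<beta> else 0) + (if x \<in># \<beta> then R \<alpha> \<beta> else 0) = multibinomial \<alpha> \<beta> *\<^sub>R g \<alpha> \<beta>"
      by (simp add: L_def R_def scaleR_add_left)
  qed
  finally show ?case by simp
qed

section \<open>The Leibniz rule\<close>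

lemma uniform_limit_null_two:
  fixes f :: "'i \<Rightarrow> 's \<Rightarrow> 'b::real_normed_vector"
  assumes A: "uniform_limit S A (\<lambda>_. 0) F" and B: "uniform_limit S B (\<lambda>_. 0) F"
    and c: "(c \<longlongrightarrow> (0::real)) F" and C: "0 \<le> C"
    and le: "\<forall>\<^sub>F y in F. \<forall>s\<in>S. norm (f y s) \<le> C * norm (A y s) + norm (B y s) + c y"
  shows "uniform_limit S f (\<lambda>_. 0) F"
proof (rule uniform_limitI)
  fix e :: real assume e: "e > 0"
  define d where "d = e / 3 / (C + 1)"
  have d: "d > 0" "C * d \<le> e / 3" using e C by (auto simp: d_def divide_simps mult_left_mono)
  have "\<forall>\<^sub>F y in F. \<forall>s\<in>S. dist (A y s) 0 < d" using A d(1) by (rule uniform_limitD)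
  moreover have "\<forall>\<^sub>F y in F. \<forall>s\<in>S. dist (B y s) 0 < e / 3" using B e by (intro uniform_limitD) auto
  moreover have "\<forall>\<^sub>F y in F. c y < e / 3" using c e by (intro order_tendstoD) auto
  ultimately show "\<forall>\<^sub>F y in F. \<forall>s\<in>S. dist (f y s) 0 < e"
    using le
  proof eventually_elim
    case (elim y)
    show ?case
    proof
      fix s assume s: "s \<in> S"
      have "C * norm (A y s) \<le> C * d" using elim(1) s C by (intro mult_left_mono) auto
      moreover have "norm (B y s) < e / 3" using elim(2) s by auto
      moreover have "norm (f y s) \<le> C * norm (A y s) + norm (B y s) + c y" using elim(4) s by blast
      ultimately show "dist (f y s) 0 < e" using d(2) elim(3) by simp
    qed
  qed
qed

lemma uniform_limit_zero: "uniform_limit S (\<lambda>y s. 0) (\<lambda>_. 0) F"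
  by (simp add: uniform_limit_iff)

lemma uniform_limit_null_sum:
  fixes f :: "'m \<Rightarrow> 'i \<Rightarrow> 's \<Rightarrow> 'b::real_normed_vector"
  assumes "finite I" "\<And>m. m \<in> I \<Longrightarrow> uniform_limit S (f m) (\<lambda>_. 0) F"
  shows "uniform_limit S (\<lambda>y s. \<Sum>m\<in>I. f m y s) (\<lambda>_. 0) F"
  using assms
proof (induction I)
  case empty
  show ?case by (simp add: uniform_limit_zero)
next
  case (insert m I)
  then have "uniform_limit S (\<lambda>y s. f m y s + (\<Sum>m\<in>I. f m y s)) (\<lambda>s. 0 + 0) F"
    by (intro uniform_limit_add) auto
  then show ?case using insert.hyps by simp
qed

lemma uniform_limit_diff_iff:
  fixes f :: "'i \<Rightarrow> 's \<Rightarrow> 'b::real_normed_vector"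
  shows "uniform_limit S f l F \<longleftrightarrow> uniform_limit S (\<lambda>y s. f y s - l s) (\<lambda>_. 0) F"
  by (simp add: uniform_limit_iff dist_norm)

text \<open>
  Bounded convergence, uniform in a parameter \<open>s\<close>: otherwise there are \<open>y\<^sub>n \<rightarrow> x\<close> and \<open>s\<^sub>n\<close> that violate
  the sequential form. The convergence need not be uniform in \<open>z\<close>.
\<close>

lemma (in operator_space) uniform_limit_sv_product:
  fixes \<nu> :: "('a::euclidean_space, 'v, 'w::banach) sv_measure" and x :: "'x::metric_space"
  assumes \<nu>: "\<nu> \<in> csv_space"
    and r: "\<And>y s. y \<noteq> x \<Longrightarrow> s \<in> S \<Longrightarrow> r y s \<in> Cb E"
    and C: "\<And>y s z. y \<noteq> x \<Longrightarrow> s \<in> S \<Longrightarrow> norm (r y s z) \<le> C"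
    and lim: "\<And>z. uniform_limit S (\<lambda>y s. r y s z) (\<lambda>_. 0) (at x)"
  shows "uniform_limit S (\<lambda>y s. sv_product E \<nu> (r y s)) (\<lambda>_. 0) (at x)"
proof (rule uniform_limitI, rule ccontr)
  fix e :: real assume e: "e > 0"
  assume neg: "\<not> (\<forall>\<^sub>F y in at x. \<forall>s\<in>S. dist (sv_product E \<nu> (r y s)) 0 < e)"
  have "\<exists>y s. y \<noteq> x \<and> dist y x < inverse (Suc n) \<and> s \<in> S \<and> \<not> dist (sv_product E \<nu> (r y s)) 0 < e" for n
  proof -
    have "inverse (Suc n) > (0::real)" by simp
    with neg show ?thesis unfolding eventually_at by blast
  qed
  then obtain y s where ys: "\<And>n. y n \<noteq> x" "\<And>n. dist (y n) x < inverse (Suc n)" "\<And>n. s n \<in> S"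
    "\<And>n. \<not> dist (sv_product E \<nu> (r (y n) (s n))) 0 < e" by metis
  have "y \<longlonglongrightarrow> x"
  proof (rule tendstoI)
    fix d :: real assume "d > 0"
    then have "\<forall>\<^sub>F n in sequentially. inverse (real (Suc n)) < d"
      using LIMSEQ_inverse_real_of_nat order_tendstoD(2) by blast
    then show "\<forall>\<^sub>F n in sequentially. dist (y n) x < d"
      by eventually_elim (use ys(2) in \<open>auto intro: less_trans\<close>)
  qed
  then have y: "filterlim y (at x) sequentially" using ys(1) by (simp add: filterlim_at)
  have "(\<lambda>n. sv_product E \<nu> (r (y n) (s n))) \<longlonglongrightarrow> 0"
  proof (rule sv_product_bounded_convergence[OF \<nu>, where C=C])
    show "(\<lambda>n. r (y n) (s n) z) \<longlonglongrightarrow> 0" for z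
    proof (rule tendstoI)
      fix d :: real assume "d > 0"
      with lim have "\<forall>\<^sub>F y in at x. \<forall>s\<in>S. dist (r y s z) 0 < d" by (rule uniform_limitD)
      then have "\<forall>\<^sub>F n in sequentially. \<forall>s\<in>S. dist (r (y n) s z) 0 < d"
        using y unfolding filterlim_iff by blast
      then show "\<forall>\<^sub>F n in sequentially. dist (r (y n) (s n) z) 0 < d"
        by eventually_elim (use ys(3) in auto)
    qed
  qed (use r C ys in auto)
  then have "\<forall>\<^sub>F n in sequentially. dist (sv_product E \<nu> (r (y n) (s n))) 0 < e"
    using e by (rule tendstoD)
  then show False using ys(4) by (auto simp: eventually_sequentially)
qed

lemma common_bound:
  fixes T :: "nat \<Rightarrow> 'i \<Rightarrow> 's \<Rightarrow> 'b::real_normed_vector"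
  assumes "\<And>j. j \<le> k \<Longrightarrow> bounded (\<Union>x\<in>X. T j x ` S j)"
  obtains C where "0 < C" "\<And>j x s. j \<le> (k::nat) \<Longrightarrow> x \<in> X \<Longrightarrow> s \<in> S j \<Longrightarrow> norm (T j x s) \<le> C"
proof -
  have "bounded (\<Union>j\<in>{..k}. \<Union>x\<in>X. T j x ` S j)"
    using assms by (intro bounded_UN) auto
  then obtain C where C: "0 < C" "\<forall>v\<in>(\<Union>j\<in>{..k}. \<Union>x\<in>X. T j x ` S j). norm v \<le> C"
    unfolding bounded_pos by (elim exE conjE)
  show thesis
  proof (rule that[OF C(1)])
    fix j x s assume "j \<le> k" "x \<in> X" "s \<in> S j"
    then show "norm (T j x s) \<le> C" by (intro C(2)[rule_format]) auto
  qed
qed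

text \<open>
  The data of the theorem, with the derivatives \<open>P\<close> of the orbit of \<open>\<mu>\<close> and \<open>Q\<close> of \<open>\<phi>\<close> fixed. The
  space \<open>E\<close> of admissible operators remains abstract.
\<close>

locale leibniz = operator_space E + P: translation_family k \<mu> P + Q: frechet_family k \<phi> Q
  for E :: "('v::banach \<Rightarrow>\<^sub>L 'v) set" and k :: nat
    and \<mu> :: "'a::euclidean_space set \<Rightarrow> 'v \<Rightarrow>\<^sub>L 'w::banach"
    and P :: "nat \<Rightarrow> 'a \<Rightarrow> 'a list \<Rightarrow> ('a, 'v, 'w) sv_measure"
    and \<phi> :: "'a \<Rightarrow> 'v \<Rightarrow>\<^sub>L 'v"
    and Q :: "nat \<Rightarrow> 'a \<Rightarrow> 'a list \<Rightarrow> 'v \<Rightarrow>\<^sub>L 'v" +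
  assumes continuous: "continuous_semivariation \<mu>"
    and P_cont: "\<And>x. uniform_limit (unit_tuples k) (P k) (P k x) (at x)"
    and Q_cont: "\<And>x. uniform_limit (unit_tuples k) (Q k) (Q k x) (at x)"
    and Q_bounded: "\<And>j. j \<le> k \<Longrightarrow> bounded (\<Union>x. Q j x ` unit_tuples j)"
    and \<phi>_in: "range \<phi> \<subseteq> E"
begin

lemma P_csv: "length hs = j \<Longrightarrow> j \<le> k \<Longrightarrow> P j x hs \<in> csv_space"
  using P.D_in_csv_space[OF continuous, of hs x] by simp

lemma Q_in: "length hs \<le> k \<Longrightarrow> Q (length hs) x hs \<in> E"
proof (induction hs arbitrary: x)
  case Nil
  then show ?case using \<phi>_in by (auto simp: Q.D_0)
next
  case (Cons h hs)
  have "((\<lambda>t. (Q (length hs) (x + t *\<^sub>R h) hs - Q (length hs) x hs) /\<^sub>R t) \<longlongrightarrow> Q (Suc (length hs)) x (h # hs)) (at (0::real))"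
    using Cons.prems by (intro Q.directional_limit) simp
  then have "Q (Suc (length hs)) x (h # hs) \<in> E"
  proof (rule Lim_in_closed_set[OF closed, rotated 2])
    show "\<forall>\<^sub>F t in at 0. (Q (length hs) (x + t *\<^sub>R h) hs - Q (length hs) x hs) /\<^sub>R t \<in> E"
      using Cons by (intro always_eventually allI subspace_scale subspace_diff subspace) auto
  qed simp
  then show ?case by simp
qed

lemma Q_Cb:
  assumes len: "length hs = j" "j \<le> k"
  shows "(\<lambda>z. Q j z hs) \<in> Cb E"
proof -
  obtain c :: real where c: "c > 0" "map ((*\<^sub>R) (inverse c)) hs \<in> unit_tuples (length hs)"
    using scale_to_unit_tuple[of hs] by metis
  define us where "us = map ((*\<^sub>R) (inverse c)) hs"
  have us: "us \<in> unit_tuples j" "length us = j" "map ((*\<^sub>R) c) us = hs"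
    using c len by (simp_all add: us_def comp_def)
  obtain C where C: "\<And>z. norm (Q j z us) \<le> C"
    using Q_bounded[OF len(2)] us(1) unfolding bounded_iff by blast
  have "isCont (\<lambda>z. Q j z us) x" for x
  proof (cases "j < k")
    case True
    then show ?thesis using has_derivative_continuous[OF Q.has_derivative_D[of us x]] us(2) by simp
  next
    case False
    then have "j = k" using len by simp
    then show ?thesis
      using tendsto_uniform_limitI[OF Q_cont us(1)[unfolded \<open>j = k\<close>], of x] by (simp add: isCont_def)
  qed
  then have "(\<lambda>z. Q j z us) \<in> Cb E"
    using C Q_in[of us] us len by (intro CbI) (auto simp: continuous_on_eq_continuous_at)
  then have "(\<lambda>z. c ^ j *\<^sub>R Q j z us) \<in> Cb E" by (rule Cb_scaleR[OF subspace])
  moreover have "Q j z hs = c ^ j *\<^sub>R Q j z us" for z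
    using Q.scale[of us z c] len unfolding us by simp
  ultimately show ?thesis by simp
qed

lemma Q_Cb': "length hs = j \<Longrightarrow> j \<le> k \<Longrightarrow> (\<lambda>z. Q j (z + x) hs) \<in> Cb E"
  by (rule Cb_translate[OF Q_Cb])

text \<open>
  A common bound of all derivatives of \<open>\<phi>\<close> of order at most \<open>k\<close>.
\<close>

definition C :: real where
  "C = (SOME C. 0 < C \<and> (\<forall>j\<le>k. \<forall>x. \<forall>hs\<in>unit_tuples j. norm (Q j x hs) \<le> C))"

lemma C: "0 < C" "\<And>j x hs. j \<le> k \<Longrightarrow> hs \<in> unit_tuples j \<Longrightarrow> norm (Q j x hs) \<le> C"
proof -
  have "\<exists>C. 0 < C \<and> (\<forall>j\<le>k. \<forall>x. \<forall>hs\<in>unit_tuples j. norm (Q j x hs) \<le> C)"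
    using common_bound[where k=k and X=UNIV and T=Q and S=unit_tuples, OF Q_bounded] by (metis UNIV_I)
  from someI_ex[OF this] show "0 < C" "\<And>j x hs. j \<le> k \<Longrightarrow> hs \<in> unit_tuples j \<Longrightarrow> norm (Q j x hs) \<le> C"
    unfolding C_def[symmetric] by blast+
qed

lemma P_bound:
  obtains K where "0 < K" "\<And>j hs. j \<le> k \<Longrightarrow> hs \<in> unit_tuples j \<Longrightarrow> norm (P j x hs) \<le> K"
proof -
  have "bounded (\<Union>x\<in>{x}. P j x ` unit_tuples j)" if "j \<le> k" for j
    using P.multilinear[OF that, of x] by (simp add: bounded_multilinear_def)
  from common_bound[where k=k and X="{x}" and T=P and S=unit_tuples, OF this] that show thesis
    by (metis singletonI)
qed

lemma Q_lipschitz: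
  "j < k \<Longrightarrow> hs \<in> unit_tuples j \<Longrightarrow> norm (Q j y hs - Q j x hs) \<le> C * norm (y - x)"
  by (rule Q.norm_D_diff_le) (use C in auto)

lemma norm_Q_Cons: "Suc j \<le> k \<Longrightarrow> hs \<in> unit_tuples j \<Longrightarrow> norm (Q (Suc j) x (w # hs)) \<le> C * norm w"
  by (rule norm_multilinear_first_le[OF Q.multilinear]) (use C in auto)

lemma P_continuous:
  assumes j: "j \<le> k"
  shows "uniform_limit (unit_tuples j) (P j) (P j x) (at x)"
proof (cases "j = k")
  case False
  then have j: "j < k" using j by simp
  obtain K where K: "0 < K" "\<And>j hs. j \<le> k \<Longrightarrow> hs \<in> unit_tuples j \<Longrightarrow> norm (P j x hs) \<le> K"
    using P_bound[of x] by metis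
  let ?A = "\<lambda>y hs. (P j y hs - P j x hs - P (Suc j) x ((y - x) # hs)) /\<^sub>R norm (y - x)"
  have "uniform_limit (unit_tuples j) (\<lambda>y hs. P j y hs - P j x hs) (\<lambda>_. 0) (at x)"
  proof (rule uniform_limit_null_two[OF P.uniform_derivative[OF j] uniform_limit_zero])
    show "((\<lambda>y. K * norm (y - x)) \<longlongrightarrow> 0) (at x)" by (auto intro!: tendsto_eq_intros)
    have "\<forall>\<^sub>F y in at x. y \<noteq> x \<and> dist y x < 1" by (auto simp: eventually_at intro!: exI[of _ 1])
    then show "\<forall>\<^sub>F y in at x. \<forall>hs\<in>unit_tuples j. norm (P j y hs - P j x hs) \<le> 1 * norm (?A y hs) + norm (0::real) + K * norm (y - x)"
    proof eventually_elim
      case (elim y)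
      show ?case
      proof
        fix hs :: "'a list" assume hs: "hs \<in> unit_tuples j"
        have "P j y hs - P j x hs = norm (y - x) *\<^sub>R ?A y hs + P (Suc j) x ((y - x) # hs)"
          using elim by simp
        then have "norm (P j y hs - P j x hs) \<le> norm (norm (y - x) *\<^sub>R ?A y hs) + norm (P (Suc j) x ((y - x) # hs))"
          by (metis norm_triangle_ineq)
        also have "norm (P (Suc j) x ((y - x) # hs)) \<le> K * norm (y - x)"
          by (rule norm_multilinear_first_le[OF P.multilinear hs]) (use K j in auto)
        also have "norm (norm (y - x) *\<^sub>R ?A y hs) \<le> 1 * norm (?A y hs)"
          unfolding norm_scaleR using elim by (intro mult_right_mono) (auto simp: dist_norm)
        finally show "norm (P j y hs - P j x hs) \<le> 1 * norm (?A y hs) + norm (0::real) + K * norm (y - x)" by simp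
      qed
    qed
  qed simp
  then show ?thesis using uniform_limit_diff_iff by blast
qed (use P_cont in simp)

text \<open>
  One term of the Leibniz formula at the base point \<open>x\<close>: the derivative of the orbit along \<open>a\<close> times
  the translated derivative of \<open>\<phi>\<close> along \<open>b\<close>.
\<close>

definition G :: "'a \<Rightarrow> 'a list \<Rightarrow> 'a list \<Rightarrow> ('a, 'v, 'w) sv_measure" where
  "G x a b = sv_product E (P (length a) x a) (\<lambda>z. Q (length b) (z + x) b)"

lemma norm_G_le:
  assumes "a \<in> unit_tuples p" "b \<in> unit_tuples q" "p \<le> k" "q \<le> k"
  shows "norm (G x a b) \<le> C * norm (P p x a)"
  using assms C unfolding G_def by (auto simp: unit_tuples_def intro!: norm_sv_product_le P_csv Q_Cb')

lemma G_linear_left: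
  assumes "i < length a" "length a \<le> k" "length b \<le> k"
  shows "linear (\<lambda>h. G x (a[i := h]) b)"
proof -
  have lin: "linear (\<lambda>h. P (length a) x (a[i := h]))"
    using assms P.multilinear by (intro bounded_multilinear_linear) auto
  show ?thesis
    unfolding G_def
    by (rule linearI)
      (use assms in \<open>simp_all add: linear_add[OF lin] linear_scale[OF lin] sv_product_add_left sv_product_scaleR_left P_csv Q_Cb'\<close>)
qed

lemma G_linear_right:
  assumes "i < length b" "length a \<le> k" "length b \<le> k"
  shows "linear (\<lambda>h. G x a (b[i := h]))"
proof -
  have lin: "linear (\<lambda>h. Q (length b) z (b[i := h]))" for z
    using assms Q.multilinear by (intro bounded_multilinear_linear) auto
  show ?thesis
    unfolding G_def
    by (rule linearI)
      (use assms in \<open>simp_all add: linear_add[OF lin] linear_scale[OF lin] sv_product_add_right sv_product_scaleR_right P_csv Q_Cb'\<close>)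
qed

text \<open>
  The derivatives of the orbit of \<open>\<mu>\<phi>\<close>.
\<close>

definition L :: "nat \<Rightarrow> 'a \<Rightarrow> 'a list \<Rightarrow> ('a, 'v, 'w) sv_measure" where
  "L j x hs = (\<Sum>m\<in>masks j. G x (pick m hs) (omit m hs))"

lemma lengths_le:
  assumes "length m = length hs" "length hs \<le> k"
  shows "length (pick m hs) \<le> k" "length (omit m hs) \<le> k"
  using assms length_filter_id_Not[of m] by (simp_all add: length_pick length_omit)

lemma multilinear_L:
  assumes j: "j \<le> k"
  shows "bounded_multilinear j (L j x)"
  unfolding bounded_multilinear_def
proof (intro conjI allI impI)
  fix hs :: "'a list" and i assume hs: "length hs = j" and i: "i < j"
  have "linear (\<lambda>h. G x (pick m (hs[i := h])) (omit m (hs[i := h])))" if m: "m \<in> masks j" for m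
  proof -
    have len: "length (pick m hs) \<le> k" "length (omit m hs) \<le> k"
      using lengths_le[of m hs] m hs j by auto
    have "length m = length hs" "i < length hs" using m hs i by auto
    from pick_update[OF this] show ?thesis
    proof (elim disjE exE conjE)
      fix i' assume i': "i' < length (pick m hs)"
        "\<forall>h. pick m (hs[i := h]) = (pick m hs)[i' := h] \<and> omit m (hs[i := h]) = omit m hs"
      then show ?thesis using G_linear_left[OF i'(1) len] by simp
    next
      fix i' assume i': "i' < length (omit m hs)"
        "\<forall>h. omit m (hs[i := h]) = (omit m hs)[i' := h] \<and> pick m (hs[i := h]) = pick m hs"
      then show ?thesis using G_linear_right[OF i'(1) len] by simp
    qed
  qed
  then show "linear (\<lambda>h. L j x (hs[i := h]))"
    unfolding L_def by (rule linear_compose_sum[rule_format])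
next
  obtain K where K: "0 < K" "\<And>j hs. j \<le> k \<Longrightarrow> hs \<in> unit_tuples j \<Longrightarrow> norm (P j x hs) \<le> K"
    using P_bound[of x] by metis
  have "norm (L j x hs) \<le> (\<Sum>m\<in>masks j. C * K)" if hs: "hs \<in> unit_tuples j" for hs
    unfolding L_def
  proof (rule order_trans[OF norm_sum sum_mono])
    fix m assume m: "m \<in> masks j"
    have u: "pick m hs \<in> unit_tuples (length (filter id m))" "omit m hs \<in> unit_tuples (length (filter Not m))"
      using pick_unit_tuples[of hs m] omit_unit_tuples[of hs m] m hs by auto
    have le: "length (filter id m) \<le> k" "length (filter Not m) \<le> k"
      using length_filter_id_Not[of m] m j by auto
    have "norm (G x (pick m hs) (omit m hs)) \<le> C * norm (P (length (filter id m)) x (pick m hs))"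
      using u le by (rule norm_G_le)
    also have "\<dots> \<le> C * K" using C(1) K(2)[OF le(1) u(1)] by (intro mult_left_mono) auto
    finally show "norm (G x (pick m hs) (omit m hs)) \<le> C * K" .
  qed
  then show "bounded (L j x ` unit_tuples j)" by (auto simp: bounded_iff)
qed

text \<open>
  Bounded convergence for a measure that does not depend on a direction.
\<close>

lemma P_product_pointwise:
  fixes R :: "'a \<Rightarrow> 'a list \<Rightarrow> 'a \<Rightarrow> 'v \<Rightarrow>\<^sub>L 'v"
  assumes R: "\<And>y b. b \<in> unit_tuples q \<Longrightarrow> R y b \<in> Cb E"
    and bound: "\<And>y b z. y \<noteq> x \<Longrightarrow> b \<in> unit_tuples q \<Longrightarrow> norm (R y b z) \<le> K"
    and lim: "\<And>z. uniform_limit (unit_tuples q) (\<lambda>y b. R y b z) (\<lambda>_. 0) (at x)"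
  shows "uniform_limit (unit_tuples 0 \<times> unit_tuples q) (\<lambda>y (a, b). sv_product E (P 0 x a) (R y b)) (\<lambda>_. 0) (at x)"
proof -
  have "P 0 x [] \<in> csv_space" by (rule P_csv) auto
  then have "uniform_limit (unit_tuples q) (\<lambda>y b. sv_product E (P 0 x []) (R y b)) (\<lambda>_. 0) (at x)"
    using assms by (rule uniform_limit_sv_product)
  then have lim: "uniform_limit (unit_tuples 0 \<times> unit_tuples q) (\<lambda>y ab. sv_product E (P 0 x []) (R y (snd ab))) (\<lambda>_. 0) (at x)"
    by (rule uniform_limit_compose'[where g="\<lambda>_. 0"]) auto
  show ?thesis
    by (rule uniform_limit_null_two[OF lim uniform_limit_zero tendsto_const, of 1]) (auto simp: unit_tuples_def)
qed

text \<open>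
  Convergence in the supremum norm allows derivatives of the orbit of any order.
\<close>

lemma P_product_lipschitz:
  fixes R :: "'a \<Rightarrow> 'a list \<Rightarrow> 'a \<Rightarrow> 'v \<Rightarrow>\<^sub>L 'v"
  assumes R: "\<And>y b. b \<in> unit_tuples q \<Longrightarrow> R y b \<in> Cb E" and p: "p \<le> k"
    and bound: "\<And>y b z. b \<in> unit_tuples q \<Longrightarrow> norm (R y b z) \<le> C * norm (y - x)"
  shows "uniform_limit (unit_tuples p \<times> unit_tuples q) (\<lambda>y (a, b). sv_product E (P p x a) (R y b)) (\<lambda>_. 0) (at x)"
proof -
  obtain K where K: "0 < K" "\<And>j hs. j \<le> k \<Longrightarrow> hs \<in> unit_tuples j \<Longrightarrow> norm (P j x hs) \<le> K"
    using P_bound[of x] by metis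
  show ?thesis
  proof (rule uniform_limit_null_two[OF uniform_limit_zero uniform_limit_zero])
    show "((\<lambda>y. C * norm (y - x) * K) \<longlongrightarrow> 0) (at x)" by (auto intro!: tendsto_eq_intros)
    show "\<forall>\<^sub>F y in at x. \<forall>s\<in>unit_tuples p \<times> unit_tuples q. norm (case s of (a, b) \<Rightarrow> sv_product E (P p x a) (R y b)) \<le>
        0 * norm (0::real) + norm (0::real) + C * norm (y - x) * K"
    proof (intro always_eventually allI ballI, clarify)
      fix y and a b :: "'a list" assume a: "a \<in> unit_tuples p" and b: "b \<in> unit_tuples q"
      have "norm (sv_product E (P p x a) (R y b)) \<le> C * norm (y - x) * norm (P p x a)"
        using a b p bound by (intro norm_sv_product_le P_csv R) (auto simp: unit_tuples_def)
      also have "\<dots> \<le> C * norm (y - x) * K"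
        using a C(1) p by (intro mult_left_mono K) auto
      finally show "norm (sv_product E (P p x a) (R y b)) \<le> 0 * norm (0::real) + norm (0::real) + C * norm (y - x) * K" by simp
    qed
  qed simp
qed

lemma filterlim_translate_at: "filterlim (\<lambda>y. z + y) (at (z + x)) (at x)"
  for x z :: "'x::real_normed_vector"
  by (rule filterlim_atI) (auto intro!: tendsto_intros simp: eventually_at_filter)

text \<open>
  The remainder of the expansion of \<open>\<phi>\<close>, multiplied by a derivative of the orbit of \<open>\<mu>\<close>. If
  \<open>q + 1 = k\<close>, then \<open>p = 0\<close>, so the measure does not depend on a direction and bounded convergence
  applies. Otherwise the derivative of order \<open>q + 1\<close> is Lipschitz and the remainder is of second
  order in the supremum norm.
\<close>

lemma remainder_right:
  assumes pq: "p + q < k"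
  shows "uniform_limit (unit_tuples p \<times> unit_tuples q)
    (\<lambda>y (a, b). sv_product E (P p x a)
      (\<lambda>z. (Q q (z + y) b - Q q (z + x) b - Q (Suc q) (z + x) ((y - x) # b)) /\<^sub>R norm (y - x)))
    (\<lambda>_. 0) (at x)"
proof -
  let ?R = "\<lambda>y b z. (Q q (z + y) b - Q q (z + x) b - Q (Suc q) (z + x) ((y - x) # b)) /\<^sub>R norm (y - x)"
  have p: "p \<le> k" and q: "q < k" using pq by auto
  have R_Cb: "?R y b \<in> Cb E" if "b \<in> unit_tuples q" for y b
    using that q by (intro Cb_scaleR Cb_diff subspace Q_Cb') (auto simp: unit_tuples_def)
  show ?thesis
  proof (cases "Suc q = k")
    case True
    then have p: "p = 0" using pq by simp
    show ?thesis
      unfolding p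
    proof (rule P_product_pointwise[OF R_Cb])
      fix y and b :: "'a list" and z assume y: "y \<noteq> x" and b: "b \<in> unit_tuples q"
      have "norm (Q q (z + y) b - Q q (z + x) b) \<le> C * norm (y - x)"
        using Q_lipschitz[OF q b, of "z + y" "z + x"] by simp
      then have "norm (Q q (z + y) b - Q q (z + x) b - Q (Suc q) (z + x) ((y - x) # b)) \<le> C * norm (y - x) + C * norm (y - x)"
        using norm_Q_Cons[of q b] q b by (intro norm_diff_le_add) auto
      then show "norm (?R y b z) \<le> 2 * C" using y by (simp add: divide_simps mult_ac)
    next
      fix z
      have "uniform_limit (unit_tuples q) (\<lambda>y b. (Q q y b - Q q (z + x) b - Q (Suc q) (z + x) ((y - (z + x)) # b)) /\<^sub>R norm (y - (z + x)))
          (\<lambda>_. 0) (at (z + x))"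
        using q by (rule Q.uniform_derivative)
      from filterlim_compose[OF this filterlim_translate_at]
      show "uniform_limit (unit_tuples q) (\<lambda>y b. ?R y b z) (\<lambda>_. 0) (at x)" by simp
    qed
  next
    case False
    then have q: "Suc q < k" using pq by simp
    show ?thesis
    proof (rule P_product_lipschitz[OF R_Cb p])
      fix y and b :: "'a list" and z assume b: "b \<in> unit_tuples q"
      show "norm (?R y b z) \<le> C * norm (y - x)"
      proof (cases "y = x")
        case False
        have "norm (Q q (z + y) b - Q q (z + x) b - Q (Suc q) (z + x) ((z + y - (z + x)) # b)) \<le> C * (norm (z + y - (z + x)))\<^sup>2"
          by (rule Q.norm_D_linearization_le[OF q _ b]) (use C q in auto)
        then show ?thesis using False by (simp add: divide_simps power2_eq_square mult_ac)
      qed simp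
    qed
  qed
qed

text \<open>
  The same dichotomy for the continuity of the derivatives of \<open>\<phi>\<close>, with \<open>q = k\<close> as the critical case.
\<close>

lemma continuity_right:
  assumes pq: "p + q \<le> k"
  shows "uniform_limit (unit_tuples p \<times> unit_tuples q)
    (\<lambda>y (a, b). sv_product E (P p x a) (\<lambda>z. Q q (z + y) b - Q q (z + x) b)) (\<lambda>_. 0) (at x)"
proof -
  let ?R = "\<lambda>y b z. Q q (z + y) b - Q q (z + x) b"
  have p: "p \<le> k" and q: "q \<le> k" using pq by auto
  have R_Cb: "?R y b \<in> Cb E" if "b \<in> unit_tuples q" for y b
    using that q by (intro Cb_diff subspace Q_Cb') (auto simp: unit_tuples_def)
  show ?thesis
  proof (cases "q = k")
    case True
    then have p: "p = 0" using pq by simp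
    show ?thesis
      unfolding p
    proof (rule P_product_pointwise[OF R_Cb])
      show "norm (?R y b z) \<le> C + C" if "b \<in> unit_tuples q" for y b z
        using that q C by (intro norm_diff_le_add) auto
      fix z
      have "uniform_limit (unit_tuples q) (\<lambda>y b. Q q y b - Q q (z + x) b) (\<lambda>_. 0) (at (z + x))"
        using Q_cont[of "z + x"] True uniform_limit_diff_iff by blast
      from filterlim_compose[OF this filterlim_translate_at]
      show "uniform_limit (unit_tuples q) (\<lambda>y b. ?R y b z) (\<lambda>_. 0) (at x)" .
    qed
  next
    case False
    then have q: "q < k" using pq by simp
    show ?thesis
    proof (rule P_product_lipschitz[OF R_Cb p])
      show "norm (?R y b z) \<le> C * norm (y - x)" if "b \<in> unit_tuples q" for y b z
        using Q_lipschitz[OF q that, of "z + y" "z + x"] by simp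
    qed
  qed
qed

text \<open>
  The product rule: the difference of products is expanded with the increment of the measure
  multiplied by the new value of the function.
\<close>

lemma G_derivative:
  assumes pq: "p + q < k"
  shows "uniform_limit (unit_tuples p \<times> unit_tuples q)
    (\<lambda>y (a, b). (G y a b - G x a b - (G x ((y - x) # a) b + G x a ((y - x) # b))) /\<^sub>R norm (y - x))
    (\<lambda>_. 0) (at x)"
proof -
  let ?S = "unit_tuples p \<times> unit_tuples q :: ('a list \<times> 'a list) set"
  let ?P1 = "\<lambda>y a. P p y a - P p x a - P (Suc p) x ((y - x) # a)"
  let ?R = "\<lambda>y b z. Q q (z + y) b - Q q (z + x) b - Q (Suc q) (z + x) ((y - x) # b)"
  obtain K where K: "0 < K" "\<And>j hs. j \<le> k \<Longrightarrow> hs \<in> unit_tuples j \<Longrightarrow> norm (P j x hs) \<le> K"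
    using P_bound[of x] by metis
  have p: "p < k" "q < k" using pq by auto
  have A: "uniform_limit ?S (\<lambda>y ab. ?P1 y (fst ab) /\<^sub>R norm (y - x)) (\<lambda>_. 0) (at x)"
    by (rule uniform_limit_compose'[OF P.uniform_derivative[OF p(1)]]) auto
  show ?thesis
  proof (rule uniform_limit_null_two[OF A remainder_right[OF pq]])
    show "((\<lambda>y. C * K * norm (y - x)) \<longlongrightarrow> 0) (at x)" by (auto intro!: tendsto_eq_intros)
    show "0 \<le> C" using C by simp
    have "\<forall>\<^sub>F y in at x. y \<noteq> x" by (simp add: eventually_at_filter)
    then show "\<forall>\<^sub>F y in at x. \<forall>ab\<in>?S.
      norm (case ab of (a, b) \<Rightarrow> (G y a b - G x a b - (G x ((y - x) # a) b + G x a ((y - x) # b))) /\<^sub>R norm (y - x)) \<le>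
      C * norm (?P1 y (fst ab) /\<^sub>R norm (y - x)) +
      norm (case ab of (a, b) \<Rightarrow> sv_product E (P p x a) (\<lambda>z. ?R y b z /\<^sub>R norm (y - x))) +
      C * K * norm (y - x)"
    proof eventually_elim
      case (elim y)
      show ?case
      proof
        fix ab assume "ab \<in> ?S"
        then obtain a b where ab: "ab = (a, b)" and a: "a \<in> unit_tuples p" and b: "b \<in> unit_tuples q" by auto
        have len: "length a = p" "length b = q" using a b by (auto simp: unit_tuples_def)
        let ?n = "inverse (norm (y - x))"
        have csv: "P p y a \<in> csv_space" "P p x a \<in> csv_space" "P (Suc p) x ((y - x) # a) \<in> csv_space"
          using len p by (auto intro: P_csv)
        have csv1: "?P1 y a \<in> csv_space" "P p y a - P p x a \<in> csv_space"
          by (intro subspace_diff subspace_csv_space csv)+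
        have cb: "(\<lambda>z. Q q (z + y) b) \<in> Cb E" "(\<lambda>z. Q q (z + x) b) \<in> Cb E" "(\<lambda>z. Q (Suc q) (z + x) ((y - x) # b)) \<in> Cb E"
          using len p by (auto intro: Q_Cb')
        have cb1: "(\<lambda>z. Q q (z + y) b - Q q (z + x) b) \<in> Cb E" "?R y b \<in> Cb E"
          by (intro Cb_diff subspace cb)+
        \<comment> \<open>the last summand is of second order: both of its factors are of first order in \<open>y - x\<close>\<close>
        have eq: "G y a b - G x a b - (G x ((y - x) # a) b + G x a ((y - x) # b)) =
            sv_product E (?P1 y a) (\<lambda>z. Q q (z + y) b) + sv_product E (P p x a) (?R y b) +
            sv_product E (P (Suc p) x ((y - x) # a)) (\<lambda>z. Q q (z + y) b - Q q (z + x) b)"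
          unfolding G_def
          by (simp add: len csv csv1 cb cb1 sv_product_diff_left sv_product_diff_right)
        have n1: "norm (?n *\<^sub>R sv_product E (?P1 y a) (\<lambda>z. Q q (z + y) b)) \<le> C * norm (?n *\<^sub>R ?P1 y a)"
        proof -
          have "norm (sv_product E (?P1 y a) (\<lambda>z. Q q (z + y) b)) \<le> C * norm (?P1 y a)"
            using C(2)[OF _ b] p by (intro norm_sv_product_le csv1 cb) auto
          then have "?n * norm (sv_product E (?P1 y a) (\<lambda>z. Q q (z + y) b)) \<le> ?n * (C * norm (?P1 y a))"
            by (rule mult_left_mono) simp
          then show ?thesis by (simp add: mult.left_commute)
        qed
        have n2: "?n *\<^sub>R sv_product E (P p x a) (?R y b) = sv_product E (P p x a) (\<lambda>z. ?n *\<^sub>R ?R y b z)"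
          using sv_product_scaleR_right[OF csv(2) cb1(2)] by simp
        have n3: "norm (?n *\<^sub>R sv_product E (P (Suc p) x ((y - x) # a)) (\<lambda>z. Q q (z + y) b - Q q (z + x) b)) \<le> C * K * norm (y - x)"
        proof -
          have "norm (sv_product E (P (Suc p) x ((y - x) # a)) (\<lambda>z. Q q (z + y) b - Q q (z + x) b)) \<le>
              C * norm (y - x) * norm (P (Suc p) x ((y - x) # a))"
          proof (rule norm_sv_product_le[OF csv(3) cb1(1)])
            show "norm (Q q (z + y) b - Q q (z + x) b) \<le> C * norm (y - x)" for z
              using Q_lipschitz[OF p(2) b, of "z + y" "z + x"] by simp
          qed
          also have "\<dots> \<le> C * norm (y - x) * (K * norm (y - x))"
            using C(1) p by (intro mult_left_mono norm_multilinear_first_le[OF P.multilinear a] K) auto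
          finally show ?thesis using elim by (simp add: divide_simps mult_ac)
        qed
        have "norm (?n *\<^sub>R (G y a b - G x a b - (G x ((y - x) # a) b + G x a ((y - x) # b)))) \<le>
            norm (?n *\<^sub>R sv_product E (?P1 y a) (\<lambda>z. Q q (z + y) b)) +
            norm (?n *\<^sub>R sv_product E (P p x a) (?R y b)) +
            norm (?n *\<^sub>R sv_product E (P (Suc p) x ((y - x) # a)) (\<lambda>z. Q q (z + y) b - Q q (z + x) b))"
          unfolding eq scaleR_add_right by (intro norm_triangle_le add_mono order_refl)
        also have "\<dots> \<le> C * norm (?n *\<^sub>R ?P1 y a) + norm (sv_product E (P p x a) (\<lambda>z. ?n *\<^sub>R ?R y b z)) + C * K * norm (y - x)"
          using n1 n3 unfolding n2 by linarith
        finally show "norm (case ab of (a, b) \<Rightarrow> (G y a b - G x a b - (G x ((y - x) # a) b + G x a ((y - x) # b))) /\<^sub>R norm (y - x)) \<le>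
            C * norm (?P1 y (fst ab) /\<^sub>R norm (y - x)) +
            norm (case ab of (a, b) \<Rightarrow> sv_product E (P p x a) (\<lambda>z. ?R y b z /\<^sub>R norm (y - x))) +
            C * K * norm (y - x)"
          unfolding ab case_prod_conv fst_conv .
      qed
    qed
  qed
qed

lemma G_continuous:
  assumes pq: "p + q \<le> k"
  shows "uniform_limit (unit_tuples p \<times> unit_tuples q) (\<lambda>y (a, b). G y a b - G x a b) (\<lambda>_. 0) (at x)"
proof -
  let ?S = "unit_tuples p \<times> unit_tuples q :: ('a list \<times> 'a list) set"
  let ?R = "\<lambda>y b z. Q q (z + y) b - Q q (z + x) b"
  have p: "p \<le> k" "q \<le> k" using pq by auto
  have "uniform_limit (unit_tuples p) (\<lambda>y a. P p y a - P p x a) (\<lambda>_. 0) (at x)"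
    using P_continuous[OF p(1)] uniform_limit_diff_iff by blast
  then have A: "uniform_limit ?S (\<lambda>y ab. P p y (fst ab) - P p x (fst ab)) (\<lambda>_. 0) (at x)"
    by (rule uniform_limit_compose'[where g="\<lambda>_. 0"]) auto
  show ?thesis
  proof (rule uniform_limit_null_two[OF A continuity_right[OF pq] tendsto_const])
    show "0 \<le> C" using C by simp
    show "\<forall>\<^sub>F y in at x. \<forall>ab\<in>?S. norm (case ab of (a, b) \<Rightarrow> G y a b - G x a b) \<le>
      C * norm (P p y (fst ab) - P p x (fst ab)) + norm (case ab of (a, b) \<Rightarrow> sv_product E (P p x a) (?R y b)) + 0"
    proof (intro always_eventually allI, clarsimp)
      fix y and a b :: "'a list" assume a: "a \<in> unit_tuples p" and b: "b \<in> unit_tuples q"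
      have len: "length a = p" "length b = q" using a b by (auto simp: unit_tuples_def)
      have csv: "P p y a \<in> csv_space" "P p x a \<in> csv_space" using len p by (auto intro: P_csv)
      have csv1: "P p y a - P p x a \<in> csv_space" by (intro subspace_diff subspace_csv_space csv)
      have cb: "(\<lambda>z. Q q (z + y) b) \<in> Cb E" "(\<lambda>z. Q q (z + x) b) \<in> Cb E" using len p by (auto intro: Q_Cb')
      have "G y a b - G x a b = sv_product E (P p y a - P p x a) (\<lambda>z. Q q (z + y) b) + sv_product E (P p x a) (?R y b)"
        unfolding G_def by (simp add: len csv cb sv_product_diff_left sv_product_diff_right)
      moreover have "norm (sv_product E (P p y a - P p x a) (\<lambda>z. Q q (z + y) b)) \<le> C * norm (P p y a - P p x a)"
        using C p b by (intro norm_sv_product_le csv1 cb) auto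
      ultimately show "norm (G y a b - G x a b) \<le> C * norm (P p y a - P p x a) + norm (sv_product E (P p x a) (?R y b))"
        by (simp add: norm_triangle_le)
    qed
  qed
qed

lemma masks_limit:
  fixes F :: "'a \<Rightarrow> 'a list \<Rightarrow> 'a list \<Rightarrow> ('a, 'v, 'w) sv_measure"
  assumes "\<And>p q. p + q = j \<Longrightarrow> uniform_limit (unit_tuples p \<times> unit_tuples q) (\<lambda>y (a, b). F y a b) (\<lambda>_. 0) (at x)"
  shows "uniform_limit (unit_tuples j) (\<lambda>y hs. \<Sum>m\<in>masks j. F y (pick m hs) (omit m hs)) (\<lambda>_. 0) (at x)"
proof -
  have "uniform_limit (unit_tuples j) (\<lambda>y hs. F y (pick m hs) (omit m hs)) (\<lambda>_. 0) (at x)" if m: "m \<in> masks j" for m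
  proof -
    have "uniform_limit (unit_tuples (length (filter id m)) \<times> unit_tuples (length (filter Not m)))
        (\<lambda>y (a, b). F y a b) (\<lambda>_. 0) (at x)"
      using length_filter_id_Not[of m] m by (intro assms) auto
    from uniform_limit_compose'[OF this, of "\<lambda>hs. (pick m hs, omit m hs)" "unit_tuples j"]
    show ?thesis using pick_unit_tuples[of _ m] omit_unit_tuples[of _ m] m by auto
  qed
  with finite_masks show ?thesis by (rule uniform_limit_null_sum)
qed

lemma frechet_L: "frechet_derivatives k (\<lambda>x. sv_of_measure (translate_measure x (product_measure E \<mu> \<phi>))) L"
  unfolding frechet_derivatives_def
proof (intro conjI allI impI)
  fix x
  have \<phi>: "\<phi> \<in> Cb E" using Q_Cb[of "[]" 0] by (simp add: Q.D_0)
  have m: "P.m \<in> csv_space" using continuous by (simp add: csv_space_def P.measure_of_m)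
  have "L 0 x [] = sv_product E (sv_translate x P.m) (\<lambda>z. \<phi> (z + x))"
    by (simp add: L_def masks_0 G_def P.D_0 P.orbit Q.D_0)
  also have "\<dots> = sv_translate x (sv_product E P.m \<phi>)" using sv_translate_product[OF m \<phi>] by simp
  also have "\<dots> = sv_of_measure (translate_measure x (product_measure E \<mu> \<phi>))"
    by (simp add: sv_translate_def measure_of_sv_product[OF m \<phi>] P.measure_of_m)
  finally show "L 0 x [] = sv_of_measure (translate_measure x (product_measure E \<mu> \<phi>))" .
next
  show "bounded_multilinear j (L j x)" if "j \<le> k" for j x using multilinear_L[OF that] .
next
  fix j x assume j: "j < k"
  have "uniform_limit (unit_tuples j) (\<lambda>y hs. \<Sum>m\<in>masks j.
      (G y (pick m hs) (omit m hs) - G x (pick m hs) (omit m hs) -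
        (G x ((y - x) # pick m hs) (omit m hs) + G x (pick m hs) ((y - x) # omit m hs))) /\<^sub>R norm (y - x)) (\<lambda>_. 0) (at x)"
    by (rule masks_limit) (use j in \<open>auto intro: G_derivative\<close>)
  moreover have "(\<Sum>m\<in>masks j. (G y (pick m hs) (omit m hs) - G x (pick m hs) (omit m hs) -
        (G x ((y - x) # pick m hs) (omit m hs) + G x (pick m hs) ((y - x) # omit m hs))) /\<^sub>R norm (y - x)) =
      (L j y hs - L j x hs - L (Suc j) x ((y - x) # hs)) /\<^sub>R norm (y - x)" for y hs
    unfolding L_def sum_masks_Suc by (simp add: scaleR_sum_right sum_subtractf[symmetric])
  ultimately show "uniform_limit (unit_tuples j)
      (\<lambda>y hs. (L j y hs - L j x hs - L (Suc j) x ((y - x) # hs)) /\<^sub>R norm (y - x)) (\<lambda>_. 0) (at x)" by simp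
qed

lemma L_continuous: "uniform_limit (unit_tuples k) (L k) (L k x) (at x)"
proof -
  have "uniform_limit (unit_tuples k) (\<lambda>y hs. \<Sum>m\<in>masks k. G y (pick m hs) (omit m hs) - G x (pick m hs) (omit m hs)) (\<lambda>_. 0) (at x)"
    by (rule masks_limit) (auto intro: G_continuous)
  then show ?thesis
    unfolding L_def[abs_def] by (subst uniform_limit_diff_iff) (simp add: sum_subtractf)
qed

end

section \<open>Mixed derivatives of the product\<close>

context leibniz
begin

lemma \<phi>_Cb: "\<phi> \<in> Cb E"
  using Q_Cb[of "[]" 0] by (simp add: Q.D_0)

lemma csv_product_\<mu>: "csv_product E \<mu>"
  using continuous P.\<mu>_CA P.\<mu>_finite
  by (simp add: csv_product_def operator_space_axioms csv_measure_def)

sublocale PQ: translation_family k "product_measure E \<mu> \<phi>" L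
proof -
  interpret csv_product E \<mu> by (rule csv_product_\<mu>)
  show "translation_family k (product_measure E \<mu> \<phi>) L"
    using product_measure_in_CA[OF \<phi>_Cb, of UNIV] finite_semivariation_product_measure[OF \<phi>_Cb] frechet_L
    by (simp add: translation_family_def translation_family_axioms_def frechet_family_def)
qed

lemma C_k_sv_product:
  assumes "product_measure E \<mu> \<phi> \<in> CA Y"
  shows "product_measure E \<mu> \<phi> \<in> C_k_sv k Y"
  using assms PQ.\<mu>_finite PQ.frechet L_continuous unfolding C_k_sv_def C_k_def by blast

lemma mixed_derivative_product:
  assumes h: "size h \<le> k"
  shows "mixed_derivative fomin_derivative h (product_measure E \<mu> \<phi>) A =
    (\<Sum>(\<alpha>, \<beta>)\<in>{(\<alpha>, \<beta>). \<alpha> + \<beta> = h}. multibinomial \<alpha> \<beta> *\<^sub>R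
      product_measure E (mixed_derivative fomin_derivative \<alpha> \<mu>) (mixed_derivative directional_derivative \<beta> \<phi>) A)"
proof -
  obtain xs where xs: "mset xs = h" using ex_mset by blast
  then have len: "length xs \<le> k" using h by (metis size_mset)
  let ?g = "\<lambda>\<alpha> \<beta>. product_measure E (mixed_derivative fomin_derivative \<alpha> \<mu>) (mixed_derivative directional_derivative \<beta> \<phi>) A"
  have "mixed_derivative fomin_derivative h (product_measure E \<mu> \<phi>) A = measure_of_sv (L (length xs) 0 xs) A"
    using PQ.mixed_fomin_derivative[OF len] xs by simp
  also have "\<dots> = (\<Sum>m\<in>masks (length xs). measure_of_sv (G 0 (pick m xs) (omit m xs)) A)"
    by (simp add: L_def measure_of_sv_sum)
  also have "\<dots> = (\<Sum>m\<in>masks (length xs). ?g (mset (pick m xs)) (mset (omit m xs)))"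
  proof (rule sum.cong[OF refl])
    fix m assume "m \<in> masks (length xs)"
    then have le: "length (pick m xs) \<le> k" "length (omit m xs) \<le> k"
      using lengths_le[of m xs] len by auto
    show "measure_of_sv (G 0 (pick m xs) (omit m xs)) A = ?g (mset (pick m xs)) (mset (omit m xs))"
      unfolding G_def P.mixed_fomin_derivative[OF le(1)] Q.mixed_directional_derivative[OF le(2)]
      using measure_of_sv_product[OF P_csv[OF refl le(1)] Q_Cb[OF refl le(2)], of 0] by simp
  qed
  also have "\<dots> = (\<Sum>(\<alpha>, \<beta>)\<in>{(\<alpha>, \<beta>). \<alpha> + \<beta> = mset xs}. multibinomial \<alpha> \<beta> *\<^sub>R ?g \<alpha> \<beta>)"
    by (rule sum_masks_eq_sum_splittings)
  finally show ?thesis using xs by simp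
qed

end

section \<open>Operators that are linear over the scalar field\<close>

lemma bounded_ops_iff:
  assumes "normed_space_over sV" "normed_space_over sW"
  shows "T \<in> bounded_ops sV sW \<longleftrightarrow> (\<forall>a x. blinfun_apply T (sV a x) = sW a (blinfun_apply T x))"
proof -
  have "vector_space sV" "vector_space sW" using assms by (simp_all add: normed_space_over_def)
  then show ?thesis
    by (auto simp: bounded_ops_def Vector_Spaces.linear_def module_hom_def module_hom_axioms_def
        module_iff_vector_space blinfun.add_right)
qed

context normed_space_over
begin

lemma scale_scaleR: "scale a (r *\<^sub>R x) = r *\<^sub>R scale a x"
  by (simp add: scale_of_real[symmetric] scale_left_commute)

lemma bounded_linear_scale: "bounded_linear (scale a)"
  by (rule bounded_linear_intro[of _ "norm a"])
    (simp_all add: scale_right_distrib scale_scaleR norm_scale mult.commute)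

end

lemma closed_subspace_bounded_ops:
  assumes "normed_space_over sV" "normed_space_over sW"
  shows "subspace (bounded_ops sV sW)" "closed (bounded_ops sV sW)"
proof -
  interpret W: normed_space_over sW by fact
  note iff = bounded_ops_iff[OF assms]
  show "subspace (bounded_ops sV sW)"
    by (rule subspaceI)
      (simp_all add: iff blinfun.add_left blinfun.scaleR_left W.scale_right_distrib W.scale_scaleR)
  have "bounded_ops sV sW = {T. \<forall>a x. blinfun_apply T (sV a x) = sW a (blinfun_apply T x)}"
    using iff by auto
  moreover have "closed {T. \<forall>a x. blinfun_apply T (sV a x) = sW a (blinfun_apply T x)}"
    by (intro closed_Collect_all closed_Collect_eq continuous_intros
        bounded_linear.continuous_on[OF W.bounded_linear_scale])
  ultimately show "closed (bounded_ops sV sW)" by simp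
qed

lemma operator_space_bounded_ops:
  fixes sV :: "'f::real_normed_field \<Rightarrow> 'v::banach \<Rightarrow> 'v"
  assumes "normed_space_over sV"
  shows "operator_space (bounded_ops sV sV)"
  using closed_subspace_bounded_ops[OF assms assms]
  by unfold_locales (simp_all add: bounded_ops_iff[OF assms assms])

lemma bounded_ops_compose:
  assumes "normed_space_over sV" "normed_space_over sW" "T \<in> bounded_ops sV sW" "F \<in> bounded_ops sV sV"
  shows "T o\<^sub>L F \<in> bounded_ops sV sW"
  using assms by (simp add: bounded_ops_iff)

theorem theorem3p4p2:
  fixes sV :: "'f::real_normed_field \<Rightarrow> 'v::banach \<Rightarrow> 'v"
    and sW :: "'f \<Rightarrow> 'w::banach \<Rightarrow> 'w"
    and \<mu> :: "(real ^ 'd) set \<Rightarrow> 'v \<Rightarrow>\<^sub>L 'w"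
    and \<phi> :: "real ^ 'd \<Rightarrow> 'v \<Rightarrow>\<^sub>L 'v"
    and k :: nat
  assumes "normed_space_over sV" and "normed_space_over sW"
    and "\<mu> \<in> C_k_sv k (bounded_ops sV sW)"
    and "continuous_semivariation \<mu>"
    and "\<phi> \<in> C_B_k k (bounded_ops sV sV)"
  shows "product_measure (bounded_ops sV sV) \<mu> \<phi> \<in> C_k_sv k (bounded_ops sV sW) \<and>
    (\<forall>h :: (real ^ 'd) multiset. size h \<le> k \<longrightarrow>
      (\<forall>A\<in>sets borel.
        mixed_derivative fomin_derivative h (product_measure (bounded_ops sV sV) \<mu> \<phi>) A =
        (\<Sum>(\<alpha>, \<beta>)\<in>{(\<alpha>, \<beta>). \<alpha> + \<beta> = h}. multibinomial \<alpha> \<beta> *\<^sub>R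
          product_measure (bounded_ops sV sV)
            (mixed_derivative fomin_derivative \<alpha> \<mu>)
            (mixed_derivative directional_derivative \<beta> \<phi>) A)))"
proof -
  let ?E = "bounded_ops sV sV" and ?Y = "bounded_ops sV sW"
  have \<mu>: "\<mu> \<in> CA ?Y" "semivariation UNIV \<mu> UNIV < \<infinity>"
    using assms(3) by (simp_all add: C_k_sv_def)
  obtain P where P: "frechet_derivatives k (\<lambda>x. sv_of_measure (translate_measure x \<mu>)) P"
    "\<And>x. uniform_limit (unit_tuples k) (P k) (P k x) (at x)"
    using assms(3) by (auto simp: C_k_sv_def C_k_def)
  obtain Q where Q: "frechet_derivatives k \<phi> Q" "\<And>x. uniform_limit (unit_tuples k) (Q k) (Q k x) (at x)"
    "\<And>j. j \<le> k \<Longrightarrow> bounded (\<Union>x. Q j x ` unit_tuples j)" and \<phi>: "range \<phi> \<subseteq> ?E"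
    using assms(5) by (auto simp: C_B_k_def)
  interpret operator_space ?E by (rule operator_space_bounded_ops[OF assms(1)])
  interpret leibniz ?E k \<mu> P \<phi> Q
  proof
    show "\<mu> \<in> CA UNIV" using \<mu>(1) CA_subset[of ?Y UNIV] by blast
  qed (use \<mu> P Q \<phi> assms(4) in auto)
  have "product_measure ?E \<mu> \<phi> \<in> CA ?Y"
    using csv_product.product_measure_in_CA[OF csv_product_\<mu> \<phi>_Cb closed_subspace_bounded_ops(2,1)[OF assms(1,2)]]
      bounded_ops_compose[OF assms(1,2)] CA_value[OF \<mu>(1)] by blast
  then show ?thesis using C_k_sv_product mixed_derivative_product by blast
qed

end
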